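(* Let $d,m,n\in\mathbb{N}$, let $a_1,\ldots,a_n\in\mathbb{C}^{d\times m}$ be deterministic matrices, and let $x=\sum_{i=1}^n a_i\otimes s_i$, where $s_1,\ldots,s_n$ is a free semicircular family. Then $$\mathrm{s}_{\rm max}(x)^2=\inf_{\substack{z>0\\ \sum_j a_j^*za_j<\mathbf{1}}}\lambda_{\rm max}\Bigg(z^{-1}+\sum_{i=1}^n a_i\Bigg(\mathbf{1}-\sum_{j=1}^n a_j^*za_j\Bigg)^{-1}a_i^*\Bigg)$$ and $$\mathrm{s}_{\rm min}(x)^2=\sup_{z<0}\,\lambda_{\rm min}\Bigg(z^{-1}+\sum_{i=1}^n a_i\Bigg(\mathbf{1}-\sum_{j=1}^n a_j^*za_j\Bigg)^{-1}a_i^*\Bigg),$$ where $z$ ranges over $\mathbb{C}^{d\times d}_{\rm s.a.}$.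
   Context: $\mathbb{C}^{d\times d}_{\rm s.a.}$ is the set of self-adjoint $d\times d$ complex matrices; $\mathbf{1}$ is the identity (matrix or operator); $A>B$ for self-adjoint $A,B$ means $A-B$ is positive definite, and $z<0$ means $-z>0$. For self-adjoint $y$ with spectrum $\mathrm{sp}(y)$, $\lambda_{\rm max}(y)=\sup\mathrm{sp}(y)$ and $\lambda_{\rm min}(y)=\inf\mathrm{sp}(y)$. The largest and smallest singular values are $\mathrm{s}_{\rm max}(x)=\sup\mathrm{sp}((xx^* )^{1/2})$ and $\mathrm{s}_{\rm min}(x)=\inf\mathrm{sp}((xx^* )^{1/2})$. A free semicircular family $s_1,\ldots,s_n$ is a family of freely independent self-adjoint elements of a $C^*$-probability space $(\mathcal{S},\tau)$ with faithful trace $\tau$, each having the standard semicircular distribution (density $\frac{1}{2\pi}\sqrt{4-t^2}$ on $[-2,2]$). The element $x\in\mathbb{C}^{d\times m}\otimes\mathcal{S}$ is regarded as a $d\times m$ matrix with entries in $\mathcal{S}$, so that $xx^*\in\mathbb{C}^{d\times d}\otimes\mathcal{S}$. *)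

theory Defs
  imports "HOL-Analysis.Analysis" "HOL-Probability.Probability_Measure"
begin

section \<open>C*-probability spaces\<close>

text \<open>Unital C*-algebras over the complex numbers. The library has only real normed algebras, so
  the complex scalar multiplication is added here, compatible with the real one.\<close>

class cstar_algebra = banach + real_normed_algebra_1 +
  fixes scaleC :: "complex \<Rightarrow> 'a \<Rightarrow> 'a" (infixr \<open>*\<^sub>C\<close> 75)
    and star :: "'a \<Rightarrow> 'a"
  assumes scaleC_add_right: "c *\<^sub>C (x + y) = c *\<^sub>C x + c *\<^sub>C y"
    and scaleC_add_left: "(c + c') *\<^sub>C x = c *\<^sub>C x + c' *\<^sub>C x"
    and scaleC_scaleC: "c *\<^sub>C (c' *\<^sub>C x) = (c * c') *\<^sub>C x"
    and scaleC_of_real: "complex_of_real r *\<^sub>C x = r *\<^sub>R x"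
    and mult_scaleC_left: "(c *\<^sub>C x) * y = c *\<^sub>C (x * y)"
    and mult_scaleC_right: "x * (c *\<^sub>C y) = c *\<^sub>C (x * y)"
    and norm_scaleC: "norm (c *\<^sub>C x) = cmod c * norm x"
    and star_star: "star (star x) = x"
    and star_add: "star (x + y) = star x + star y"
    and star_scaleC: "star (c *\<^sub>C x) = cnj c *\<^sub>C star x"
    and star_mult: "star (x * y) = star y * star x"
    and cstar_identity: "norm (star x * x) = (norm x)\<^sup>2"

instantiation complex :: cstar_algebra
begin

definition scaleC_complex_def: "(c::complex) *\<^sub>C (x::complex) = c * x"
definition star_complex_def: "star (x::complex) = cnj x"

instance
  by standard
    (auto simp: scaleC_complex_def star_complex_def algebra_simps scaleR_conv_of_real
       norm_mult power2_eq_square)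

end

definition faithful_tracial_state :: "('a::cstar_algebra \<Rightarrow> complex) \<Rightarrow> bool" where
  "faithful_tracial_state \<tau> \<longleftrightarrow>
     (\<forall>x y. \<tau> (x + y) = \<tau> x + \<tau> y) \<and>
     (\<forall>c x. \<tau> (c *\<^sub>C x) = c * \<tau> x) \<and>
     \<tau> 1 = 1 \<and>
     (\<forall>x. \<tau> (star x * x) \<in> \<real> \<and> 0 \<le> Re (\<tau> (star x * x))) \<and>
     (\<forall>x y. \<tau> (x * y) = \<tau> (y * x)) \<and>
     (\<forall>x. \<tau> (star x * x) = 0 \<longrightarrow> x = 0)"


section \<open>Free semicircular families\<close>

text \<open>The unital *-subalgebra generated by a set.\<close>

inductive_set star_subalgebra :: "'a::cstar_algebra set \<Rightarrow> 'a set" for X where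
  gen: "x \<in> X \<Longrightarrow> x \<in> star_subalgebra X"
| one: "1 \<in> star_subalgebra X"
| add: "x \<in> star_subalgebra X \<Longrightarrow> y \<in> star_subalgebra X \<Longrightarrow> x + y \<in> star_subalgebra X"
| mult: "x \<in> star_subalgebra X \<Longrightarrow> y \<in> star_subalgebra X \<Longrightarrow> x * y \<in> star_subalgebra X"
| scale: "x \<in> star_subalgebra X \<Longrightarrow> c *\<^sub>C x \<in> star_subalgebra X"
| star: "x \<in> star_subalgebra X \<Longrightarrow> star x \<in> star_subalgebra X"

text \<open>Freeness: the trace vanishes on every alternating product of centered elements. Such a
  product is encoded as a list of pairs (index, element of the algebra with that index).\<close>

definition freely_independent ::
    "('a::cstar_algebra \<Rightarrow> complex) \<Rightarrow> 'i set \<Rightarrow> ('i \<Rightarrow> 'a) \<Rightarrow> bool" where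
  "freely_independent \<tau> I s \<longleftrightarrow>
     (\<forall>w :: ('i \<times> 'a) list. w \<noteq> [] \<longrightarrow> distinct_adj (map fst w) \<longrightarrow>
        (\<forall>(i, b) \<in> set w. i \<in> I \<and> b \<in> star_subalgebra {s i} \<and> \<tau> b = 0) \<longrightarrow>
        \<tau> (prod_list (map snd w)) = 0)"

text \<open>The distribution of a self-adjoint element is the compactly supported probability measure
  on the real line with the same moments; compact support makes it unique.\<close>

definition has_distribution ::
    "('a::cstar_algebra \<Rightarrow> complex) \<Rightarrow> 'a \<Rightarrow> real measure \<Rightarrow> bool" where
  "has_distribution \<tau> x \<mu> \<longleftrightarrow>
     star x = x \<and> prob_space \<mu> \<and> sets \<mu> = sets borel \<and> (\<exists>C. AE t in \<mu>. \<bar>t\<bar> \<le> C) \<and>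
     (\<forall>k::nat. \<tau> (x ^ k) = complex_of_real (\<integral>t. t ^ k \<partial>\<mu>))"

definition semicircle_law :: "real measure" where
  "semicircle_law =
     density lborel (\<lambda>t. ennreal (indicator {-2..2} t * (1 / (2 * pi) * sqrt (4 - t\<^sup>2))))"

definition free_semicircular_family ::
    "('a::cstar_algebra \<Rightarrow> complex) \<Rightarrow> 'i set \<Rightarrow> ('i \<Rightarrow> 'a) \<Rightarrow> bool" where
  "free_semicircular_family \<tau> I s \<longleftrightarrow>
     freely_independent \<tau> I s \<and> (\<forall>i\<in>I. has_distribution \<tau> (s i) semicircle_law)"


section \<open>Matrices over a C*-algebra\<close>

text \<open>Matrices with entries in a C*-algebra are elements of \<open>'a ^ 'm ^ 'd\<close> (rows indexed by
  \<open>'d\<close>), multiplied by \<open>**\<close>. Everything below applies both to this algebra and, with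
  \<open>'a = complex\<close>, to scalar matrices.\<close>

definition mat_star :: "'a::cstar_algebra ^ 'm ^ 'd \<Rightarrow> 'a ^ 'd ^ 'm" where
  "mat_star A = (\<chi> i j. star (A $ j $ i))"

definition mat_tensor :: "complex ^ 'm ^ 'd \<Rightarrow> 'a::cstar_algebra \<Rightarrow> 'a ^ 'm ^ 'd"
    (infixl \<open>\<otimes>\<^sub>M\<close> 70) where
  "A \<otimes>\<^sub>M s = (\<chi> i j. (A $ i $ j) *\<^sub>C s)"

definition spectrum :: "'a::cstar_algebra ^ 'd ^ 'd \<Rightarrow> complex set" where
  "spectrum y = {c. \<not> invertible (y - mat (c *\<^sub>C 1))}"

text \<open>Meant for self-adjoint \<open>y\<close>, whose spectrum is real; the set is then just the spectrum, viewed
  as a (nonempty compact) set of reals.\<close>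

definition lambda_max :: "'a::cstar_algebra ^ 'd ^ 'd \<Rightarrow> real" where
  "lambda_max y = Sup {t. complex_of_real t \<in> spectrum y}"

definition lambda_min :: "'a::cstar_algebra ^ 'd ^ 'd \<Rightarrow> real" where
  "lambda_min y = Inf {t. complex_of_real t \<in> spectrum y}"

definition positive_elem :: "'a::cstar_algebra ^ 'd ^ 'd \<Rightarrow> bool" where
  "positive_elem y \<longleftrightarrow> mat_star y = y \<and> spectrum y \<subseteq> complex_of_real ` {0..}"

text \<open>The positive square root; it exists and is unique for positive \<open>y\<close>, since the square
  matrices over a C*-algebra form a C*-algebra.\<close>

definition mat_sqrt :: "'a::cstar_algebra ^ 'd ^ 'd \<Rightarrow> 'a ^ 'd ^ 'd" where
  "mat_sqrt y = (THE h. positive_elem h \<and> h ** h = y)"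

definition s_max :: "'a::cstar_algebra ^ 'm ^ 'd \<Rightarrow> real" where
  "s_max x = lambda_max (mat_sqrt (x ** mat_star x))"

definition s_min :: "'a::cstar_algebra ^ 'm ^ 'd \<Rightarrow> real" where
  "s_min x = lambda_min (mat_sqrt (x ** mat_star x))"

definition positive_definite :: "complex ^ 'd ^ 'd \<Rightarrow> bool" where
  "positive_definite A \<longleftrightarrow>
     mat_star A = A \<and> (\<forall>v. v \<noteq> 0 \<longrightarrow> 0 < Re (\<Sum>i\<in>UNIV. cnj (v $ i) * (A *v v) $ i))"

end

(* In the free Fock space the semicirculars are s_i = l_i + l_i^*, so x = V + U^* with V, U the sums
   of a_i \<otimes> l_i and a_i^* \<otimes> l_i. These satisfy V^* z V = \<Sum> a_i^* z a_i = 1 - W and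
   U^* W^{-1} U = \<Sum> a_i W^{-1} a_i^*, and two applications of 2 Re <p, q> <= <p, z p> + <q, z^{-1} q> give
   x x^* <= z^{-1} + U^* W^{-1} U for admissible z > 0, and the reverse inequality for z < 0.
   Conversely, for t outside the convex hull of the spectrum of x x^*, put z = E[(t - x x^* )^{-1}] and
   Q = E[1 + x^* (t - x x^* )^{-1} x], where E = id \<otimes> \<tau>. Splitting off the last letter of a word gives the
   Dyson equations t = z^{-1} + \<Sum> a_i Q a_i^* and Q W Q = Q. For t above the spectrum Q is positive, so
   Q = W^{-1}; for t below it Q <= W^{-1}. Either way this z is optimal up to t.
   No Hilbert space is completed: all inequalities are tested on the pre-Hilbert space of columns over
   the algebra with the inner product of \<tau>. The GNS representation of a faithful trace is isometric,
   hence strict inequalities of forms yield inverses in the algebra itself. *)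

theory Submission
  imports Defs
begin

text \<open>The algebra may be larger than the one generated by the semicirculars, so for a general
  element only Bessel's inequality holds in the Fock basis; Parseval is available for polynomials.
  The variational bounds are therefore first known on polynomial columns. They extend because
  matrices act from the left and commute with right multiplication by elements of the algebra, which
  is bounded since \<tau> is a trace. The Dyson equations need Bessel only: they are coefficientwise
  identities into which resolvents enter as square-summable families. They come from the block
  operator with diagonal t, 1 and off-diagonal -x, -x^*; t enters linearly, so t = 0 and t < 0 need
  no separate treatment. The diagonal blocks of its inverse have expectations z and Q, and the
  off-diagonal expectations drop out by parity of word length. Below the spectrum the sign of Q is
  not controlled and Q W Q = Q cannot be cancelled; but D = W^{-1} - Q satisfies D W D = D, so D
  \<ge> 0 as W > 0, and the lower bound needs no more.\<close>

section \<open>Square roots in a C*-algebra\<close>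

lemma star_scaleR: "star (r *\<^sub>R x) = r *\<^sub>R star (x::'a::cstar_algebra)"
  by (metis complex_cnj_complex_of_real scaleC_of_real star_scaleC)

lemma star_zero [simp]: "star (0::'a::cstar_algebra) = 0"
  using star_scaleR[of 0 "0::'a"] by simp

lemma star_minus: "star (- x) = - star (x::'a::cstar_algebra)"
  using star_scaleR[of "-1" x] by simp

lemma star_diff: "star (x - y) = star x - star (y::'a::cstar_algebra)"
  using star_add[of x "-y"] by (simp add: star_minus)

lemma star_one [simp]: "star (1::'a::cstar_algebra) = 1"
  by (metis mult.left_neutral mult.right_neutral star_mult star_star)

lemma star_sum: "star (sum f S) = (\<Sum>k\<in>S. star (f k :: 'a::cstar_algebra))"
  by (induction S rule: infinite_finite_induct) (auto simp: star_add)

lemma norm_star [simp]: "norm (star x) = norm (x::'a::cstar_algebra)"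
proof -
  have *: "norm y \<le> norm (star y)" for y :: 'a
  proof (cases "y = 0")
    case False
    have "norm y * norm y \<le> norm (star y) * norm y"
      using norm_mult_ineq[of "star y" y] by (simp add: cstar_identity power2_eq_square)
    then show ?thesis using False by simp
  qed auto
  show ?thesis using *[of x] *[of "star x"] by (simp add: star_star)
qed

lemma bounded_linear_star: "bounded_linear (star :: 'a::cstar_algebra \<Rightarrow> 'a)"
  by (rule bounded_linear_intro[where K=1]) (auto simp: star_add star_scaleR)

lemmas continuous_on_star [continuous_intros] = bounded_linear.continuous_on[OF bounded_linear_star]

lemma scaleC_zero_left [simp]: "0 *\<^sub>C x = (0::'a::cstar_algebra)"
  using scaleC_of_real[of 0 x] by simp

lemma scaleC_one [simp]: "1 *\<^sub>C x = (x::'a::cstar_algebra)"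
  using scaleC_of_real[of 1 x] by simp

lemma scaleC_zero_right [simp]: "c *\<^sub>C 0 = (0::'a::cstar_algebra)"
  using scaleC_scaleC[of c 0 "0::'a"] by simp

lemma scaleC_minus_left: "(- c) *\<^sub>C x = - (c *\<^sub>C (x::'a::cstar_algebra))"
  by (metis add_eq_0_iff add.right_inverse scaleC_add_left scaleC_zero_left)

lemma scaleC_minus_right: "c *\<^sub>C (- x) = - (c *\<^sub>C (x::'a::cstar_algebra))"
  by (metis add_eq_0_iff add.right_inverse scaleC_add_right scaleC_zero_right)

lemma scaleC_diff_right: "c *\<^sub>C (x - y) = c *\<^sub>C x - c *\<^sub>C (y::'a::cstar_algebra)"
  using scaleC_add_right[of c x "-y"] by (simp add: scaleC_minus_right)

text \<open>Source of every Cauchy-Schwarz inequality below. The forms may be degenerate, so neither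
  the sign of \<open>C\<close> nor \<open>C \<noteq> 0\<close> is assumed.\<close>

lemma real_discriminant:
  fixes A B C :: real
  assumes "\<And>t. 0 \<le> A + 2 * t * B + t\<^sup>2 * C"
  shows "B\<^sup>2 \<le> A * C"
proof (cases "C = 0")
  case True
  have "B = 0"
  proof (rule ccontr)
    assume "B \<noteq> 0"
    \<comment> \<open>This \<open>t\<close> gives the linear function the value -1.\<close>
    then have "2 * (- (A + 1) / (2 * B)) * B = - (A + 1)" by (simp add: field_simps)
    with assms[of "- (A + 1) / (2 * B)"] True show False by simp
  qed
  then show ?thesis using True by simp
next
  case False
  have "0 \<le> C"
  proof (rule ccontr)
    assume C: "\<not> 0 \<le> C"
    have sum: "0 \<le> A + t\<^sup>2 * C" for t
      using assms[of t] assms[of "-t"] by simp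
    \<comment> \<open>Since t \<ge> 1 and C < 0, t^2 C \<le> t C = C - |A|, which is too
      negative.\<close>
    define t where "t = 1 + \<bar>A\<bar> / \<bar>C\<bar>"
    have "0 \<le> \<bar>A\<bar> / \<bar>C\<bar>" by (rule divide_nonneg_nonneg) auto
    then have "t \<ge> 1" unfolding t_def by linarith
    then have "t\<^sup>2 \<ge> t" by (simp add: power2_eq_square)
    then have "t\<^sup>2 * C \<le> t * C" using C by (simp add: mult_right_mono_neg)
    moreover have "t * C = C - \<bar>A\<bar>" using C by (simp add: t_def field_simps)
    ultimately show False using sum[of t] C by linarith
  qed
  then have "C > 0" using False by simp
  \<comment> \<open>The vertex of the parabola.\<close>
  have "0 \<le> C * (A + 2 * (- B / C) * B + (- B / C)\<^sup>2 * C)"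
    using assms[of "- B / C"] \<open>C > 0\<close> by simp
  also have "\<dots> = A * C - B\<^sup>2" using \<open>C > 0\<close> by (simp add: field_simps power2_eq_square)
  finally show ?thesis by simp
qed

text \<open>Completeness enters through this majorant test, which serves the square root iteration
  and the Neumann series.\<close>

lemma convergent_if_dominated_increments:
  fixes y :: "nat \<Rightarrow> 'b::banach" and \<eta> :: "nat \<Rightarrow> real"
  assumes inc: "\<And>k. norm (y (Suc k) - y k) \<le> C * (\<eta> (Suc k) - \<eta> k)" and "convergent \<eta>"
  shows "convergent y"
proof -
  have "0 \<le> C * (\<eta> (Suc k) - \<eta> k)" for k using inc[of k] norm_ge_zero order_trans by blast
  have tel: "norm (y (k + j) - y k) \<le> C * (\<eta> (k + j) - \<eta> k)" for k j
  proof (induction j)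
    case (Suc j)
    have "norm (y (k + Suc j) - y k) \<le> norm (y (Suc (k + j)) - y (k + j)) + norm (y (k + j) - y k)"
      by (metis add_Suc_right norm_triangle_sub diff_add_cancel norm_triangle_ineq add_diff_eq)
    also have "\<dots> \<le> C * (\<eta> (Suc (k + j)) - \<eta> (k + j)) + C * (\<eta> (k + j) - \<eta> k)"
      using inc[of "k + j"] Suc by linarith
    finally show ?case by (simp add: algebra_simps)
  qed auto
  have C\<eta>: "Cauchy (\<lambda>k. C * \<eta> k)"
    using assms(2) by (intro convergent_Cauchy convergent_mult convergent_const)
  have "Cauchy y"
    unfolding Cauchy_def
  proof (intro allI impI)
    fix e :: real assume "0 < e"
    then obtain M where M: "\<And>m n. m \<ge> M \<Longrightarrow> n \<ge> M \<Longrightarrow> dist (C * \<eta> m) (C * \<eta> n) < e"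
      using C\<eta> unfolding Cauchy_def by blast
    have *: "dist (y m) (y n) < e" if "n \<ge> M" "m \<ge> n" for m n
    proof -
      have "dist (y m) (y n) \<le> C * (\<eta> m - \<eta> n)"
        using tel[of n "m - n"] that by (simp add: dist_norm)
      also have "\<dots> \<le> dist (C * \<eta> m) (C * \<eta> n)" by (simp add: dist_real_def algebra_simps)
      finally show ?thesis using M[of m n] that by simp
    qed
    show "\<exists>M. \<forall>m\<ge>M. \<forall>n\<ge>M. dist (y m) (y n) < e"
      using * by (metis dist_commute nat_le_linear)
  qed
  then show ?thesis by (simp add: Cauchy_convergent_iff)
qed

text \<open>A solution of \<open>2 y = b + y\<^sup>2\<close> gives a square root \<open>1 - y\<close> of \<open>1 - b\<close>. The iterates are
  polynomials in \<open>b\<close> with nonnegative coefficients, hence are dominated by the iterates for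
  \<open>b = 1\<close>. The size estimate \<open>bnd\<close> is abstract because for matrices it is not the norm of the type.\<close>

lemma sqrt_fixpoint:
  fixes mul :: "'b::banach \<Rightarrow> 'b \<Rightarrow> 'b" and bnd :: "'b \<Rightarrow> real \<Rightarrow> bool"
  assumes bil: "bounded_bilinear mul"
    and bnd_add: "\<And>x y K L. bnd x K \<Longrightarrow> bnd y L \<Longrightarrow> bnd (x + y) (K + L)"
    and bnd_mul: "\<And>x y K L. bnd x K \<Longrightarrow> bnd y L \<Longrightarrow> 0 \<le> K \<Longrightarrow> 0 \<le> L \<Longrightarrow> bnd (mul x y) (K * L)"
    and bnd_half: "\<And>x K. bnd x K \<Longrightarrow> bnd ((1/2) *\<^sub>R x) (K / 2)"
    and bnd_zero: "bnd 0 0"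
    and bnd_norm: "\<And>x K. bnd x K \<Longrightarrow> norm x \<le> C * K"
    and b: "bnd b 1"
    and S: "closed S" "0 \<in> S" "\<And>u. u \<in> S \<Longrightarrow> (1/2) *\<^sub>R (b + mul u u) \<in> S"
  shows "\<exists>y\<in>S. 2 *\<^sub>R y = b + mul y y"
proof -
  interpret bounded_bilinear mul by (rule bil)
  define y where "y = rec_nat 0 (\<lambda>_ u. (1/2) *\<^sub>R (b + mul u u))"
  define \<eta> :: "nat \<Rightarrow> real" where "\<eta> = rec_nat 0 (\<lambda>_ u. (1 + u\<^sup>2) / 2)"
  have y0: "y 0 = 0" and yS: "y (Suc k) = (1/2) *\<^sub>R (b + mul (y k) (y k))" for k
    by (auto simp: y_def)
  have \<eta>0: "\<eta> 0 = 0" and \<eta>S: "\<eta> (Suc k) = (1 + (\<eta> k)\<^sup>2) / 2" for k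
    by (auto simp: \<eta>_def)
  have \<eta>1: "0 \<le> \<eta> k \<and> \<eta> k \<le> 1" for k
    by (induction k) (auto simp: \<eta>0 \<eta>S power_le_one)
  have mono: "\<eta> k \<le> \<eta> (Suc k)" for k
    by (induction k) (use \<eta>1 in \<open>auto simp: \<eta>0 \<eta>S intro!: power_mono\<close>)
  have "convergent \<eta>"
  proof (rule Bseq_mono_convergent)
    show "Bseq \<eta>" using \<eta>1 by (intro BseqI'[of _ 1]) auto
    show "\<forall>m n. m \<le> n \<longrightarrow> \<eta> m \<le> \<eta> n" using lift_Suc_mono_le[of \<eta>] mono by blast
  qed
  have yb: "bnd (y k) (\<eta> k)" for k
  proof (induction k)
    case (Suc k)
    show ?case
      using bnd_half[OF bnd_add[OF b bnd_mul[OF Suc Suc]]] \<eta>1[of k]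
      by (simp add: yS \<eta>S power2_eq_square)
  qed (simp add: y0 \<eta>0 bnd_zero)
  have inc: "bnd (y (Suc k) - y k) (\<eta> (Suc k) - \<eta> k)" for k
  proof (induction k)
    case 0
    show ?case using bnd_half[OF b] by (simp add: y0 yS \<eta>0 \<eta>S zero_left)
  next
    case (Suc k)
    define u v where "u = y (Suc k)" and "v = y k"
    define p q where "p = \<eta> (Suc k)" and "q = \<eta> k"
    have "bnd (u - v) (p - q)" "bnd u p" "bnd v q" "0 \<le> p - q" "0 \<le> p" "0 \<le> q"
      using Suc yb mono[of k] \<eta>1 by (auto simp: u_def v_def p_def q_def)
    \<comment> \<open>The factorization u u - v v = (u - v) u + v (u - v) needs no
      commutativity.\<close>
    then have "bnd ((1/2) *\<^sub>R (mul (u - v) u + mul v (u - v))) (((p - q) * p + q * (p - q)) / 2)"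
      by (intro bnd_half bnd_add bnd_mul) auto
    moreover have "(1/2) *\<^sub>R (mul (u - v) u + mul v (u - v)) = y (Suc (Suc k)) - y (Suc k)"
      unfolding yS[of "Suc k"] using yS[of k]
      by (simp add: u_def[symmetric] v_def[symmetric] diff_left diff_right scaleR_diff_right[symmetric])
    moreover have "((p - q) * p + q * (p - q)) / 2 = \<eta> (Suc (Suc k)) - \<eta> (Suc k)"
      unfolding \<eta>S[of "Suc k"] using \<eta>S[of k]
      by (simp add: p_def[symmetric] q_def[symmetric] field_simps power2_eq_square)
    ultimately show ?case by simp
  qed
  obtain l where l: "y \<longlonglongrightarrow> l"
    using convergent_if_dominated_increments[of y C \<eta>] bnd_norm[OF inc] \<open>convergent \<eta>\<close>
    by (auto simp: convergent_def)
  have "y k \<in> S" for k by (induction k) (auto simp: y0 yS S)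
  then have "l \<in> S" using S(1) l closed_sequentially by blast
  have "(\<lambda>k. (1/2) *\<^sub>R (b + mul (y k) (y k))) \<longlonglongrightarrow> (1/2) *\<^sub>R (b + mul l l)"
    by (intro tendsto_intros tendsto l)
  moreover have "(\<lambda>k. y (Suc k)) \<longlonglongrightarrow> l" using l LIMSEQ_Suc by blast
  ultimately have "(1/2) *\<^sub>R (b + mul l l) = l"
    unfolding yS using LIMSEQ_unique by blast
  then have "2 *\<^sub>R l = b + mul l l" by (metis scaleR_half_double scaleR_scaleR scaleR_2 scaleR_right_distrib)
  with \<open>l \<in> S\<close> show ?thesis by blast
qed

text \<open>The commutation property and the bound on \<open>y\<close> are closed conditions kept by
  each iterate, so they are part of the set \<open>S\<close> and survive in the limit. The bound on
  \<open>y\<close> allows a second root to be taken in \<open>cstar_abs\<close>.\<close>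

lemma sqrt_one_minus:
  fixes b :: "'a::cstar_algebra"
  assumes b: "norm b \<le> 1" "star b = b"
  shows "\<exists>y. star y = y \<and> norm y \<le> 1 \<and> (1 - y) * (1 - y) = 1 - b \<and>
    (\<forall>z. z * b = b * z \<longrightarrow> z * y = y * z)"
proof -
  define S where "S = {y::'a. star y = y \<and> norm y \<le> 1 \<and> (\<forall>z. z * b = b * z \<longrightarrow> z * y = y * z)}"
  have "closed {y::'a. z * b = b * z \<longrightarrow> z * y = y * z}" for z
    by (cases "z * b = b * z") (auto intro!: closed_Collect_eq continuous_intros)
  then have "closed S"
    unfolding S_def Collect_conj_eq
    by (intro closed_Int closed_Collect_eq closed_Collect_le continuous_intros closed_Collect_all)
  have step: "(1/2) *\<^sub>R (b + u * u) \<in> S" if u: "u \<in> S" for u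
  proof -
    have us: "star u = u" "norm u \<le> 1" and uc: "\<And>z. z * b = b * z \<Longrightarrow> z * u = u * z"
      using u unfolding S_def by blast+
    have "norm (b + u * u) \<le> norm b + norm u * norm u"
      by (meson norm_triangle_le add_left_mono norm_mult_ineq)
    also have "\<dots> \<le> 1 + 1 * 1"
      using us b by (intro add_mono mult_mono) auto
    finally have "norm ((1/2) *\<^sub>R (b + u * u)) \<le> 1" by simp
    moreover have "z * (u * u) = u * u * z" if "z * b = b * z" for z
    proof -
      have "z * u = u * z" using uc that by blast
      then show ?thesis by (metis mult.assoc)
    qed
    moreover have "star ((1/2) *\<^sub>R (b + u * u)) = (1/2) *\<^sub>R (b + u * u)"
      by (simp add: us b(2) star_scaleR star_add star_mult)
    ultimately show ?thesis
      unfolding S_def by (simp add: distrib_left distrib_right)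
  qed
  have "\<exists>y\<in>S. 2 *\<^sub>R y = b + y * y"
  proof (rule sqrt_fixpoint[where mul="(*)" and bnd="\<lambda>x K. norm x \<le> K" and C=1])
    show "norm (x * y) \<le> K * L" if "norm x \<le> K" "norm y \<le> L" "0 \<le> K" "0 \<le> L" for x y :: 'a and K L
      using norm_mult_ineq[of x y] mult_mono[OF that(1,2)] that by (meson norm_ge_zero order_trans)
    show "closed S" "\<And>u. u \<in> S \<Longrightarrow> (1/2) *\<^sub>R (b + u * u) \<in> S" by fact+
    show "0 \<in> S" by (simp add: S_def)
  qed (use b in \<open>auto simp: bounded_bilinear_mult intro: norm_triangle_mono\<close>)
  then obtain y where y: "y \<in> S" "2 *\<^sub>R y = b + y * y" by blast
  have "(1 - y) * (1 - y) = 1 - 2 *\<^sub>R y + y * y"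
    by (simp add: algebra_simps scaleR_2)
  also have "\<dots> = 1 - b" using y(2) by simp
  finally show ?thesis using y(1) unfolding S_def by blast
qed

text \<open>Here \<open>c\<close> is the real part of \<open>u = c + i w\<close>; the hypotheses say
  that \<open>star u * u\<close> is the scalar K^2, so \<open>u\<close> has norm
  \<open>K\<close>.\<close>

lemma norm_le_if_sum_squares:
  fixes c w :: "'a::cstar_algebra"
  assumes "star c = c" "star w = w" "c * w = w * c" "c * c + w * w = K\<^sup>2 *\<^sub>R 1" "0 \<le> K"
  shows "norm c \<le> K"
proof -
  define u where "u = c + \<i> *\<^sub>C w"
  have "star u = c - \<i> *\<^sub>C w"
    by (simp add: u_def star_add star_scaleC assms scaleC_minus_left)
  then have "star u * u = (c - \<i> *\<^sub>C w) * (c + \<i> *\<^sub>C w)" by (simp only: u_def)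
  also have "\<dots> = c * c + w * w + \<i> *\<^sub>C (c * w - w * c)"
    by (simp add: left_diff_distrib distrib_left mult_scaleC_left mult_scaleC_right scaleC_scaleC
        scaleC_minus_left scaleC_diff_right)
  also have "\<dots> = K\<^sup>2 *\<^sub>R 1" unfolding assms(3,4) by simp
  finally have "star u * u = K\<^sup>2 *\<^sub>R 1" .
  then have "(norm u)\<^sup>2 = K\<^sup>2" using cstar_identity[of u] by simp
  then have "norm u = K" using assms(5) by simp
  have "2 *\<^sub>R c = u + star u" unfolding \<open>star u = _\<close> by (simp add: u_def scaleR_2)
  then have "norm (2 *\<^sub>R c) \<le> norm u + norm (star u)" by (metis norm_triangle_ineq)
  then show ?thesis using \<open>norm u = K\<close> by simp
qed

text \<open>The triangle inequality only gives 2. Reading \<open>c\<close> as a cosine and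
  \<open>w\<close> as the sine, \<open>p\<close> and \<open>q\<close> are the cosine and sine of the
  double angle; hence \<open>p\<close> is a contraction, and 1 - c^2 = (1 - p) / 2.\<close>

lemma norm_one_minus_square:
  fixes c :: "'a::cstar_algebra"
  assumes c: "star c = c" "norm c \<le> 1"
  shows "norm (1 - c * c) \<le> 1"
proof -
  have "norm (c * c) \<le> 1" using c norm_mult_ineq[of c c] mult_mono[OF c(2) c(2)] by simp
  then obtain y where y: "star y = y" "(1 - y) * (1 - y) = 1 - c * c" "c * y = y * c"
    using sqrt_one_minus[of "c * c"] c by (auto simp: star_mult mult.assoc)
  define w where "w = 1 - y"
  have w: "star w = w" "w * w = 1 - c * c" "c * w = w * c"
    using y by (auto simp: w_def star_diff algebra_simps)
  define p q where "p = 2 *\<^sub>R (c * c) - 1" and "q = 2 *\<^sub>R (c * w)"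
  have "c * w * (c * w) = c * c * (w * w)" by (metis w(3) mult.assoc)
  also have "\<dots> = c * c - c * c * (c * c)" by (simp add: w(2) algebra_simps)
  finally have cw: "c * w * (c * w) = c * c - c * c * (c * c)" .
  have "norm p \<le> 1"
  proof (rule norm_le_if_sum_squares[of p q])
    show "p * p + q * q = 1\<^sup>2 *\<^sub>R 1"
      


    proof -
      have "4 *\<^sub>R x = 2 *\<^sub>R x + 2 *\<^sub>R x" for x :: 'a by (simp flip: scaleR_add_left)
      then show ?thesis
        by (simp add: cw p_def q_def left_diff_distrib right_diff_distrib scaleR_diff_right)
    qed
    show "p * q = q * p"
    proof -
      have "c * c * (c * w) = c * w * (c * c)" by (metis w(3) mult.assoc)
      then show ?thesis by (simp add: p_def q_def algebra_simps)
    qed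
  qed (auto simp: p_def q_def star_diff star_scaleR star_mult c w)
  have "1 - c * c = (1/2) *\<^sub>R (1 - p)"
    by (simp add: p_def algebra_simps flip: scaleR_2)
  then have "norm (1 - c * c) = norm (1 - p) / 2" by simp
  also have "\<dots> \<le> 1" using norm_triangle_ineq4[of 1 p] \<open>norm p \<le> 1\<close> by simp
  finally show ?thesis .
qed

text \<open>The square of \<open>v\<close> plays the role of the absolute value of \<open>c\<close>.
  The further root makes its positivity visible without spectral theory: the form of
  \<open>v * v\<close> at \<open>b\<close> is \<open>sqn (v * b)\<close>.\<close>

lemma cstar_abs:
  fixes c :: "'a::cstar_algebra"
  assumes c: "star c = c" "norm c \<le> 1"
  shows "\<exists>v. star v = v \<and> (v * v) * (v * v) = c * c \<and> (\<forall>z. z * c = c * z \<longrightarrow> z * v = v * z)"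
proof -
  have "star (1 - c * c) = 1 - c * c" using c(1) by (simp add: star_diff star_mult)
  then obtain y where y: "star y = y" "norm y \<le> 1" "(1 - y) * (1 - y) = 1 - (1 - c * c)"
    "\<And>z. z * (1 - c * c) = (1 - c * c) * z \<Longrightarrow> z * y = y * z"
    using sqrt_one_minus[OF norm_one_minus_square[OF c]] by blast
  obtain u where u: "star u = u" "(1 - u) * (1 - u) = 1 - y"
    "\<And>z. z * y = y * z \<Longrightarrow> z * u = u * z"
    using sqrt_one_minus[OF y(2,1)] by blast
  have "z * (1 - u) = (1 - u) * z" if "z * c = c * z" for z
  proof -
    have "z * (c * c) = c * c * z" using that by (metis mult.assoc)
    then have "z * u = u * z" by (intro u y) (simp add: left_diff_distrib right_diff_distrib)
    then show ?thesis by (simp add: left_diff_distrib right_diff_distrib)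
  qed
  moreover have "(1 - u) * (1 - u) * ((1 - u) * (1 - u)) = c * c"
    using u(2) y(3) by simp
  moreover have "star (1 - u) = 1 - u" by (simp add: star_diff u(1))
  ultimately show ?thesis by blast
qed


section \<open>The trace norm and its faithfulness\<close>

lemma mat_star_star [simp]: "mat_star (mat_star A) = A"
  by (simp add: mat_star_def star_star vec_eq_iff)

lemma mat_star_add: "mat_star (A + B) = mat_star A + mat_star B"
  by (simp add: mat_star_def star_add vec_eq_iff)

lemma mat_star_diff: "mat_star (A - B) = mat_star A - mat_star B"
  by (simp add: mat_star_def star_diff vec_eq_iff)

lemma mat_star_minus: "mat_star (- A) = - mat_star A"
  by (simp add: mat_star_def star_minus vec_eq_iff)

lemma mat_star_zero [simp]: "mat_star 0 = 0"
  by (simp add: mat_star_def vec_eq_iff)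

lemma mat_star_sum: "mat_star (sum f S) = (\<Sum>k\<in>S. mat_star (f k))"
  by (simp add: mat_star_def star_sum vec_eq_iff)

lemma mat_star_scaleR: "mat_star (r *\<^sub>R A) = r *\<^sub>R mat_star A"
  by (simp add: mat_star_def star_scaleR vec_eq_iff)

lemma mat_star_mult: "mat_star (A ** B) = mat_star B ** mat_star A"
  by (simp add: mat_star_def matrix_matrix_mult_def star_sum star_mult vec_eq_iff)

lemma mat_star_mat: "mat_star (mat c) = mat (star c)"
  by (auto simp: mat_star_def mat_def vec_eq_iff)

lemma mat_star_one [simp]: "mat_star (mat 1) = mat 1"
  by (simp add: mat_star_mat)

lemma matrix_vector_scaleR_right:
  "A *v (r *\<^sub>R x) = r *\<^sub>R (A *v (x :: 'a::real_algebra_1 ^ 'n))"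
  using linear_cmul[OF matrix_vector_mul_linear] by blast

lemma matrix_vector_scaleR_left:
  "(r *\<^sub>R A) *v x = r *\<^sub>R (A *v (x :: 'a::real_algebra_1 ^ 'n))"
  by (simp add: matrix_vector_mult_def vec_eq_iff scaleR_sum_right)

lemma matrix_diff_ldistrib: "A ** (B - C) = A ** B - A ** (C :: 'a::ring_1 ^ 'n ^ 'm)"
  by (simp add: matrix_matrix_mult_def vec_eq_iff right_diff_distrib sum_subtractf)

lemma matrix_diff_rdistrib: "(B - C) ** A = B ** A - (C :: 'a::ring_1 ^ 'n ^ 'm) ** A"
  by (simp add: matrix_matrix_mult_def vec_eq_iff left_diff_distrib sum_subtractf)

lemma matrix_add_rdistrib: "(B + C) ** A = B ** A + C ** (A :: 'a::semiring_1 ^ 'n ^ 'm)"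
  by (simp add: matrix_matrix_mult_def vec_eq_iff distrib_right sum.distrib)

lemma matrix_vector_mult_sum_left: "(\<Sum>k\<in>S. T k) *v v = (\<Sum>k\<in>S. T k *v v)"
  by (induction S rule: infinite_finite_induct) (auto simp: matrix_vector_mult_add_rdistrib)

lemma matrix_mult_minus_right: "A ** (- B) = - (A ** (B :: 'a::ring_1 ^ 'n ^ 'm))"
  using matrix_diff_ldistrib[of A 0 B] by simp

lemma matrix_mult_minus_left: "(- A) ** B = - (A ** (B :: 'a::ring_1 ^ 'n ^ 'm))"
  using matrix_diff_rdistrib[of 0 A B] by simp

section \<open>The faithful trace and its inner product\<close>

locale tracial =
  fixes \<tau> :: "'a::cstar_algebra \<Rightarrow> complex"
  assumes tracial_state: "faithful_tracial_state \<tau>"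
begin

lemma tau_add: "\<tau> (x + y) = \<tau> x + \<tau> y"
  and tau_scaleC: "\<tau> (c *\<^sub>C x) = c * \<tau> x"
  and tau_one: "\<tau> 1 = 1"
  and tau_square_real: "\<tau> (star x * x) \<in> \<real>"
  and tau_square_ge_0: "0 \<le> Re (\<tau> (star x * x))"
  and tau_commute: "\<tau> (x * y) = \<tau> (y * x)"
  and tau_faithful: "\<tau> (star x * x) = 0 \<Longrightarrow> x = 0"
  using tracial_state unfolding faithful_tracial_state_def by auto

lemma tau_scaleR: "\<tau> (r *\<^sub>R x) = complex_of_real r * \<tau> x"
  using tau_scaleC[of "complex_of_real r" x] by (simp add: scaleC_of_real)

lemma tau_zero [simp]: "\<tau> 0 = 0"
  using tau_scaleR[of 0 0] by simp

lemma tau_minus: "\<tau> (- x) = - \<tau> x"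
  using tau_scaleR[of "-1" x] by simp

lemma tau_diff: "\<tau> (x - y) = \<tau> x - \<tau> y"
  using tau_add[of x "-y"] by (simp add: tau_minus)

lemma tau_sum: "\<tau> (sum f S) = (\<Sum>k\<in>S. \<tau> (f k))"
  by (induction S rule: infinite_finite_induct) (auto simp: tau_add)

text \<open>The axioms give reality on squares only; at 1 + x it fixes the imaginary part of \<tau>
  (star x), at 1 + i x the real part.\<close>

lemma tau_star: "\<tau> (star x) = cnj (\<tau> x)"
proof -
  have "star (1 + x) * (1 + x) = 1 + star x * x + (x + star x)"
    by (simp add: star_add algebra_simps)
  then have "Im (\<tau> (1 + star x * x + (x + star x))) = 0"
    using tau_square_real[of "1 + x"] by (simp add: complex_is_Real_iff)
  then have im: "Im (\<tau> x) + Im (\<tau> (star x)) = 0"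
    using tau_square_real[of x] by (simp add: tau_add tau_one complex_is_Real_iff)
  have "star (1 + \<i> *\<^sub>C x) * (1 + \<i> *\<^sub>C x) = 1 + star x * x + \<i> *\<^sub>C (x - star x)"
    by (simp add: star_add star_scaleC distrib_left distrib_right left_diff_distrib mult_scaleC_left mult_scaleC_right
        scaleC_scaleC scaleC_minus_left scaleC_diff_right)
  then have "Im (\<tau> (1 + star x * x + \<i> *\<^sub>C (x - star x))) = 0"
    using tau_square_real[of "1 + \<i> *\<^sub>C x"] by (simp add: complex_is_Real_iff)
  then have "Re (\<tau> x) - Re (\<tau> (star x)) = 0"
    using tau_square_real[of x] by (simp add: tau_add tau_diff tau_scaleC tau_one complex_is_Real_iff)
  with im show ?thesis by (simp add: complex_eq_iff)
qed

definition sqn :: "'a \<Rightarrow> real" where "sqn x = Re (\<tau> (star x * x))"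

lemma sqn_ge_0 [simp]: "0 \<le> sqn x"
  by (simp add: sqn_def tau_square_ge_0)

lemma sqn_eq_0: "sqn x = 0 \<longleftrightarrow> x = 0"
proof
  assume "sqn x = 0"
  then have "\<tau> (star x * x) = 0"
    using tau_square_real[of x] by (simp add: sqn_def complex_eq_iff complex_is_Real_iff)
  then show "x = 0" by (rule tau_faithful)
qed (simp add: sqn_def)

lemma sqn_scaleR: "sqn (r *\<^sub>R x) = r\<^sup>2 * sqn x"
  by (simp add: sqn_def star_scaleR tau_scaleR power2_eq_square)

text \<open>The trace property enters here; it makes right multiplication bounded as well, see
  \<open>tnorm_rmul_le\<close>.\<close>

lemma sqn_star: "sqn (star x) = sqn x"
  by (simp add: sqn_def star_star tau_commute)

lemma tau_cauchy_schwarz: "(Re (\<tau> (star x * y)))\<^sup>2 \<le> sqn x * sqn y"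
proof (rule real_discriminant)
  fix t :: real
  have "\<tau> (star y * x) = cnj (\<tau> (star x * y))"
    by (metis star_mult star_star tau_star)
  then have "sqn (x + t *\<^sub>R y) = sqn x + 2 * t * Re (\<tau> (star x * y)) + t\<^sup>2 * sqn y"
    by (simp add: sqn_def star_add star_scaleR distrib_left distrib_right tau_add tau_scaleR
        power2_eq_square algebra_simps)
  then show "0 \<le> sqn x + 2 * t * Re (\<tau> (star x * y)) + t\<^sup>2 * sqn y"
    by (metis sqn_ge_0)
qed

text \<open>After scaling to norm 1, 1 - u^* u has a self-adjoint root 1 - w, and
  \<open>sqn y - sqn (u * y)\<close> is \<open>sqn ((1 - w) * y)\<close>.\<close>

lemma sqn_mult_le: "sqn (x * y) \<le> (norm x)\<^sup>2 * sqn y"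
proof (cases "x = 0")
  case False
  define u where "u = (1 / norm x) *\<^sub>R x"
  have "norm u = 1" using False by (simp add: u_def)
  then have "norm (star u * u) \<le> 1" by (simp add: cstar_identity)
  then obtain w where w: "star w = w" "(1 - w) * (1 - w) = 1 - star u * u"
    using sqrt_one_minus[of "star u * u"] by (auto simp: star_mult star_star)
  have "star ((1 - w) * y) * ((1 - w) * y) = star y * ((1 - w) * (1 - w)) * y"
    by (simp add: star_mult star_diff w(1) mult.assoc)
  also have "\<dots> = star y * y - star (u * y) * (u * y)"
    unfolding w(2) by (simp add: star_mult algebra_simps)
  finally have "sqn y - sqn (u * y) = sqn ((1 - w) * y)"
    by (simp add: sqn_def tau_diff)
  then have "sqn (u * y) \<le> sqn y" using sqn_ge_0[of "(1 - w) * y"] by linarith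
  moreover have "sqn (u * y) = sqn (x * y) / (norm x)\<^sup>2"
    by (simp add: u_def sqn_scaleR power_divide)
  ultimately show ?thesis using False by (simp add: field_simps)
qed (simp add: sqn_def)

lemma norm_tau_le: "\<bar>Re (\<tau> x)\<bar> \<le> norm x"
proof -
  have "(Re (\<tau> x))\<^sup>2 \<le> sqn x" using tau_cauchy_schwarz[of 1 x] by (simp add: sqn_def tau_one)
  also have "\<dots> \<le> (norm x)\<^sup>2" using sqn_mult_le[of x 1] by (simp add: sqn_def tau_one)
  finally show ?thesis by (metis abs_le_square_iff abs_norm_cancel)
qed

lemma bounded_linear_tau: "bounded_linear \<tau>"
proof (rule bounded_linear_intro[where K=2])
  fix x
  have "\<bar>Im (\<tau> x)\<bar> \<le> norm x"
    using norm_tau_le[of "\<i> *\<^sub>C x"] by (simp add: tau_scaleC norm_scaleC)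
  then show "norm (\<tau> x) \<le> norm x * 2"
    using cmod_le[of "\<tau> x"] norm_tau_le[of x] by linarith
qed (auto simp: tau_add tau_scaleR scaleR_conv_of_real[where 'a=complex])

lemmas continuous_on_tau [continuous_intros] = bounded_linear.continuous_on[OF bounded_linear_tau]

text \<open>Let c be a positive multiple of a^2 - K^2 and v^2 = |c|. Then p = |c| + c is twice the
  positive part of c, and c p = |c| p. The hypothesis at p makes the trace of p c p, which is
  \<open>sqn (v * p)\<close>, nonpositive; so v p = 0 by faithfulness, and p = 0. Hence c = - v^2,
  and a^2 plus a square is K^2.\<close>

lemma norm_le_if_sqn_le_selfadj:
  assumes a: "star a = a" and K: "0 \<le> K" and le: "\<And>b. sqn (a * b) \<le> K\<^sup>2 * sqn b"
  shows "norm a \<le> K"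
proof -
  define c0 where "c0 = a * a - K\<^sup>2 *\<^sub>R 1"
  \<comment> \<open>Scaling makes \<open>c\<close> a contraction, as \<open>cstar_abs\<close>
    requires.\<close>
  define r where "r = 1 / (1 + norm c0)"
  have r: "0 < r" unfolding r_def by (simp add: add_pos_nonneg)
  define c where "c = r *\<^sub>R c0"
  have "star c = c" by (simp add: c_def c0_def star_scaleR star_diff star_mult a)
  moreover have "norm c \<le> 1" using r by (simp add: c_def r_def field_simps)
  ultimately obtain v where v: "star v = v" "(v * v) * (v * v) = c * c"
    "\<And>z. z * c = c * z \<Longrightarrow> z * v = v * z"
    using cstar_abs by blast
  have vc: "c * v = v * c" by (rule v) simp
  have va: "a * v = v * a" by (rule v) (simp add: c_def c0_def algebra_simps)
  define p where "p = v * v + c"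
  have "v * v * c = c * (v * v)" using vc by (metis mult.assoc)
  then have cp: "c * p = v * v * p" unfolding p_def using v(2) by (simp add: distrib_left)
  have "star p = p" by (simp add: p_def star_add star_mult v(1) \<open>star c = c\<close>)
  have "star (v * p) * (v * p) = star p * (c * p)"
    unfolding cp by (simp add: star_mult v(1) mult.assoc)
  also have "\<dots> = r *\<^sub>R (star (a * p) * (a * p) - K\<^sup>2 *\<^sub>R (star p * p))"
    by (simp add: c_def c0_def star_mult a algebra_simps)
  finally have "sqn (v * p) = r * (sqn (a * p) - K\<^sup>2 * sqn p)"
    by (simp add: sqn_def tau_scaleR tau_diff)
  also have "\<dots> \<le> 0" using r le[of p] by (simp add: mult_nonneg_nonpos)
  finally have "v * p = 0" using sqn_eq_0[of "v * p"] sqn_ge_0[of "v * p"] by simp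
  then have "v * v * p = 0" by (simp add: mult.assoc)
  have "star p * p = v * v * p + c * p" unfolding \<open>star p = p\<close> by (simp add: p_def distrib_right)
  then have "star p * p = 0" using cp \<open>v * v * p = 0\<close> by simp
  then have "p = 0" using cstar_identity[of p] by simp
  then have "v * v = - c" by (simp add: p_def eq_neg_iff_add_eq_0)
  show ?thesis
  proof (rule norm_le_if_sum_squares[of a "(1 / sqrt r) *\<^sub>R v"])
    have "((1 / sqrt r) *\<^sub>R v) * ((1 / sqrt r) *\<^sub>R v) = (1 / r) *\<^sub>R (v * v)"
      using r by simp
    also have "\<dots> = - c0" using r by (simp add: \<open>v * v = - c\<close> c_def)
    finally show "a * a + ((1 / sqrt r) *\<^sub>R v) * ((1 / sqrt r) *\<^sub>R v) = K\<^sup>2 *\<^sub>R 1"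
      by (simp add: c0_def)
  qed (use a v(1) va K in \<open>auto simp: star_scaleR\<close>)
qed

text \<open>The GNS representation of a faithful trace is isometric.\<close>

lemma norm_le_if_sqn_le:
  assumes K: "0 \<le> K" and le: "\<And>b. sqn (a * b) \<le> K\<^sup>2 * sqn b"
  shows "norm a \<le> K"
proof -
  \<comment> \<open>With the bound for \<open>star a\<close> too, the self-adjoint
    \<open>star a * a\<close> has bound K^2, and the C*-identity gives the norm.\<close>
  have le': "sqn (star a * b) \<le> K\<^sup>2 * sqn b" for b
  proof (cases "sqn (star a * b) = 0")
    case False
    define q where "q = sqn (star a * b)"
    have "q = Re (\<tau> (star b * (a * (star a * b))))"
      by (simp add: q_def sqn_def star_mult star_star mult.assoc)
    then have "q\<^sup>2 \<le> sqn b * sqn (a * (star a * b))" using tau_cauchy_schwarz by simp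
    also have "\<dots> \<le> sqn b * (K\<^sup>2 * q)" unfolding q_def by (intro mult_left_mono le) auto
    finally have "q * q \<le> (K\<^sup>2 * sqn b) * q" by (simp add: power2_eq_square mult_ac)
    moreover have "q > 0" using False sqn_ge_0[of "star a * b"] unfolding q_def by linarith
    ultimately show ?thesis by (simp add: q_def)
  qed auto
  have "norm (star a * a) \<le> K\<^sup>2"
  proof (rule norm_le_if_sqn_le_selfadj)
    fix b
    have "sqn (star a * a * b) \<le> K\<^sup>2 * sqn (a * b)" using le'[of "a * b"] by (simp add: mult.assoc)
    also have "\<dots> \<le> K\<^sup>2 * (K\<^sup>2 * sqn b)" by (intro mult_left_mono le) auto
    finally show "sqn (star a * a * b) \<le> (K\<^sup>2)\<^sup>2 * sqn b" by (simp add: power2_eq_square mult_ac)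
  qed (auto simp: star_mult star_star)
  then have "(norm a)\<^sup>2 \<le> K\<^sup>2" by (simp add: cstar_identity)
  then show ?thesis using K by (simp add: power2_le_iff_abs_le)
qed

section \<open>Matrices as operators\<close>

definition tip :: "'a ^ 'd \<Rightarrow> 'a ^ 'd \<Rightarrow> complex" where
  "tip \<xi> \<eta> = (\<Sum>k\<in>UNIV. \<tau> (star (\<xi> $ k) * \<eta> $ k))"

text \<open>Order relations only see the real part, and by \<open>matrix_eqI_rip\<close> it still
  determines a matrix.\<close>

definition rip :: "'a ^ 'd \<Rightarrow> 'a ^ 'd \<Rightarrow> real" where
  "rip \<xi> \<eta> = Re (tip \<xi> \<eta>)"

definition tnorm :: "'a ^ 'd \<Rightarrow> real" where
  "tnorm \<xi> = sqrt (rip \<xi> \<xi>)"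

lemma tip_add_right: "tip \<xi> (\<eta> + \<zeta>) = tip \<xi> \<eta> + tip \<xi> \<zeta>"
  by (simp add: tip_def distrib_left tau_add sum.distrib)

lemma tip_add_left: "tip (\<eta> + \<zeta>) \<xi> = tip \<eta> \<xi> + tip \<zeta> \<xi>"
  by (simp add: tip_def distrib_right star_add tau_add sum.distrib)

lemma tip_commute: "tip \<eta> \<xi> = cnj (tip \<xi> \<eta>)"
  by (simp add: tip_def cnj_sum flip: tau_star) (simp add: star_mult star_star)

lemma tip_scaleR_right: "tip \<xi> (r *\<^sub>R \<eta>) = of_real r * tip \<xi> \<eta>"
  by (simp add: tip_def tau_scaleR sum_distrib_left)

lemma tip_adjoint: "tip \<xi> (X *v \<eta>) = tip (mat_star X *v \<xi>) \<eta>"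
proof -
  have "tip \<xi> (X *v \<eta>) = (\<Sum>k\<in>UNIV. \<Sum>j\<in>UNIV. \<tau> (star (\<xi> $ k) * (X $ k $ j * \<eta> $ j)))"
    by (simp add: tip_def matrix_vector_mult_def sum_distrib_left tau_sum)
  also have "\<dots> = (\<Sum>j\<in>UNIV. \<Sum>k\<in>UNIV. \<tau> (star (\<xi> $ k) * (X $ k $ j * \<eta> $ j)))"
    by (rule sum.swap)
  also have "\<dots> = tip (mat_star X *v \<xi>) \<eta>"
    by (simp add: tip_def matrix_vector_mult_def sum_distrib_right tau_sum mat_star_def star_sum
        star_mult star_star mult.assoc)
  finally show ?thesis .
qed

lemma rip_commute: "rip \<xi> \<eta> = rip \<eta> \<xi>"
  by (simp add: rip_def tip_commute[of \<xi>])

lemma rip_add_right: "rip \<xi> (\<eta> + \<zeta>) = rip \<xi> \<eta> + rip \<xi> \<zeta>"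
  by (simp add: rip_def tip_add_right)

lemma rip_add_left: "rip (\<eta> + \<zeta>) \<xi> = rip \<eta> \<xi> + rip \<zeta> \<xi>"
  by (simp add: rip_def tip_add_left)

lemma rip_scaleR_right: "rip \<xi> (r *\<^sub>R \<eta>) = r * rip \<xi> \<eta>"
  by (simp add: rip_def tip_scaleR_right)

lemma rip_scaleR_left: "rip (r *\<^sub>R \<eta>) \<xi> = r * rip \<eta> \<xi>"
  using rip_scaleR_right[of \<xi> r \<eta>] by (simp only: rip_commute[of \<xi>])

lemma rip_minus_right: "rip \<xi> (- \<eta>) = - rip \<xi> \<eta>"
  using rip_scaleR_right[of \<xi> "-1" \<eta>] by simp

lemma rip_diff_right: "rip \<xi> (\<eta> - \<zeta>) = rip \<xi> \<eta> - rip \<xi> \<zeta>"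
  using rip_add_right[of \<xi> \<eta> "-\<zeta>"] by (simp add: rip_minus_right)

lemma rip_diff_left: "rip (\<eta> - \<zeta>) \<xi> = rip \<eta> \<xi> - rip \<zeta> \<xi>"
  by (simp add: rip_commute[of "\<eta> - \<zeta>"] rip_commute[of \<eta>] rip_commute[of \<zeta>] rip_diff_right)

lemma rip_zero [simp]: "rip 0 \<xi> = 0" "rip \<xi> 0 = 0"
  using rip_scaleR_right[of \<xi> 0 0] rip_scaleR_left[of 0 0 \<xi>] by auto

lemma rip_sum_right: "rip \<xi> (sum f S) = (\<Sum>k\<in>S. rip \<xi> (f k))"
  by (induction S rule: infinite_finite_induct) (auto simp: rip_add_right)

lemma rip_adjoint: "rip \<xi> (X *v \<eta>) = rip (mat_star X *v \<xi>) \<eta>"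
  by (simp add: rip_def tip_adjoint)

lemma rip_selfadj: "mat_star X = X \<Longrightarrow> rip \<xi> (X *v \<eta>) = rip (X *v \<xi>) \<eta>"
  by (simp add: rip_adjoint)

lemma rip_self_sqn: "rip \<xi> \<xi> = (\<Sum>k\<in>UNIV. sqn (\<xi> $ k))"
  by (simp add: rip_def tip_def sqn_def)

lemma rip_self_ge_0 [simp]: "0 \<le> rip \<xi> \<xi>"
  by (simp add: rip_self_sqn sum_nonneg)

lemma rip_self_eq_0: "rip \<xi> \<xi> = 0 \<longleftrightarrow> \<xi> = 0"
  by (simp add: rip_self_sqn sum_nonneg_eq_0_iff sqn_eq_0 vec_eq_iff)

lemma rip_self_pos: "\<xi> \<noteq> 0 \<Longrightarrow> 0 < rip \<xi> \<xi>"
  using rip_self_ge_0[of \<xi>] rip_self_eq_0[of \<xi>] by linarith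

lemma tnorm_ge_0 [simp]: "0 \<le> tnorm \<xi>"
  by (simp add: tnorm_def)

lemma tnorm_square: "(tnorm \<xi>)\<^sup>2 = rip \<xi> \<xi>"
  by (simp add: tnorm_def)

lemma tnorm_eq_0: "tnorm \<xi> = 0 \<longleftrightarrow> \<xi> = 0"
  by (simp add: tnorm_def rip_self_eq_0)

lemma tnorm_zero [simp]: "tnorm 0 = 0"
  by (simp add: tnorm_eq_0)

lemma tnorm_scaleR: "tnorm (r *\<^sub>R \<xi>) = \<bar>r\<bar> * tnorm \<xi>"
proof -
  have "rip (r *\<^sub>R \<xi>) (r *\<^sub>R \<xi>) = r\<^sup>2 * rip \<xi> \<xi>"
    by (simp add: rip_scaleR_left rip_scaleR_right power2_eq_square)
  then show ?thesis by (simp add: tnorm_def real_sqrt_mult)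
qed

lemma form_cauchy_schwarz:
  assumes T: "mat_star T = T" and pos: "\<And>\<xi>. 0 \<le> rip \<xi> (T *v \<xi>)"
  shows "(rip \<xi> (T *v \<eta>))\<^sup>2 \<le> rip \<xi> (T *v \<xi>) * rip \<eta> (T *v \<eta>)"
proof (rule real_discriminant)
  fix t :: real
  have "rip \<eta> (T *v \<xi>) = rip \<xi> (T *v \<eta>)"
    by (metis T rip_commute rip_selfadj)
  then have "rip (\<xi> + t *\<^sub>R \<eta>) (T *v (\<xi> + t *\<^sub>R \<eta>)) =
      rip \<xi> (T *v \<xi>) + 2 * t * rip \<xi> (T *v \<eta>) + t\<^sup>2 * rip \<eta> (T *v \<eta>)"
    by (simp add: matrix_vector_right_distrib matrix_vector_scaleR_right rip_add_left rip_add_right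
        rip_scaleR_left rip_scaleR_right power2_eq_square algebra_simps)
  then show "0 \<le> rip \<xi> (T *v \<xi>) + 2 * t * rip \<xi> (T *v \<eta>) + t\<^sup>2 * rip \<eta> (T *v \<eta>)"
    by (metis pos)
qed

lemma rip_cauchy_schwarz: "(rip \<xi> \<eta>)\<^sup>2 \<le> rip \<xi> \<xi> * rip \<eta> \<eta>"
  using form_cauchy_schwarz[of "mat 1" \<xi> \<eta>] by simp

lemma rip_le_tnorm: "\<bar>rip \<xi> \<eta>\<bar> \<le> tnorm \<xi> * tnorm \<eta>"
proof -
  have "sqrt ((rip \<xi> \<eta>)\<^sup>2) \<le> sqrt (rip \<xi> \<xi> * rip \<eta> \<eta>)"
    using rip_cauchy_schwarz by (rule real_sqrt_le_mono)
  then show ?thesis by (simp add: tnorm_def real_sqrt_mult)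
qed

lemma tnorm_triangle: "tnorm (\<xi> + \<eta>) \<le> tnorm \<xi> + tnorm \<eta>"
proof (rule power2_le_imp_le)
  have "(tnorm (\<xi> + \<eta>))\<^sup>2 = (tnorm \<xi>)\<^sup>2 + 2 * rip \<xi> \<eta> + (tnorm \<eta>)\<^sup>2"
    by (simp add: tnorm_square rip_add_left rip_add_right rip_commute[of \<eta> \<xi>])
  also have "\<dots> \<le> (tnorm \<xi> + tnorm \<eta>)\<^sup>2"
    using rip_le_tnorm[of \<xi> \<eta>] by (simp add: power2_sum)
  finally show "(tnorm (\<xi> + \<eta>))\<^sup>2 \<le> (tnorm \<xi> + tnorm \<eta>)\<^sup>2" .
qed simp

lemma tnorm_sum_le: "tnorm (sum f S) \<le> (\<Sum>k\<in>S. tnorm (f k))"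
proof (induction S rule: infinite_finite_induct)
  case (insert k S)
  then show ?case using tnorm_triangle[of "f k" "sum f S"] by simp
qed auto

lemma matrix_eqI_rip:
  assumes "\<And>\<xi> \<eta>. rip \<xi> (X *v \<eta>) = rip \<xi> (Y *v \<eta>)"
  shows "X = Y"
proof -
  have "X *v \<eta> = Y *v \<eta>" for \<eta>
    using assms[of "X *v \<eta> - Y *v \<eta>" \<eta>] rip_self_eq_0[of "X *v \<eta> - Y *v \<eta>"]
    by (simp add: rip_diff_right)
  then show ?thesis by (simp add: matrix_eq)
qed

text \<open>A bound for the operator norm on columns. The relation avoids a supremum and has the
  shape that \<open>sqrt_fixpoint\<close> takes.\<close>

definition bnd :: "'a ^ 'd ^ 'd \<Rightarrow> real \<Rightarrow> bool" where
  "bnd X K \<longleftrightarrow> 0 \<le> K \<and> (\<forall>\<xi>. tnorm (X *v \<xi>) \<le> K * tnorm \<xi>)"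

lemma bndD: "bnd X K \<Longrightarrow> tnorm (X *v \<xi>) \<le> K * tnorm \<xi>"
  and bnd_ge_0: "bnd X K \<Longrightarrow> 0 \<le> K"
  by (auto simp: bnd_def)

lemma bnd_add:
  assumes "bnd X K" "bnd Y L"
  shows "bnd (X + Y) (K + L)"
proof -
  have "tnorm ((X + Y) *v \<xi>) \<le> K * tnorm \<xi> + L * tnorm \<xi>" for \<xi>
    unfolding matrix_vector_mult_add_rdistrib
    by (rule order_trans[OF tnorm_triangle add_mono[OF bndD[OF assms(1)] bndD[OF assms(2)]]])
  then show ?thesis
    using assms[THEN bnd_ge_0] by (simp add: bnd_def distrib_right)
qed

lemma bnd_mult:
  assumes "bnd X K" "bnd Y L"
  shows "bnd (X ** Y) (K * L)"
proof -
  have "tnorm (X ** Y *v \<xi>) \<le> K * (L * tnorm \<xi>)" for \<xi>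
    unfolding matrix_vector_mul_assoc[symmetric]
    by (rule order_trans[OF bndD[OF assms(1)] mult_left_mono[OF bndD[OF assms(2)] bnd_ge_0[OF assms(1)]]])
  then show ?thesis
    using assms[THEN bnd_ge_0] by (simp add: bnd_def mult.assoc)
qed

lemma bnd_scaleR:
  assumes "bnd X K"
  shows "bnd (r *\<^sub>R X) (\<bar>r\<bar> * K)"
proof -
  have "\<bar>r\<bar> * tnorm (X *v \<xi>) \<le> \<bar>r\<bar> * (K * tnorm \<xi>)" for \<xi>
    by (intro mult_left_mono bndD assms) auto
  then show ?thesis
    using bnd_ge_0[OF assms]
    by (simp add: bnd_def matrix_vector_scaleR_left tnorm_scaleR mult.assoc)
qed

lemma bnd_zero: "bnd 0 0"
  by (simp add: bnd_def tnorm_eq_0)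

lemma bnd_mono:
  assumes "bnd X K" "K \<le> L"
  shows "bnd X L"
proof -
  have "tnorm (X *v \<xi>) \<le> L * tnorm \<xi>" for \<xi>
    using bndD[OF assms(1), of \<xi>] mult_right_mono[OF assms(2), of "tnorm \<xi>"] by simp
  then show ?thesis using bnd_ge_0[OF assms(1)] assms(2) by (simp add: bnd_def)
qed

lemma tnorm_axis: "tnorm (axis k x) = sqrt (sqn x)"
  by (simp add: tnorm_def rip_self_sqn axis_def if_distrib[of sqn] sqn_def[of 0] cong: if_cong)

lemma sqn_le_tnorm: "sqn (\<xi> $ k) \<le> (tnorm \<xi>)\<^sup>2"
  unfolding tnorm_square rip_self_sqn by (rule member_le_sum) auto

text \<open>The isometry of the GNS representation lets an operator bound control the entries. So
  limits of operator-bounded iterations exist in the complete norm of the matrices.\<close>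

lemma bnd_norm_entry:
  assumes "bnd X K"
  shows "norm (X $ i $ j) \<le> K"
proof (rule norm_le_if_sqn_le)
  show "0 \<le> K" using assms bnd_ge_0 by blast
  fix b
  have "X $ i $ j * b = (X *v axis j b) $ i"
    by (simp add: matrix_vector_mult_def axis_def if_distrib[of "\<lambda>x. _ * x"] cong: if_cong)
  then have "sqn (X $ i $ j * b) \<le> (tnorm (X *v axis j b))\<^sup>2" using sqn_le_tnorm by simp
  also have "\<dots> \<le> (K * tnorm (axis j b))\<^sup>2" by (intro power_mono bndD assms) auto
  finally show "sqn (X $ i $ j * b) \<le> K\<^sup>2 * sqn b" by (simp add: tnorm_axis power_mult_distrib)
qed

lemma bnd_norm:
  assumes "bnd (X :: 'a ^ 'd ^ 'd) K"
  shows "norm X \<le> (real CARD('d) * real CARD('d)) * K"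
proof -
  have "norm X \<le> (\<Sum>i\<in>UNIV. norm (X $ i))"
    unfolding norm_vec_def[of X] by (rule L2_set_le_sum) auto
  also have "\<dots> \<le> (\<Sum>i\<in>(UNIV::'d set). \<Sum>j\<in>(UNIV::'d set). norm (X $ i $ j))"
    by (rule sum_mono) (simp add: norm_vec_def L2_set_le_sum)
  also have "\<dots> \<le> (\<Sum>i\<in>(UNIV::'d set). \<Sum>j\<in>(UNIV::'d set). K)"
    by (intro sum_mono bnd_norm_entry assms)
  finally show ?thesis by simp
qed

lemma bnd_exists: "\<exists>K>0. bnd X K"
proof -
  define C where "C i = (\<Sum>j\<in>UNIV. norm (X $ i $ j))" for i
  have C: "0 \<le> C i" for i by (simp add: C_def sum_nonneg)
  have entry: "tnorm (axis i ((X *v \<xi>) $ i)) \<le> C i * tnorm \<xi>" for i \<xi>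
  proof -
    have "axis i ((X *v \<xi>) $ i) = (\<Sum>j\<in>UNIV. axis i (X $ i $ j * \<xi> $ j))"
      by (simp add: matrix_vector_mult_def vec_eq_iff axis_def)
    then have "tnorm (axis i ((X *v \<xi>) $ i)) \<le> (\<Sum>j\<in>UNIV. sqrt (sqn (X $ i $ j * \<xi> $ j)))"
      using tnorm_sum_le[of "\<lambda>j. axis i (X $ i $ j * \<xi> $ j)" UNIV] by (simp add: tnorm_axis)
    also have "\<dots> \<le> (\<Sum>j\<in>UNIV. norm (X $ i $ j) * tnorm \<xi>)"
    proof (rule sum_mono)
      fix j
      have "sqn (X $ i $ j * \<xi> $ j) \<le> (norm (X $ i $ j))\<^sup>2 * (tnorm \<xi>)\<^sup>2"
        by (meson sqn_mult_le sqn_le_tnorm mult_left_mono order_trans zero_le_power2)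
      then show "sqrt (sqn (X $ i $ j * \<xi> $ j)) \<le> norm (X $ i $ j) * tnorm \<xi>"
        by (intro real_le_lsqrt) (auto simp: power_mult_distrib)
    qed
    finally show ?thesis by (simp add: C_def sum_distrib_right)
  qed
  have "tnorm (X *v \<xi>) \<le> (\<Sum>i\<in>UNIV. C i) * tnorm \<xi>" for \<xi>
  proof -
    have "X *v \<xi> = (\<Sum>i\<in>UNIV. axis i ((X *v \<xi>) $ i))"
      by (simp add: vec_eq_iff axis_def)
    then have "tnorm (X *v \<xi>) = tnorm (\<Sum>i\<in>UNIV. axis i ((X *v \<xi>) $ i))"
      by (rule arg_cong)
    also have "\<dots> \<le> (\<Sum>i\<in>UNIV. tnorm (axis i ((X *v \<xi>) $ i)))"
      by (rule tnorm_sum_le)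
    also have "\<dots> \<le> (\<Sum>i\<in>UNIV. C i * tnorm \<xi>)" by (intro sum_mono entry)
    finally show ?thesis by (simp add: sum_distrib_right)
  qed
  then have "bnd X (\<Sum>i\<in>UNIV. C i)" by (simp add: bnd_def C sum_nonneg)
  \<comment> \<open>Adding 1 makes the constant positive, so that one can divide by it even for
    \<open>X = 0\<close>.\<close>
  then have "bnd X ((\<Sum>i\<in>UNIV. C i) + 1)" by (rule bnd_mono) simp
  then show ?thesis using C by (intro exI[of _ "(\<Sum>i\<in>UNIV. C i) + 1"]) (simp add: sum_nonneg add_nonneg_pos)
qed

lemma bnd_mat_star: "bnd X K \<Longrightarrow> bnd (mat_star X) K"
  unfolding bnd_def
proof safe
  fix \<xi> assume K: "0 \<le> K" and X: "\<forall>\<xi>. tnorm (X *v \<xi>) \<le> K * tnorm \<xi>"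
  define \<eta> where "\<eta> = mat_star X *v \<xi>"
  have "tnorm \<eta> * tnorm \<eta> = rip \<xi> (X *v \<eta>)"
    by (simp add: \<eta>_def rip_adjoint flip: tnorm_square power2_eq_square)
  also have "\<dots> \<le> tnorm \<xi> * tnorm (X *v \<eta>)" using rip_le_tnorm abs_le_D1 by blast
  also have "\<dots> \<le> tnorm \<xi> * (K * tnorm \<eta>)" using X by (simp add: mult_left_mono)
  finally have "tnorm \<eta> * tnorm \<eta> \<le> (K * tnorm \<xi>) * tnorm \<eta>" by (simp add: mult_ac)
  then show "tnorm \<eta> \<le> K * tnorm \<xi>"
    using K tnorm_ge_0[of \<eta>] by (cases "tnorm \<eta> = 0") auto
qed

lemma continuous_on_matrix_form:
  "continuous_on S (\<lambda>u. rip \<xi> (u *v (\<eta> :: 'a ^ 'd)))"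
  unfolding rip_def tip_def matrix_vector_mult_def
  by (simp, intro continuous_intros)

lemma continuous_on_mult_right: "continuous_on S (\<lambda>u. u ** (X :: 'a ^ 'd ^ 'e))"
  unfolding matrix_matrix_mult_def by (intro continuous_intros)

lemma continuous_on_mult_left: "continuous_on S (\<lambda>u. (X :: 'a ^ 'd ^ 'e) ** u)"
  unfolding matrix_matrix_mult_def by (intro continuous_intros)

lemma continuous_on_mat_star: "continuous_on S (mat_star :: 'a ^ 'd ^ 'e \<Rightarrow> _)"
  unfolding mat_star_def by (intro continuous_intros)

lemma bounded_bilinear_matrix_mult:
  "bounded_bilinear ((**) :: 'a ^ 'd ^ 'd \<Rightarrow> 'a ^ 'd ^ 'd \<Rightarrow> _)"
proof (unfold_locales, goal_cases)
  case 5
  define N where "N = real CARD('d) * (real CARD('d) * real CARD('d))"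
  have entry: "norm ((X ** Y) $ i $ j) \<le> real CARD('d) * (norm X * norm Y)"
    for X Y :: "'a ^ 'd ^ 'd" and i j
  proof -
    have e: "norm (Z $ k $ l) \<le> norm Z" for Z :: "'a ^ 'd ^ 'd" and k l
      by (rule order_trans[OF Finite_Cartesian_Product.norm_nth_le Finite_Cartesian_Product.norm_nth_le])
    have "norm ((X ** Y) $ i $ j) \<le> (\<Sum>k\<in>UNIV. norm (X $ i $ k * Y $ k $ j))"
      unfolding matrix_matrix_mult_def by (simp add: norm_sum)
    also have "\<dots> \<le> (\<Sum>k\<in>(UNIV::'d set). norm X * norm Y)"
      by (intro sum_mono order_trans[OF norm_mult_ineq] mult_mono e) auto
    finally show ?thesis by simp
  qed
  have "norm (X ** Y) \<le> norm X * norm Y * N" for X Y :: "'a ^ 'd ^ 'd"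
  proof -
    have "norm (X ** Y) \<le> (\<Sum>i\<in>UNIV. norm ((X ** Y) $ i))"
      unfolding norm_vec_def[of "X ** Y"] by (rule L2_set_le_sum) auto
    also have "\<dots> \<le> (\<Sum>i\<in>(UNIV::'d set). \<Sum>j\<in>(UNIV::'d set). norm ((X ** Y) $ i $ j))"
      by (rule sum_mono) (simp add: norm_vec_def L2_set_le_sum)
    also have "\<dots> \<le> (\<Sum>i\<in>(UNIV::'d set). \<Sum>j\<in>(UNIV::'d set). real CARD('d) * (norm X * norm Y))"
      by (intro sum_mono entry)
    finally show ?thesis by (simp add: N_def mult_ac)
  qed
  then show ?case by blast
qed (auto simp: matrix_add_ldistrib matrix_add_rdistrib matrix_scalar_ac scalar_matrix_assoc)

end


section \<open>Spectral theory of self-adjoint matrices\<close>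

lemma invertible_commuting_factor:
  assumes "A ** B = B ** A" "invertible (A ** B)"
  shows "invertible (A :: 'a::semiring_1 ^ 'd ^ 'd)"
proof -
  obtain C where C: "A ** B ** C = mat 1" "C ** (A ** B) = mat 1"
    using assms(2) unfolding invertible_def by blast
  have l: "(C ** B) ** A = mat 1" using C(2) assms(1) by (simp add: matrix_mul_assoc)
  have r: "A ** (B ** C) = mat 1" using C(1) by (simp add: matrix_mul_assoc)
  have "C ** B = (C ** B) ** (A ** (B ** C))" using r by simp
  also have "\<dots> = B ** C" using l by (simp add: matrix_mul_assoc)
  finally show ?thesis using l r unfolding invertible_def by auto
qed

lemma invertible_minus: "invertible (- (A :: 'a::ring_1 ^ 'd ^ 'd)) \<longleftrightarrow> invertible A"
proof -
  have *: "invertible (- B)" if B: "invertible B" for B :: "'a ^ 'd ^ 'd"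
  proof -
    obtain C where "B ** C = mat 1" "C ** B = mat 1" using B unfolding invertible_def by blast
    then have "(- B) ** (- C) = mat 1" "(- C) ** (- B) = mat 1"
      by (simp_all add: matrix_matrix_mult_def)
    then show ?thesis unfolding invertible_def by blast
  qed
  show ?thesis using *[of A] *[of "- A"] by auto
qed

lemma mat_scaleR: "mat (r *\<^sub>R x) = r *\<^sub>R mat x"
  by (simp add: mat_def vec_eq_iff)

lemma mat_of_real_scaleC: "mat (complex_of_real t *\<^sub>C (1::'a::cstar_algebra)) = t *\<^sub>R mat 1"
  by (simp add: scaleC_of_real mat_scaleR)

lemma real_in_spectrum:
  "complex_of_real t \<in> spectrum y \<longleftrightarrow> \<not> invertible (y - t *\<^sub>R mat 1)"
  by (simp add: spectrum_def mat_of_real_scaleC)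

context tracial
begin

text \<open>Cauchy-Schwarz for the form of \<open>T\<close> at \<open>T *v \<eta>\<close> and \<eta>
  turns the form bound into a norm bound. Both vectors lie in \<open>V\<close>, so the form bound is
  needed only there; \<open>form_ge_0_from_subspace\<close> uses this.\<close>

lemma tnorm_le_if_form_le:
  assumes T: "mat_star T = T" and pos: "\<And>\<xi>. 0 \<le> rip \<xi> (T *v \<xi>)"
    and inv: "\<And>\<xi>. \<xi> \<in> V \<Longrightarrow> T *v \<xi> \<in> V"
    and le: "\<And>\<xi>. \<xi> \<in> V \<Longrightarrow> rip \<xi> (T *v \<xi>) \<le> q * rip \<xi> \<xi>"
    and q: "0 \<le> q" and \<eta>: "\<eta> \<in> V"
  shows "tnorm (T *v \<eta>) \<le> q * tnorm \<eta>"
proof -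
  define \<zeta> where "\<zeta> = T *v \<eta>"
  have \<zeta>: "\<zeta> \<in> V" using inv \<eta> by (simp add: \<zeta>_def)
  have "(rip \<zeta> \<zeta>)\<^sup>2 \<le> rip \<zeta> (T *v \<zeta>) * rip \<eta> (T *v \<eta>)"
    using form_cauchy_schwarz[OF T pos, of \<zeta> \<eta>] by (simp add: \<zeta>_def)
  also have "\<dots> \<le> (q * rip \<zeta> \<zeta>) * (q * rip \<eta> \<eta>)"
    using le[OF \<zeta>] le[OF \<eta>] pos q by (intro mult_mono) auto
  finally have le2: "rip \<zeta> \<zeta> * rip \<zeta> \<zeta> \<le> rip \<zeta> \<zeta> * (q\<^sup>2 * rip \<eta> \<eta>)"
    by (simp add: power2_eq_square mult_ac)
  have "rip \<zeta> \<zeta> \<le> q\<^sup>2 * rip \<eta> \<eta>"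
  proof (cases "rip \<zeta> \<zeta> = 0")
    case False
    then have "0 < rip \<zeta> \<zeta>" using rip_self_ge_0[of \<zeta>] by linarith
    with le2 show ?thesis by simp
  qed simp
  then have "(tnorm \<zeta>)\<^sup>2 \<le> (q * tnorm \<eta>)\<^sup>2" by (simp add: tnorm_square power_mult_distrib)
  then show ?thesis using q unfolding \<zeta>_def by (meson mult_nonneg_nonneg power2_le_imp_le tnorm_ge_0)
qed

lemma bnd_form_le: "bnd X K \<Longrightarrow> \<bar>rip \<xi> (X *v \<xi>)\<bar> \<le> K * rip \<xi> \<xi>"
proof -
  assume X: "bnd X K"
  have "\<bar>rip \<xi> (X *v \<xi>)\<bar> \<le> tnorm \<xi> * tnorm (X *v \<xi>)" by (rule rip_le_tnorm)
  also have "\<dots> \<le> tnorm \<xi> * (K * tnorm \<xi>)" by (intro mult_left_mono bndD X) auto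
  finally show ?thesis by (simp add: mult_ac flip: tnorm_square power2_eq_square)
qed

text \<open>Neumann series. The left inverse follows in \<open>invertible_one_minus\<close> by
  passing to adjoints.\<close>

lemma right_inverse_one_minus:
  assumes b: "bnd b q" and q: "q < 1"
  shows "\<exists>Y. (mat 1 - b) ** Y = mat 1"
proof -
  interpret mm: bounded_bilinear "(**) :: 'a ^ 'b ^ 'b \<Rightarrow> 'a ^ 'b ^ 'b \<Rightarrow> _"
    by (rule bounded_bilinear_matrix_mult)
  define y where "y = rec_nat 0 (\<lambda>_ u. mat 1 + b ** u)"
  have y0: "y 0 = 0" and yS: "y (Suc k) = mat 1 + b ** y k" for k by (auto simp: y_def)
  define \<eta> :: "nat \<Rightarrow> real" where "\<eta> k = (\<Sum>i<k. q ^ i)" for k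
  have inc: "bnd (y (Suc k) - y k) (q ^ k)" for k
  proof (induction k)
    case 0
    then show ?case by (simp add: y0 yS bnd_def)
  next
    case (Suc k)
    have "y (Suc (Suc k)) - y (Suc k) = b ** (y (Suc k) - y k)"
      unfolding yS[of "Suc k"] using yS[of k] by (simp add: matrix_diff_ldistrib)
    then show ?case using bnd_mult[OF b Suc] by simp
  qed
  have "norm (y (Suc k) - y k) \<le> (real CARD('b) * real CARD('b)) * (\<eta> (Suc k) - \<eta> k)" for k
    using bnd_norm[OF inc[of k]] by (simp add: \<eta>_def)
  moreover have "convergent \<eta>"
    using summable_geometric[of q] bnd_ge_0[OF b] q by (simp add: summable_iff_convergent \<eta>_def[abs_def])
  ultimately obtain Y where Y: "y \<longlonglongrightarrow> Y"
    using convergent_if_dominated_increments unfolding convergent_def by blast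
  have "(\<lambda>k. mat 1 + b ** y k) \<longlonglongrightarrow> mat 1 + b ** Y"
    by (intro tendsto_intros mm.tendsto Y)
  moreover have "(\<lambda>k. y (Suc k)) \<longlonglongrightarrow> Y" using Y LIMSEQ_Suc by blast
  ultimately have "mat 1 + b ** Y = Y" unfolding yS using LIMSEQ_unique by blast
  then have "(mat 1 - b) ** Y = mat 1"
    by (metis add_diff_cancel_right' matrix_diff_rdistrib matrix_mul_lid)
  then show ?thesis by blast
qed

lemma invertible_one_minus:
  assumes b: "bnd b q" and q: "q < 1"
  shows "invertible (mat 1 - b)"
proof -
  obtain Y where Y: "(mat 1 - b) ** Y = mat 1" using right_inverse_one_minus[OF b q] by blast
  obtain Z where "(mat 1 - mat_star b) ** Z = mat 1"
    using right_inverse_one_minus[OF bnd_mat_star[OF b] q] by blast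
  then have "mat_star ((mat 1 - mat_star b) ** Z) = mat 1" by simp
  then have Z: "mat_star Z ** (mat 1 - b) = mat 1" by (simp add: mat_star_mult mat_star_diff)
  have "mat_star Z = mat_star Z ** ((mat 1 - b) ** Y)" using Y by simp
  also have "\<dots> = Y" using Z by (simp add: matrix_mul_assoc)
  finally show ?thesis using Y Z unfolding invertible_def by auto
qed

definition form_ge :: "'a ^ 'd ^ 'd \<Rightarrow> real \<Rightarrow> bool" where
  "form_ge y t \<longleftrightarrow> (\<forall>\<xi>. t * rip \<xi> \<xi> \<le> rip \<xi> (y *v \<xi>))"

lemma form_geD: "form_ge y t \<Longrightarrow> t * rip \<xi> \<xi> \<le> rip \<xi> (y *v \<xi>)"
  by (simp add: form_ge_def)

lemma rip_shift: "rip \<xi> ((y - t *\<^sub>R mat 1) *v \<xi>) = rip \<xi> (y *v \<xi>) - t * rip \<xi> \<xi>"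
  by (simp add: matrix_vector_mult_diff_rdistrib rip_diff_right matrix_vector_scaleR_left
      rip_scaleR_right)

text \<open>If K \<ge> \<delta> bounds y, then T = 1 - y / K lies between 0 and 1 - \<delta> / K, so
  y = K (1 - T) is inverted by a Neumann series.\<close>

lemma invertible_if_form_ge:
  assumes y: "mat_star y = y" and \<delta>: "0 < \<delta>" and ge: "form_ge y \<delta>"
  shows "invertible y"
proof -
  obtain K0 where K0: "0 < K0" "bnd y K0" using bnd_exists by blast
  define K where "K = K0 + \<delta>"
  have K: "0 < K" "\<delta> \<le> K" "bnd y K" using K0 \<delta> bnd_mono[OF K0(2), of K] by (auto simp: K_def)
  define T where "T = mat 1 - (1 / K) *\<^sub>R y"
  have form: "rip \<xi> (T *v \<xi>) = rip \<xi> \<xi> - rip \<xi> (y *v \<xi>) / K" for \<xi>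
    by (simp add: T_def matrix_vector_mult_diff_rdistrib rip_diff_right matrix_vector_scaleR_left
        rip_scaleR_right)
  have "bnd T (1 - \<delta> / K)"
    unfolding bnd_def
  proof (intro conjI allI)
    show "0 \<le> 1 - \<delta> / K" using K by simp
    show "tnorm (T *v \<eta>) \<le> (1 - \<delta> / K) * tnorm \<eta>" for \<eta>
    proof (rule tnorm_le_if_form_le[where V=UNIV])
      show "mat_star T = T" by (simp add: T_def mat_star_diff mat_star_scaleR y)
      show "0 \<le> rip \<xi> (T *v \<xi>)" for \<xi>
        using bnd_form_le[OF K(3), of \<xi>] K(1) by (simp add: form field_simps)
      show "rip \<xi> (T *v \<xi>) \<le> (1 - \<delta> / K) * rip \<xi> \<xi>" for \<xi>
        using form_geD[OF ge, of \<xi>] K(1) by (simp add: form field_simps)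
    qed (use K in auto)
  qed
  then have "invertible (mat 1 - T)" by (rule invertible_one_minus) (use K \<delta> in auto)
  then have "invertible (K *\<^sub>R (mat 1 - T))" using K by (intro scalar_invertible) auto
  then show ?thesis using K by (simp add: T_def)
qed

lemma not_in_spectrum_below:
  assumes "mat_star y = y" "form_ge y m" "t < m"
  shows "complex_of_real t \<notin> spectrum y"
proof -
  have "form_ge (y - t *\<^sub>R mat 1) (m - t)"
    using assms(2) by (simp add: form_ge_def rip_shift left_diff_distrib)
  then show ?thesis
    unfolding real_in_spectrum
    using invertible_if_form_ge[of "y - t *\<^sub>R mat 1" "m - t"] assms
    by (simp add: mat_star_diff mat_star_scaleR)
qed

text \<open>\<open>J\<close> is the central matrix i Im c, so (p - J)(p + J) = p^2 + (Im c)^2 is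
  bounded below by (Im c)^2 > 0; a commuting factor of an invertible matrix is invertible.\<close>

lemma spectrum_selfadj_real:
  fixes y :: "'a ^ 'd ^ 'd"
  assumes y: "mat_star y = y" and c: "c \<in> spectrum y"
  shows "c = complex_of_real (Re c)"
proof (rule ccontr)
  assume "c \<noteq> complex_of_real (Re c)"
  then have \<beta>: "Im c \<noteq> 0" by (simp add: complex_eq_iff)
  define p where "p = y - Re c *\<^sub>R mat 1"
  define J :: "'a ^ 'd ^ 'd" where "J = mat (Im c *\<^sub>R (\<i> *\<^sub>C 1))"
  have Jc: "J ** X = X ** J" for X :: "'a ^ 'd ^ 'd"
    by (simp add: J_def matrix_matrix_mult_def mat_def if_distrib[of "\<lambda>x. x * _"]
        if_distrib[of "\<lambda>x. _ * x"] mult_scaleC_left mult_scaleC_right vec_eq_iff cong: if_cong)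
  have "(Im c *\<^sub>R (\<i> *\<^sub>C (1::'a))) * (Im c *\<^sub>R (\<i> *\<^sub>C 1)) = - ((Im c)\<^sup>2 *\<^sub>R 1)"
    by (simp add: mult_scaleC_left scaleC_scaleC scaleC_minus_left power2_eq_square)
  moreover have "mat u ** mat v = (mat (u * v) :: 'a ^ 'd ^ 'd)" for u v :: 'a
    by (simp add: matrix_matrix_mult_def mat_def vec_eq_iff if_distrib[of "\<lambda>x. x * _"] cong: if_cong)
  moreover have "mat (- u) = - (mat u :: 'a ^ 'd ^ 'd)" for u :: 'a by (simp add: mat_def vec_eq_iff)
  ultimately have JJ: "J ** J = - ((Im c)\<^sup>2 *\<^sub>R mat 1)"
    unfolding J_def by (simp only: mat_scaleR[of "(Im c)\<^sup>2"])
  have "c *\<^sub>C (1::'a) = Re c *\<^sub>R 1 + Im c *\<^sub>R (\<i> *\<^sub>C 1)"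
    by (simp add: scaleC_scaleC mult.commute[of _ \<i>] flip: scaleC_of_real scaleC_add_left complex_eq)
  moreover have "mat (u + v) = mat u + (mat v :: 'a ^ 'd ^ 'd)" for u v :: 'a by (simp add: mat_def vec_eq_iff)
  ultimately have "y - mat (c *\<^sub>C 1) = p - J"
    by (simp add: p_def J_def mat_scaleR)
  have prod: "(p - J) ** (p + J) = p ** p + (Im c)\<^sup>2 *\<^sub>R mat 1"
    by (simp add: matrix_add_ldistrib matrix_diff_rdistrib JJ Jc[of p])
  have "(p - J) ** (p + J) = (p + J) ** (p - J)"
    by (simp add: matrix_add_ldistrib matrix_add_rdistrib matrix_diff_rdistrib matrix_diff_ldistrib Jc[of p])
  moreover have "invertible ((p - J) ** (p + J))"
    unfolding prod
  proof (rule invertible_if_form_ge)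
    have p: "mat_star p = p" by (simp add: p_def mat_star_diff mat_star_scaleR y)
    then show "mat_star (p ** p + (Im c)\<^sup>2 *\<^sub>R mat 1) = p ** p + (Im c)\<^sup>2 *\<^sub>R mat 1"
      by (simp add: mat_star_add mat_star_mult mat_star_scaleR)
    have "rip \<xi> (p ** p *v \<xi>) = rip (p *v \<xi>) (p *v \<xi>)" for \<xi>
      by (simp add: rip_selfadj[OF p] flip: matrix_vector_mul_assoc)
    then show "form_ge (p ** p + (Im c)\<^sup>2 *\<^sub>R mat 1) ((Im c)\<^sup>2)"
      by (simp add: form_ge_def matrix_vector_mult_add_rdistrib rip_add_right matrix_vector_scaleR_left
          rip_scaleR_right)
  qed (use \<beta> in simp)
  ultimately have "invertible (p - J)" by (rule invertible_commuting_factor)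
  then show False using c \<open>y - mat (c *\<^sub>C 1) = p - J\<close> by (simp add: spectrum_def)
qed

text \<open>Invertibility bounds \<xi> by y \<xi>, and Cauchy-Schwarz for the form of
  \<open>y\<close> bounds the squared norm of y \<xi> by a multiple of the form at \<xi>.\<close>

lemma form_gap_if_invertible:
  assumes y: "mat_star y = y" and pos: "form_ge y 0" and inv: "invertible y"
  shows "\<exists>\<delta>>0. form_ge y \<delta>"
proof -
  obtain Q where Q: "Q ** y = mat 1" using inv unfolding invertible_def by blast
  obtain K where K: "0 < K" "bnd Q K" using bnd_exists by blast
  obtain L where L: "0 < L" "bnd y L" using bnd_exists by blast
  have pos': "0 \<le> rip \<xi> (y *v \<xi>)" for \<xi> using form_geD[OF pos, of \<xi>] by simp
  have "rip \<xi> \<xi> \<le> K\<^sup>2 * L * rip \<xi> (y *v \<xi>)" for \<xi>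
  proof -
    define \<zeta> where "\<zeta> = y *v \<xi>"
    have "\<xi> = Q *v \<zeta>" by (simp add: \<zeta>_def matrix_vector_mul_assoc Q)
    then have "tnorm \<xi> \<le> K * tnorm \<zeta>" using bndD[OF K(2)] by simp
    then have 1: "rip \<xi> \<xi> \<le> K\<^sup>2 * rip \<zeta> \<zeta>"
      unfolding tnorm_square[symmetric] power_mult_distrib[symmetric] by (intro power_mono) auto
    have "(rip \<zeta> \<zeta>)\<^sup>2 \<le> rip \<zeta> (y *v \<zeta>) * rip \<xi> (y *v \<xi>)"
      using form_cauchy_schwarz[OF y pos', of \<zeta> \<xi>] by (simp add: \<zeta>_def)
    also have "\<dots> \<le> (L * rip \<zeta> \<zeta>) * rip \<xi> (y *v \<xi>)"
      using bnd_form_le[OF L(2), of \<zeta>] pos' by (intro mult_right_mono) auto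
    finally have 2: "rip \<zeta> \<zeta> * rip \<zeta> \<zeta> \<le> rip \<zeta> \<zeta> * (L * rip \<xi> (y *v \<xi>))"
      by (simp add: power2_eq_square mult_ac)
    have "rip \<zeta> \<zeta> \<le> L * rip \<xi> (y *v \<xi>)"
    proof (cases "rip \<zeta> \<zeta> = 0")
      case True
      then show ?thesis using L pos' by simp
    next
      case False
      then have "0 < rip \<zeta> \<zeta>" using rip_self_ge_0[of \<zeta>] by linarith
      with 2 show ?thesis by simp
    qed
    then have "K\<^sup>2 * rip \<zeta> \<zeta> \<le> K\<^sup>2 * (L * rip \<xi> (y *v \<xi>))" by (rule mult_left_mono) simp
    with 1 show ?thesis by simp
  qed
  then have "form_ge y (1 / (K\<^sup>2 * L))"
    using K L by (simp add: form_ge_def field_simps)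
  then show ?thesis using K L by (intro exI[of _ "1 / (K\<^sup>2 * L)"]) auto
qed

lemma vec_nonzero_exists: "\<exists>\<xi>::'a ^ 'd. 0 < rip \<xi> \<xi>"
  by (rule exI[of _ "axis undefined 1"], rule rip_self_pos) (simp add: axis_eq_0_iff)

text \<open>The best lower bound \<open>m\<close> of the form is a spectral value: if y - m were
  invertible, \<open>form_gap_if_invertible\<close> would improve \<open>m\<close>.\<close>

lemma spectrum_bottom:
  assumes y: "mat_star y = y"
  shows "\<exists>m. complex_of_real m \<in> spectrum y \<and> form_ge y m"
proof -
  define S where "S = {t. form_ge y t}"
  obtain K where K: "0 < K" "bnd y K" using bnd_exists by blast
  have "-K \<in> S" unfolding S_def form_ge_def using bnd_form_le[OF K(2)] by (smt (verit) mem_Collect_eq mult_minus_left)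
  obtain \<xi>0 :: "'a ^ 'b" where \<xi>0: "0 < rip \<xi>0 \<xi>0" using vec_nonzero_exists by blast
  have bdd: "bdd_above S"
  proof (rule bdd_aboveI)
    fix t assume "t \<in> S"
    then have "t * rip \<xi>0 \<xi>0 \<le> rip \<xi>0 (y *v \<xi>0)" unfolding S_def form_ge_def by blast
    then show "t \<le> rip \<xi>0 (y *v \<xi>0) / rip \<xi>0 \<xi>0" using \<xi>0 by (simp add: field_simps)
  qed
  define m where "m = Sup S"
  have m: "form_ge y m"
    unfolding form_ge_def
  proof
    fix \<xi>
    show "m * rip \<xi> \<xi> \<le> rip \<xi> (y *v \<xi>)"
    proof (cases "rip \<xi> \<xi> = 0")
      case True
      then show ?thesis by (simp add: rip_self_eq_0)
    next
      case False
      then have pos: "0 < rip \<xi> \<xi>" using rip_self_ge_0[of \<xi>] by linarith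
      have "m \<le> rip \<xi> (y *v \<xi>) / rip \<xi> \<xi>"
        unfolding m_def
      proof (rule cSup_least)
        show "S \<noteq> {}" using \<open>-K \<in> S\<close> by blast
        fix t assume "t \<in> S"
        then have "t * rip \<xi> \<xi> \<le> rip \<xi> (y *v \<xi>)" unfolding S_def form_ge_def by blast
        then show "t \<le> rip \<xi> (y *v \<xi>) / rip \<xi> \<xi>" using pos by (simp add: field_simps)
      qed
      then show ?thesis using pos by (simp add: field_simps)
    qed
  qed
  have "\<not> invertible (y - m *\<^sub>R mat 1)"
  proof
    assume "invertible (y - m *\<^sub>R mat 1)"
    moreover have "form_ge (y - m *\<^sub>R mat 1) 0" using m by (simp add: form_ge_def rip_shift)
    moreover have "mat_star (y - m *\<^sub>R mat 1) = y - m *\<^sub>R mat 1"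
      by (simp add: mat_star_diff mat_star_scaleR y)
    ultimately obtain \<delta> where \<delta>: "0 < \<delta>" "form_ge (y - m *\<^sub>R mat 1) \<delta>"
      using form_gap_if_invertible by blast
    then have "form_ge y (m + \<delta>)"
      by (auto simp: form_ge_def rip_shift distrib_right le_diff_eq add.commute)
    then have "m + \<delta> \<in> S" by (simp add: S_def)
    then have "m + \<delta> \<le> m" unfolding m_def using bdd by (rule cSup_upper)
    then show False using \<delta> by simp
  qed
  then show ?thesis using m by (auto simp: real_in_spectrum)
qed

lemma lambda_min_unique:
  assumes y: "mat_star y = y" and "complex_of_real m \<in> spectrum y" "form_ge y m"
  shows "lambda_min y = m"
  unfolding lambda_min_def
proof (rule cInf_eq_minimum)
  show "m \<le> t" if "t \<in> {t. complex_of_real t \<in> spectrum y}" for t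
    using not_in_spectrum_below[OF y assms(3), of t] that by force
qed (use assms in simp)

lemma lambda_min_in_spectrum: "mat_star y = y \<Longrightarrow> complex_of_real (lambda_min y) \<in> spectrum y"
  and form_ge_lambda_min: "mat_star y = y \<Longrightarrow> form_ge y (lambda_min y)"
  using spectrum_bottom lambda_min_unique by metis+

lemma form_ge_mono: "form_ge y t \<Longrightarrow> t' \<le> t \<Longrightarrow> form_ge y t'"
  unfolding form_ge_def by (meson mult_right_mono order_trans rip_self_ge_0)

lemma le_lambda_min_iff:
  assumes y: "mat_star y = y"
  shows "t \<le> lambda_min y \<longleftrightarrow> form_ge y t"
  using form_ge_mono[OF form_ge_lambda_min[OF y]] not_in_spectrum_below[OF y, of t "lambda_min y"]
    lambda_min_in_spectrum[OF y] not_in_spectrum_below[OF y] by (meson not_le)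

section \<open>The top of the spectrum, by reflection\<close>

lemma spectrum_minus: "c \<in> spectrum (- y) \<longleftrightarrow> - c \<in> spectrum y"
proof -
  have "- y - mat (c *\<^sub>C 1) = - (y - mat ((- c) *\<^sub>C 1))"
    by (simp add: scaleC_minus_left mat_def vec_eq_iff)
  then have "invertible (- y - mat (c *\<^sub>C 1)) \<longleftrightarrow> invertible (y - mat ((- c) *\<^sub>C 1))"
    by (simp only: invertible_minus)
  then show ?thesis by (simp only: spectrum_def mem_Collect_eq)
qed

lemma lambda_max_eq: "lambda_max y = - lambda_min (- y)"
proof -
  have "{t. complex_of_real t \<in> spectrum (- y)} = uminus ` {t. complex_of_real t \<in> spectrum y}"
    by (auto simp: spectrum_minus image_iff intro!: exI[of _ "- _"])
  then show ?thesis unfolding lambda_max_def lambda_min_def Inf_real_def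
    by (simp add: image_image)
qed

lemma lambda_max_in_spectrum:
  fixes y :: "'a ^ 'd ^ 'd"
  assumes "mat_star y = y" shows "complex_of_real (lambda_max y) \<in> spectrum y"
  using lambda_min_in_spectrum[of "- y"] assms
  by (simp add: lambda_max_eq mat_star_minus spectrum_minus)

lemma lambda_max_le_iff:
  fixes y :: "'a ^ 'd ^ 'd"
  assumes "mat_star y = y"
  shows "lambda_max y \<le> t \<longleftrightarrow> (\<forall>\<xi>. rip \<xi> (y *v \<xi>) \<le> t * rip \<xi> \<xi>)"
proof -
  have "lambda_max y \<le> t \<longleftrightarrow> - t \<le> lambda_min (- y)" by (auto simp: lambda_max_eq)
  also have "\<dots> \<longleftrightarrow> form_ge (- y) (- t)" by (rule le_lambda_min_iff) (simp add: mat_star_minus assms)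
  also have "\<dots> \<longleftrightarrow> (\<forall>\<xi>. rip \<xi> (y *v \<xi>) \<le> t * rip \<xi> \<xi>)"
    by (simp add: form_ge_def matrix_vector_scaleR_left[of "-1" y, simplified] rip_minus_right)
  finally show ?thesis .
qed

lemma invertible_outside_spectral_interval:
  fixes y :: "'a ^ 'd ^ 'd"
  assumes y: "mat_star y = y" and t: "lambda_max y < t \<or> t < lambda_min y"
  shows "invertible (t *\<^sub>R mat 1 - y)"
proof -
  have "complex_of_real t \<notin> spectrum y"
    using t
  proof
    assume "lambda_max y < t"
    then have "- t < lambda_min (- y)" by (simp add: lambda_max_eq)
    moreover have "mat_star (- y) = - y" by (simp add: mat_star_minus y)
    ultimately have "complex_of_real (- t) \<notin> spectrum (- y)"
      using not_in_spectrum_below[of "- y" "lambda_min (- y)" "- t"] form_ge_lambda_min[of "- y"] by blast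
    then show ?thesis by (simp add: spectrum_minus)
  next
    assume "t < lambda_min y"
    then show ?thesis using not_in_spectrum_below[OF y form_ge_lambda_min[OF y]] by blast
  qed
  then show ?thesis
    using invertible_minus[of "y - t *\<^sub>R mat 1"] by (simp add: real_in_spectrum)
qed

end


section \<open>Positive square roots and singular values\<close>

context tracial
begin

lemma form_ge_0: "form_ge y 0 \<longleftrightarrow> (\<forall>\<xi>. 0 \<le> rip \<xi> (y *v \<xi>))"
  by (simp add: form_ge_def)

text \<open>One direction needs that the spectrum contains the best lower bound of the form, the
  other that the spectrum is real.\<close>

lemma positive_elem_iff:
  fixes h :: "'a ^ 'd ^ 'd"
  shows "positive_elem h \<longleftrightarrow> mat_star h = h \<and> form_ge h 0"
proof
  assume h: "positive_elem h"
  then have s: "mat_star h = h" by (simp add: positive_elem_def)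
  have "complex_of_real (lambda_min h) \<in> complex_of_real ` {0..}"
    using lambda_min_in_spectrum[OF s] h unfolding positive_elem_def by blast
  then have "0 \<le> lambda_min h" by auto
  then show "mat_star h = h \<and> form_ge h 0" using s le_lambda_min_iff[OF s] by blast
next
  assume h: "mat_star h = h \<and> form_ge h 0"
  have "c \<in> complex_of_real ` {0..}" if "c \<in> spectrum h" for c
  proof -
    have c: "c = complex_of_real (Re c)" using spectrum_selfadj_real h that by blast
    then have "\<not> Re c < 0" using not_in_spectrum_below[of h 0 "Re c"] h that by metis
    then show ?thesis using c by (intro image_eqI[of _ _ "Re c"]) auto
  qed
  then show "positive_elem h" using h by (auto simp: positive_elem_def)
qed

lemma bnd_oneI:
  assumes "mat_star T = T" "\<And>\<xi>. 0 \<le> rip \<xi> (T *v \<xi>)" "\<And>\<xi>. rip \<xi> (T *v \<xi>) \<le> rip \<xi> \<xi>"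
  shows "bnd T 1"
  unfolding bnd_def
proof (intro conjI allI)
  show "tnorm (T *v \<eta>) \<le> 1 * tnorm \<eta>" for \<eta>
    by (rule tnorm_le_if_form_le[where V=UNIV]) (use assms in simp_all)
qed simp

lemma rip_one_minus_scale:
  "rip \<xi> ((mat 1 - r *\<^sub>R y) *v \<xi>) = rip \<xi> \<xi> - r * rip \<xi> (y *v \<xi>)"
  by (simp add: matrix_vector_mult_diff_rdistrib rip_diff_right matrix_vector_scaleR_left
      rip_scaleR_right)

lemma closed_bnd_one: "closed {u :: 'a ^ 'd ^ 'd. bnd u 1}"
proof -
  have eq: "{u :: 'a ^ 'd ^ 'd. bnd u 1} = {u. \<forall>\<xi>. rip \<xi> ((mat_star u ** u) *v \<xi>) \<le> rip \<xi> \<xi>}"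
  proof -
    have "tnorm (u *v \<xi>) \<le> tnorm \<xi> \<longleftrightarrow> rip \<xi> ((mat_star u ** u) *v \<xi>) \<le> rip \<xi> \<xi>"
      for u :: "'a ^ 'd ^ 'd" and \<xi>
      by (simp add: tnorm_def rip_adjoint flip: matrix_vector_mul_assoc)
    then show ?thesis by (simp add: bnd_def)
  qed
  have mm: "continuous_on UNIV (\<lambda>u :: 'a ^ 'd ^ 'd. mat_star u ** u)"
    by (intro bounded_bilinear.continuous_on[OF bounded_bilinear_matrix_mult] continuous_on_mat_star
        continuous_on_id)
  have "continuous_on UNIV (\<lambda>u :: 'a ^ 'd ^ 'd. rip \<xi> ((mat_star u ** u) *v \<xi>))" for \<xi>
    using continuous_on_compose2[OF continuous_on_matrix_form mm] by blast
  then show ?thesis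
    unfolding eq Collect_all_eq
    by (intro closed_INT ballI closed_Collect_le continuous_intros) auto
qed

text \<open>As in \<open>sqrt_one_minus\<close>, with b = 1 - y / K and 0 \<le> b \<le> 1.
  Commutation with everything that commutes with \<open>y\<close> is recorded for the uniqueness of
  the root.\<close>

lemma mat_sqrt_exists:
  fixes y :: "'a ^ 'd ^ 'd"
  assumes y: "mat_star y = y" and pos: "form_ge y 0"
  shows "\<exists>h. mat_star h = h \<and> form_ge h 0 \<and> h ** h = y \<and> (\<forall>z. z ** y = y ** z \<longrightarrow> z ** h = h ** z)"
proof -
  obtain K where K: "0 < K" "bnd y K" using bnd_exists by blast
  define b where "b = mat 1 - (1 / K) *\<^sub>R y"
  have bs: "mat_star b = b" by (simp add: b_def mat_star_diff mat_star_scaleR y)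
  have b1: "bnd b 1"
  proof (rule bnd_oneI)
    fix \<xi>
    show "0 \<le> rip \<xi> (b *v \<xi>)"
      unfolding b_def rip_one_minus_scale using bnd_form_le[OF K(2), of \<xi>] K(1) by (simp add: field_simps)
    show "rip \<xi> (b *v \<xi>) \<le> rip \<xi> \<xi>"
      unfolding b_def rip_one_minus_scale using form_geD[OF pos, of \<xi>] K(1) by simp
  qed (rule bs)
  define S where "S = {u. bnd u 1 \<and> mat_star u = u \<and> (\<forall>z. z ** y = y ** z \<longrightarrow> z ** u = u ** z)}"
  have "closed {u. z ** y = y ** z \<longrightarrow> z ** u = u ** z}" for z
    by (cases "z ** y = y ** z")
      (auto intro!: closed_Collect_eq continuous_on_mult_left continuous_on_mult_right)
  then have "closed {u. \<forall>z. z ** y = y ** z \<longrightarrow> z ** u = u ** z}"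
    unfolding Collect_all_eq by (intro closed_INT ballI) auto
  moreover have "closed {u :: 'a ^ 'd ^ 'd. mat_star u = u}"
    by (intro closed_Collect_eq continuous_on_mat_star continuous_on_id)
  ultimately have S_closed: "closed S"
    unfolding S_def Collect_conj_eq by (intro closed_Int closed_bnd_one)
  have S_step: "(1/2) *\<^sub>R (b + u ** u) \<in> S" if "u \<in> S" for u
  proof -
    have u: "bnd u 1" "mat_star u = u" and uc: "\<And>z. z ** y = y ** z \<Longrightarrow> z ** u = u ** z"
      using that unfolding S_def by blast+
    have "bnd ((1/2) *\<^sub>R (b + u ** u)) (\<bar>1/2\<bar> * (1 + 1 * 1))"
      by (intro bnd_scaleR bnd_add bnd_mult b1 u)
    moreover have "mat_star ((1/2) *\<^sub>R (b + u ** u)) = (1/2) *\<^sub>R (b + u ** u)"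
      by (simp add: mat_star_scaleR mat_star_add mat_star_mult u bs)
    moreover have "z ** ((1/2) *\<^sub>R (b + u ** u)) = ((1/2) *\<^sub>R (b + u ** u)) ** z" if z: "z ** y = y ** z" for z
    proof -
      have "z ** b = b ** z"
        by (simp add: b_def matrix_diff_ldistrib matrix_diff_rdistrib matrix_scalar_ac z
            flip: scalar_matrix_assoc)
      moreover have "z ** (u ** u) = u ** u ** z"
        using uc[OF z] by (metis matrix_mul_assoc)
      ultimately show ?thesis
        by (simp add: matrix_scalar_ac matrix_add_ldistrib matrix_add_rdistrib scaleR_right_distrib
            flip: scalar_matrix_assoc)
    qed
    ultimately show ?thesis unfolding S_def by simp
  qed
  have "\<exists>u\<in>S. 2 *\<^sub>R u = b + u ** u"
  proof (rule sqrt_fixpoint[where mul="(**)" and bnd=bnd and C="real CARD('d) * real CARD('d)"])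
    show "bnd ((1/2) *\<^sub>R x) (K / 2)" if "bnd x K" for x :: "'a ^ 'd ^ 'd" and K
      using bnd_scaleR[OF that, of "1/2"] by simp
    show "0 \<in> S" by (simp add: S_def bnd_def)
    show "bnd (x ** u) (K * L)" if "bnd x K" "bnd u L" for x u :: "'a ^ 'd ^ 'd" and K L
      using that by (rule bnd_mult)
  qed (simp_all add: bounded_bilinear_matrix_mult bnd_add bnd_zero bnd_norm b1 S_closed S_step del: scaleR_right_distrib)
  then obtain u where u: "u \<in> S" "2 *\<^sub>R u = b + u ** u" by blast
  then have us: "bnd u 1" "mat_star u = u" and uc: "\<And>z. z ** y = y ** z \<Longrightarrow> z ** u = u ** z"
    unfolding S_def by blast+
  define h where "h = sqrt K *\<^sub>R (mat 1 - u)"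
  have "mat_star h = h" by (simp add: h_def mat_star_scaleR mat_star_diff us)
  moreover have "form_ge h 0"
    unfolding form_ge_0 h_def
    using bnd_form_le[OF us(1)] K
    by (simp add: matrix_vector_scaleR_left rip_scaleR_right matrix_vector_mult_diff_rdistrib
        rip_diff_right abs_le_iff)
  moreover have "h ** h = y"
  proof -
    have "(mat 1 - u) ** (mat 1 - u) = mat 1 - 2 *\<^sub>R u + u ** u"
      by (simp add: matrix_diff_ldistrib matrix_diff_rdistrib scaleR_2)
    also have "\<dots> = (1 / K) *\<^sub>R y" unfolding u(2) by (simp add: b_def)
    finally show ?thesis
      using K by (simp add: h_def matrix_scalar_ac flip: scalar_matrix_assoc)
  qed
  moreover have "z ** h = h ** z" if "z ** y = y ** z" for z
    using uc[OF that]
    by (simp add: h_def matrix_scalar_ac matrix_diff_ldistrib matrix_diff_rdistrib scaleR_diff_right flip: scalar_matrix_assoc)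
  ultimately show ?thesis by blast
qed

text \<open>Since (h + k)(h - k) = 0, the positive forms of h and k both vanish on the range of d =
  h - k; hence h and k kill that range, so d^2 = 0 and d = 0.\<close>

lemma square_root_unique:
  fixes h k :: "'a ^ 'd ^ 'd"
  assumes h: "mat_star h = h" "form_ge h 0" and k: "mat_star k = k" "form_ge k 0"
    and sq: "h ** h = k ** k" and comm: "k ** h = h ** k"
  shows "h = k"
proof -
  define d where "d = h - k"
  have d: "mat_star d = d" by (simp add: d_def mat_star_diff h k)
  have prod: "(h + k) ** d = 0"
    by (simp add: d_def matrix_diff_ldistrib matrix_add_rdistrib sq comm)
  have z: "d *v \<eta> = 0" for \<eta>
  proof -
    define \<xi> where "\<xi> = d *v \<eta>"
    have "(h + k) *v \<xi> = 0" by (simp add: \<xi>_def matrix_vector_mul_assoc prod)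
    then have "rip \<xi> (h *v \<xi>) + rip \<xi> (k *v \<xi>) = 0"
      by (metis matrix_vector_mult_add_rdistrib rip_add_right rip_zero(2))
    moreover have hk: "\<And>\<zeta>. 0 \<le> rip \<zeta> (h *v \<zeta>)" "\<And>\<zeta>. 0 \<le> rip \<zeta> (k *v \<zeta>)"
      using h k by (auto simp: form_ge_0)
    ultimately have "rip \<xi> (h *v \<xi>) = 0" "rip \<xi> (k *v \<xi>) = 0"
      using hk[of \<xi>] by linarith+
    then have "(rip (h *v \<xi>) (h *v \<xi>))\<^sup>2 \<le> 0" "(rip (k *v \<xi>) (k *v \<xi>))\<^sup>2 \<le> 0"
      using form_cauchy_schwarz[OF h(1) hk(1), of "h *v \<xi>" \<xi>]
        form_cauchy_schwarz[OF k(1) hk(2), of "k *v \<xi>" \<xi>] by auto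
    then have "h *v \<xi> = 0" "k *v \<xi> = 0" by (auto simp: rip_self_eq_0)
    then have "d *v \<xi> = 0" by (simp add: d_def matrix_vector_mult_diff_rdistrib)
    then have "rip \<xi> \<xi> = 0" using rip_selfadj[OF d, of \<eta> \<xi>] by (simp add: \<xi>_def)
    then show ?thesis by (simp add: \<xi>_def rip_self_eq_0)
  qed
  have "d = 0" by (simp add: matrix_eq z)
  then show ?thesis by (simp add: d_def)
qed

lemma mat_sqrt_props:
  fixes y :: "'a ^ 'd ^ 'd"
  assumes y: "mat_star y = y" and pos: "form_ge y 0"
  shows "mat_star (mat_sqrt y) = mat_sqrt y \<and> form_ge (mat_sqrt y) 0 \<and> mat_sqrt y ** mat_sqrt y = y"
proof -
  obtain h where h: "mat_star h = h" "form_ge h 0" "h ** h = y"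
    "\<And>z. z ** y = y ** z \<Longrightarrow> z ** h = h ** z"
    using mat_sqrt_exists[OF y pos] by blast
  have "k = h" if "positive_elem k \<and> k ** k = y" for k
  proof -
    have k: "mat_star k = k" "form_ge k 0" "k ** k = y" using that by (auto simp: positive_elem_iff)
    \<comment> \<open>Any root commutes with its own square \<open>y\<close>, hence with
      \<open>h\<close>.\<close>
    have "k ** y = y ** k" by (simp add: matrix_mul_assoc flip: k(3))
    then have "k ** h = h ** k" by (rule h(4))
    then show ?thesis using square_root_unique[OF h(1,2) k(1,2)] h(3) k(3) by simp
  qed
  moreover have "positive_elem h \<and> h ** h = y" using h(1-3) by (simp add: positive_elem_iff)
  ultimately have "mat_sqrt y = h" unfolding mat_sqrt_def by (rule the_equality[rotated])
  then show ?thesis using h(1-3) by simp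
qed

lemma square_in_spectrum_square:
  assumes "complex_of_real m \<in> spectrum h"
  shows "complex_of_real (m\<^sup>2) \<in> spectrum (h ** h)"
proof -
  have a: "(h - m *\<^sub>R mat 1) ** (h + m *\<^sub>R mat 1) = h ** h - m\<^sup>2 *\<^sub>R mat 1"
    "(h + m *\<^sub>R mat 1) ** (h - m *\<^sub>R mat 1) = h ** h - m\<^sup>2 *\<^sub>R mat 1"
    by (simp_all add: matrix_diff_rdistrib matrix_diff_ldistrib matrix_add_ldistrib matrix_add_rdistrib
        matrix_scalar_ac power2_eq_square scaleR_right_distrib scaleR_diff_right flip: scalar_matrix_assoc)
  show ?thesis
    using invertible_commuting_factor[of "h - m *\<^sub>R mat 1" "h + m *\<^sub>R mat 1"] assms
    unfolding a real_in_spectrum by blast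
qed

lemma square_form:
  assumes "mat_star h = h"
  shows "rip \<xi> (h ** h *v \<xi>) = (tnorm (h *v \<xi>))\<^sup>2"
  unfolding tnorm_square matrix_vector_mul_assoc[symmetric] by (rule rip_selfadj[OF assms])

lemma lambda_min_square:
  fixes h :: "'a ^ 'd ^ 'd"
  assumes h: "mat_star h = h" "form_ge h 0"
  shows "lambda_min (h ** h) = (lambda_min h)\<^sup>2"
proof (rule lambda_min_unique)
  have m0: "0 \<le> lambda_min h" using le_lambda_min_iff[OF h(1)] h(2) by blast
  show "form_ge (h ** h) ((lambda_min h)\<^sup>2)"
    unfolding form_ge_def
  proof
    fix \<xi>
    have "lambda_min h * (tnorm \<xi> * tnorm \<xi>) \<le> tnorm \<xi> * tnorm (h *v \<xi>)"
      using form_geD[OF form_ge_lambda_min[OF h(1)], of \<xi>] rip_le_tnorm[of \<xi> "h *v \<xi>"]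
      by (simp add: flip: tnorm_square power2_eq_square)
    then have "lambda_min h * tnorm \<xi> \<le> tnorm (h *v \<xi>)"
      using tnorm_ge_0[of \<xi>] by (cases "tnorm \<xi> = 0") (auto simp: mult_ac)
    then have "(lambda_min h * tnorm \<xi>)\<^sup>2 \<le> (tnorm (h *v \<xi>))\<^sup>2"
      using m0 by (intro power_mono) auto
    then show "(lambda_min h)\<^sup>2 * rip \<xi> \<xi> \<le> rip \<xi> (h ** h *v \<xi>)"
      by (simp add: square_form[OF h(1)] power_mult_distrib tnorm_square)
  qed
  show "complex_of_real ((lambda_min h)\<^sup>2) \<in> spectrum (h ** h)"
    by (rule square_in_spectrum_square[OF lambda_min_in_spectrum[OF h(1)]])
  show "mat_star (h ** h) = h ** h" by (simp add: mat_star_mult h(1))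
qed

lemma lambda_max_square:
  fixes h :: "'a ^ 'd ^ 'd"
  assumes h: "mat_star h = h" "form_ge h 0"
  shows "lambda_max (h ** h) = (lambda_max h)\<^sup>2"
proof (rule antisym)
  have hh: "mat_star (h ** h) = h ** h" by (simp add: mat_star_mult h)
  have le: "rip \<xi> (h *v \<xi>) \<le> lambda_max h * rip \<xi> \<xi>" for \<xi>
    using lambda_max_le_iff[OF h(1), of "lambda_max h"] by blast
  obtain \<xi>0 :: "'a ^ 'd" where "0 < rip \<xi>0 \<xi>0" using vec_nonzero_exists by blast
  moreover have "0 \<le> rip \<xi>0 (h *v \<xi>0)" using h(2) by (simp add: form_ge_0)
  ultimately have M0: "0 \<le> lambda_max h" using le[of \<xi>0] by (smt (verit) mult_neg_pos)
  show "lambda_max (h ** h) \<le> (lambda_max h)\<^sup>2"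
    unfolding lambda_max_le_iff[OF hh]
  proof
    fix \<xi>
    have "tnorm (h *v \<xi>) \<le> lambda_max h * tnorm \<xi>"
      using h M0 le by (intro tnorm_le_if_form_le[where V=UNIV]) (auto simp: form_ge_0)
    then have "(tnorm (h *v \<xi>))\<^sup>2 \<le> (lambda_max h * tnorm \<xi>)\<^sup>2" by (intro power_mono) auto
    then show "rip \<xi> (h ** h *v \<xi>) \<le> (lambda_max h)\<^sup>2 * rip \<xi> \<xi>"
      by (simp add: square_form[OF h(1)] power_mult_distrib tnorm_square)
  qed
  have "complex_of_real ((lambda_max h)\<^sup>2) \<in> spectrum (h ** h)"
    by (rule square_in_spectrum_square[OF lambda_max_in_spectrum[OF h(1)]])
  then have "\<not> invertible ((lambda_max h)\<^sup>2 *\<^sub>R mat 1 - h ** h)"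
    using invertible_minus[of "h ** h - (lambda_max h)\<^sup>2 *\<^sub>R mat 1"]
    unfolding real_in_spectrum by simp
  then show "(lambda_max h)\<^sup>2 \<le> lambda_max (h ** h)"
    using invertible_outside_spectral_interval[OF hh] by (meson not_le)
qed

lemma gram_form: "rip \<xi> (x ** mat_star x *v \<xi>) = rip (mat_star x *v \<xi>) (mat_star x *v \<xi>)"
  unfolding matrix_vector_mul_assoc[symmetric] by (rule rip_adjoint)

lemma gram_selfadj: "mat_star (x ** mat_star x) = x ** mat_star x"
  by (simp add: mat_star_mult)

text \<open>Removes the square root: from here on only \<open>x ** mat_star x\<close>
  matters.\<close>

lemma s_max_square: "(s_max (x :: 'a ^ 'm ^ 'd))\<^sup>2 = lambda_max (x ** mat_star x)"
  and s_min_square: "(s_min x)\<^sup>2 = lambda_min (x ** mat_star x)"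
proof -
  have "form_ge (x ** mat_star x) 0" by (simp add: form_ge_0 gram_form)
  note * = mat_sqrt_props[OF gram_selfadj this]
  show "(s_max x)\<^sup>2 = lambda_max (x ** mat_star x)" "(s_min x)\<^sup>2 = lambda_min (x ** mat_star x)"
    using lambda_max_square[of "mat_sqrt (x ** mat_star x)"] lambda_min_square[of "mat_sqrt (x ** mat_star x)"] *
    by (simp_all add: s_max_def s_min_def)
qed

section \<open>Positivity on a cyclic subspace\<close>

text \<open>Right multiplication by an algebra element; it commutes with every matrix.\<close>

definition rmul :: "'a ^ 'd \<Rightarrow> 'a \<Rightarrow> 'a ^ 'd" where "rmul \<xi> b = (\<chi> k. \<xi> $ k * b)"

lemma matrix_vector_rmul: "X *v rmul \<xi> b = rmul (X *v \<xi>) b"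
  by (simp add: rmul_def matrix_vector_mult_def sum_distrib_right mult.assoc vec_eq_iff)

lemma tnorm_rmul_le: "tnorm (rmul \<xi> b) \<le> norm b * tnorm \<xi>"
proof (rule power2_le_imp_le)
  have "sqn (\<xi> $ k * b) \<le> (norm b)\<^sup>2 * sqn (\<xi> $ k)" for k
    using sqn_mult_le[of "star b" "star (\<xi> $ k)"] sqn_star[of "\<xi> $ k * b"]
    by (simp add: star_mult sqn_star)
  then show "(tnorm (rmul \<xi> b))\<^sup>2 \<le> (norm b * tnorm \<xi>)\<^sup>2"
    unfolding tnorm_square power_mult_distrib rip_self_sqn sum_distrib_left
    by (simp add: rmul_def sum_mono)
qed simp

text \<open>The norms a_j of T^j \<xi> are log-convex: a_{j+1}^2 \<le> a_j a_{j+2}. If a_1 > a_0,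
  the ratios never drop below a_1 / a_0 > 1 and the sequence is unbounded.\<close>

lemma tnorm_le_if_powers_bounded:
  assumes T: "mat_star T = T" and b: "\<And>j. tnorm (((*v) T ^^ j) \<xi>) \<le> C"
  shows "tnorm (T *v \<xi>) \<le> tnorm \<xi>"
proof (rule ccontr)
  define a where "a j = tnorm (((*v) T ^^ j) \<xi>)" for j
  assume "\<not> ?thesis"
  then have a01: "a 0 < a 1" by (simp add: a_def)
  have a0: "0 < a 0"
  proof -
    have "\<xi> \<noteq> 0" using a01 by (auto simp: a_def)
    then have "tnorm \<xi> \<noteq> 0" by (simp add: tnorm_eq_0)
    then have "0 < tnorm \<xi>" using tnorm_ge_0[of \<xi>] by linarith
    then show ?thesis by (simp add: a_def)
  qed
  define r where "r = a 1 / a 0"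
  have r: "1 < r" using a01 a0 by (simp add: r_def)
  have conv: "a (Suc j) * a (Suc j) \<le> a j * a (Suc (Suc j))" for j
  proof -
    define \<eta> where "\<eta> = ((*v) T ^^ j) \<xi>"
    have "a (Suc j) * a (Suc j) = rip \<eta> (T *v (T *v \<eta>))"
      by (simp add: a_def \<eta>_def rip_selfadj[OF T] flip: tnorm_square power2_eq_square)
    also have "\<dots> \<le> a j * a (Suc (Suc j))"
      using rip_le_tnorm[of \<eta> "T *v (T *v \<eta>)"] by (simp add: a_def \<eta>_def)
    finally show ?thesis .
  qed
  have "0 < a j \<and> r * a j \<le> a (Suc j)" for j
  proof (induction j)
    case 0
    then show ?case using a0 by (simp add: r_def)
  next
    case (Suc j)
    then have p: "0 < a (Suc j)" using r by (smt (verit) mult_pos_pos)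
    have "a j * (r * a (Suc j)) = (r * a j) * a (Suc j)" by simp
    also have "\<dots> \<le> a (Suc j) * a (Suc j)" using Suc p by (intro mult_right_mono) auto
    also have "\<dots> \<le> a j * a (Suc (Suc j))" by (rule conv)
    finally show ?case using Suc p by simp
  qed
  then have "r ^ j * a 0 \<le> a j" for j
  proof (induction j)
    case (Suc j)
    have "r ^ Suc j * a 0 = r * (r ^ j * a 0)" by simp
    also have "\<dots> \<le> r * a j" using Suc r by (intro mult_left_mono) auto
    also have "\<dots> \<le> a (Suc j)" using Suc by blast
    finally show ?case .
  qed simp
  then have "r ^ j * a 0 \<le> C" for j using b[of j] unfolding a_def by (meson order_trans)
  moreover obtain j where "C / a 0 < r ^ j" using real_arch_pow[OF r] by blast
  ultimately show False using a0 by (smt (verit) divide_less_eq)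
qed

text \<open>\<open>V\<close> need not be dense. It contains the unit columns, every column is a sum
  of right multiples of these, and T = 1 - c / K commutes with right multiplication. So the powers
  of T, contractive on \<open>V\<close>, are bounded on each column, which forces T to be
  contractive everywhere; then c \<ge> 0.\<close>

lemma form_ge_0_from_subspace:
  fixes c :: "'a ^ 'd ^ 'd"
  assumes c: "mat_star c = c"
    and unit: "\<And>k. axis k 1 \<in> V" and inv: "\<And>\<xi>. \<xi> \<in> V \<Longrightarrow> c *v \<xi> \<in> V"
    and lin: "\<And>\<xi> \<eta> r. \<xi> \<in> V \<Longrightarrow> \<eta> \<in> V \<Longrightarrow> \<xi> - r *\<^sub>R \<eta> \<in> V"
    and pos: "\<And>\<xi>. \<xi> \<in> V \<Longrightarrow> 0 \<le> rip \<xi> (c *v \<xi>)"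
  shows "form_ge c 0"
proof -
  obtain K where K: "0 < K" "bnd c K" using bnd_exists by blast
  define T where "T = mat 1 - (1 / K) *\<^sub>R c"
  have Ts: "mat_star T = T" by (simp add: T_def mat_star_diff mat_star_scaleR c)
  have Tpos: "0 \<le> rip \<xi> (T *v \<xi>)" for \<xi>
    unfolding T_def rip_one_minus_scale using bnd_form_le[OF K(2), of \<xi>] K(1) by (simp add: field_simps)
  have TV: "T *v \<xi> \<in> V" if "\<xi> \<in> V" for \<xi>
    using lin[OF that inv[OF that], of "1 / K"]
    by (simp add: T_def matrix_vector_mult_diff_rdistrib matrix_vector_scaleR_left)
  have contr: "tnorm (T *v \<xi>) \<le> tnorm \<xi>" if "\<xi> \<in> V" for \<xi>
    using tnorm_le_if_form_le[OF Ts Tpos TV, of 1 \<xi>] that pos K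
    by (simp add: T_def rip_one_minus_scale)
  have powV: "((*v) T ^^ j) \<xi> \<in> V \<and> tnorm (((*v) T ^^ j) \<xi>) \<le> tnorm \<xi>" if "\<xi> \<in> V" for j \<xi>
    by (induction j) (use that TV contr in \<open>auto intro: order_trans\<close>)
  have "rip \<xi> (T *v \<xi>) \<le> rip \<xi> \<xi>" for \<xi>
  proof -
    have dec: "\<xi> = (\<Sum>k\<in>UNIV. rmul (axis k 1) (\<xi> $ k))"
      by (simp add: vec_eq_iff rmul_def axis_def if_distrib[of "\<lambda>x. x * _"] cong: if_cong)
    have pow_rmul: "((*v) T ^^ j) (rmul \<eta> b) = rmul (((*v) T ^^ j) \<eta>) b" for j \<eta> b
      by (induction j) (auto simp: matrix_vector_rmul)
    have pow_add: "((*v) T ^^ j) (\<eta> + \<zeta>) = ((*v) T ^^ j) \<eta> + ((*v) T ^^ j) \<zeta>" for j \<eta> \<zeta>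
      by (induction j) (auto simp: matrix_vector_right_distrib)
    have pow_zero: "((*v) T ^^ j) 0 = 0" for j by (induction j) auto
    have pow_sum: "((*v) T ^^ j) (\<Sum>k\<in>S. f k) = (\<Sum>k\<in>S. ((*v) T ^^ j) (f k))"
      for j and S :: "'d set" and f
      by (induction S rule: infinite_finite_induct) (auto simp: pow_add pow_zero)
    have "tnorm (((*v) T ^^ j) \<xi>) \<le> (\<Sum>k\<in>UNIV. norm (\<xi> $ k) * tnorm (axis k 1 :: 'a ^ 'd))" for j
    proof -
      have "((*v) T ^^ j) \<xi> = (\<Sum>k\<in>UNIV. rmul (((*v) T ^^ j) (axis k 1)) (\<xi> $ k))"
        using arg_cong[OF dec, of "(*v) T ^^ j"] by (simp add: pow_sum pow_rmul)
      then have "tnorm (((*v) T ^^ j) \<xi>) \<le> (\<Sum>k\<in>UNIV. tnorm (rmul (((*v) T ^^ j) (axis k 1)) (\<xi> $ k)))"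
        using tnorm_sum_le[of "\<lambda>k. rmul (((*v) T ^^ j) (axis k 1)) (\<xi> $ k)" UNIV] by (simp only:)
      also have "\<dots> \<le> (\<Sum>k\<in>UNIV. norm (\<xi> $ k) * tnorm (axis k 1 :: 'a ^ 'd))"
        by (intro sum_mono order_trans[OF tnorm_rmul_le] mult_left_mono) (use powV unit in auto)
      finally show ?thesis .
    qed
    then have "tnorm (T *v \<xi>) \<le> tnorm \<xi>" by (rule tnorm_le_if_powers_bounded[OF Ts])
    then have "tnorm \<xi> * tnorm (T *v \<xi>) \<le> tnorm \<xi> * tnorm \<xi>" by (rule mult_left_mono) simp
    then show ?thesis
      using rip_le_tnorm[of \<xi> "T *v \<xi>"] by (simp flip: tnorm_square power2_eq_square)
  qed
  then have "0 \<le> rip \<xi> (c *v \<xi>) / K" for \<xi>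
    unfolding T_def rip_one_minus_scale by (simp add: field_simps)
  then show ?thesis using K by (simp add: form_ge_0 zero_le_divide_iff)
qed

end


section \<open>Chebyshev polynomials and the semicircle law\<close>

text \<open>Chebyshev polynomials of the second kind, rescaled to be orthogonal for the semicircle law.\<close>

fun cheb :: "nat \<Rightarrow> 'b::ring_1 \<Rightarrow> 'b" where
  "cheb 0 x = 1"
| "cheb (Suc 0) x = x"
| "cheb (Suc (Suc k)) x = x * cheb (Suc k) x - cheb k x"

lemma cheb_cos: "sin \<theta> * cheb k (2 * cos \<theta>) = sin (real (Suc k) * \<theta>)"
proof (induction k "2 * cos \<theta>" rule: cheb.induct)
  case 2
  then show ?case using sin_double[of \<theta>] by simp
next
  case (3 k)
  have "sin \<theta> * cheb (Suc (Suc k)) (2 * cos \<theta>) =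
      2 * cos \<theta> * sin (real (Suc (Suc k)) * \<theta>) - sin (real (Suc k) * \<theta>)"
    using 3 by (simp add: algebra_simps)
  also have "\<dots> = sin (real (Suc (Suc k)) * \<theta> + \<theta>)"
    using sin_diff[of "real (Suc (Suc k)) * \<theta>" \<theta>] sin_add[of "real (Suc (Suc k)) * \<theta>" \<theta>]
    by (simp add: algebra_simps)
  finally show ?case by (simp add: algebra_simps)
qed simp

lemma continuous_on_cheb [continuous_intros]:
  "continuous_on S f \<Longrightarrow> continuous_on S (\<lambda>t. cheb k (f t :: real))"
proof (induction k "0::real" rule: cheb.induct)
  case (3 k)
  then show ?case by (simp, intro continuous_intros) auto
qed auto

lemma integral_cheb_semicircle:
  assumes "0 < k"
  shows "integral {-2..2} (\<lambda>t. sqrt (4 - t\<^sup>2) * cheb k t) = 0"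
proof -
  \<comment> \<open>With t = 2 cos \<theta>, an antiderivative of -4 sin \<theta> sin ((k + 1)
    \<theta>), the integrand times dt / d\<theta>; k > 0 keeps the denominators nonzero.\<close>
  define H :: "real \<Rightarrow> real" where
    "H \<theta> = - 2 * (sin (real k * \<theta>) / real k - sin (real (k + 2) * \<theta>) / real (k + 2))" for \<theta>
  have "((\<lambda>t. sqrt (4 - t\<^sup>2) * cheb k t) has_integral (H (arccos (2/2)) - H (arccos (-2/2)))) {-2..2}"
  \<comment> \<open>\<open>arccos\<close> is not differentiable at the end points.\<close>
  proof (rule fundamental_theorem_of_calculus_interior)
    show "continuous_on {-2..2} (\<lambda>t. H (arccos (t / 2)))"
      unfolding H_def by (intro continuous_intros) (use assms in auto)
    fix t :: real assume t: "t \<in> {-2<..<2}"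
    define \<theta> where "\<theta> = arccos (t / 2)"
    have c: "t = 2 * cos \<theta>" using t by (simp add: \<theta>_def)
    have s: "sqrt (4 - t\<^sup>2) = 2 * sin \<theta>" "sqrt (1 - (t / 2)\<^sup>2) = sin \<theta>"
    proof -
      show s: "sqrt (1 - (t / 2)\<^sup>2) = sin \<theta>" using t by (simp add: \<theta>_def sin_arccos)
      have "4 - t\<^sup>2 = 2\<^sup>2 * (1 - (t / 2)\<^sup>2)" by (simp add: power_divide)
      then have "sqrt (4 - t\<^sup>2) = sqrt (2\<^sup>2) * sqrt (1 - (t / 2)\<^sup>2)" by (simp only: real_sqrt_mult)
      then show "sqrt (4 - t\<^sup>2) = 2 * sin \<theta>" by (simp only: s real_sqrt_abs)
    qed
    have sin0: "sin \<theta> \<noteq> 0"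
    proof -
      have "\<theta> \<in> {0<..<pi}" using arccos_lt_bounded[of "t / 2"] t by (auto simp: \<theta>_def)
      then show ?thesis using sin_gt_zero[of \<theta>] by auto
    qed
    have arc: "((\<lambda>t. arccos (t / 2)) has_real_derivative (inverse (- sin \<theta>) * (1 / 2))) (at t)"
    proof (rule DERIV_chain2[where f=arccos])
      show "(arccos has_real_derivative inverse (- sin \<theta>)) (at (t / 2))"
        using DERIV_arccos[of "t / 2"] t by (simp add: s)
    qed (auto intro!: derivative_eq_intros)
    have "(H has_real_derivative - 2 * (cos (real k * \<theta>) - cos (real (k + 2) * \<theta>))) (at \<theta>)"
      unfolding H_def using assms by (auto intro!: derivative_eq_intros)
    then have der: "((\<lambda>t. H (arccos (t / 2))) has_real_derivative
        - 2 * (cos (real k * \<theta>) - cos (real (k + 2) * \<theta>)) * (inverse (- sin \<theta>) * (1 / 2))) (at t)"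
      by (intro DERIV_chain2[where f=H, OF _ arc]) (simp add: \<theta>_def)
    have "cos (real k * \<theta>) - cos (real (k + 2) * \<theta>) = 2 * sin (real (Suc k) * \<theta>) * sin \<theta>"
      using cos_diff[of "real (Suc k) * \<theta>" \<theta>] cos_add[of "real (Suc k) * \<theta>" \<theta>]
      by (simp add: algebra_simps)
    moreover have "2 * sin \<theta> * cheb k t = 2 * sin (real (Suc k) * \<theta>)"
      unfolding c using cheb_cos[of \<theta> k] by simp
    ultimately have "- 2 * (cos (real k * \<theta>) - cos (real (k + 2) * \<theta>)) * (inverse (- sin \<theta>) * (1 / 2))
        = sqrt (4 - t\<^sup>2) * cheb k t"
      using sin0 by (simp add: s)
    with der show "((\<lambda>t. H (arccos (t / 2))) has_vector_derivative sqrt (4 - t\<^sup>2) * cheb k t) (at t)"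
      by (simp only: has_real_derivative_iff_has_vector_derivative)
  qed simp
  moreover have "H (arccos (2/2)) = 0" "H (arccos (-2/2)) = 0"
    using sin_npi[of k] sin_npi[of "k + 2"] by (simp_all add: H_def)
  ultimately show ?thesis by (simp add: integral_unique)
qed

lemma semicircle_integral:
  fixes f :: "real \<Rightarrow> real"
  assumes f: "continuous_on UNIV f"
  shows "integrable semicircle_law f"
    and "(\<integral>t. f t \<partial>semicircle_law) = 1 / (2 * pi) * integral {-2..2} (\<lambda>t. sqrt (4 - t\<^sup>2) * f t)"
proof -
  define g :: "real \<Rightarrow> real" where "g t = indicator {-2..2} t * (1 / (2 * pi) * sqrt (4 - t\<^sup>2))" for t
  have law: "semicircle_law = density lborel (\<lambda>t. ennreal (g t))"
    by (simp add: semicircle_law_def g_def)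
  have fm: "f \<in> borel_measurable lborel"
    using borel_measurable_continuous_onI[OF f] by simp
  have gm: "g \<in> borel_measurable lborel" unfolding g_def by measurable
  have g0: "AE t in lborel. 0 \<le> g t"
  proof (rule AE_I2)
    fix t show "0 \<le> g t"
    proof (cases "t \<in> {-2..2}")
      case True
      then have "t\<^sup>2 \<le> 2\<^sup>2" by (intro power2_le_iff_abs_le[THEN iffD2]) auto
      then show ?thesis by (simp add: g_def)
    qed (simp add: g_def)
  qed
  define h where "h t = 1 / (2 * pi) * (sqrt (4 - t\<^sup>2) * f t)" for t
  have "continuous_on {-2..2} h"
    unfolding h_def by (intro continuous_intros continuous_on_subset[OF f]) auto
  then have hi: "set_integrable lborel {-2..2} h" by (rule borel_integrable_atLeastAtMost')
  have gf: "g t *\<^sub>R f t = indicator {-2..2} t *\<^sub>R h t" for t by (simp add: g_def h_def)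
  show "integrable semicircle_law f"
    unfolding law integrable_density[OF fm gm g0] gf using hi by (simp add: set_integrable_def)
  have "(\<integral>t. f t \<partial>semicircle_law) = integral {-2..2} h"
    unfolding law integral_density[OF fm gm g0] gf
    using set_borel_integral_eq_integral(2)[OF hi] by (simp add: set_lebesgue_integral_def)
  then show "(\<integral>t. f t \<partial>semicircle_law) = 1 / (2 * pi) * integral {-2..2} (\<lambda>t. sqrt (4 - t\<^sup>2) * f t)"
    unfolding h_def by simp
qed

section \<open>The Fock space of a free semicircular family\<close>

locale free_family = tracial \<tau> for \<tau> :: "'a::cstar_algebra \<Rightarrow> complex" +
  fixes s :: "nat \<Rightarrow> 'a" and n :: nat
  assumes family: "free_semicircular_family \<tau> {1..n} s"
begin

lemma s_star: "i \<in> {1..n} \<Longrightarrow> star (s i) = s i"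
  using family by (auto simp: free_semicircular_family_def has_distribution_def)

lemma tau_cheb:
  assumes i: "i \<in> {1..n}" and k: "0 < k"
  shows "\<tau> (cheb k (s i)) = 0"
proof -
  have mom: "\<tau> (s i ^ k) = complex_of_real (\<integral>t. t ^ k \<partial>semicircle_law)" for k :: nat
    using family i by (auto simp: free_semicircular_family_def has_distribution_def)
  \<comment> \<open>Only moments are known, and the recursion of \<open>cheb\<close> produces a
    power times a Chebyshev polynomial; the factor \<open>s i ^ m\<close> closes the
    induction.\<close>
  have "\<tau> (s i ^ m * cheb k (s i)) = complex_of_real (\<integral>t. t ^ m * cheb k t \<partial>semicircle_law)" for m k
  proof (induction k "0::real" arbitrary: m rule: cheb.induct)
    case 1
    show ?case using mom[of m] by simp
  next
    case 2
    show ?case using mom[of "Suc m"] by (simp flip: power_Suc2)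
  next
    case (3 k)
    have i1: "integrable semicircle_law (\<lambda>t::real. t ^ Suc m * cheb (Suc k) t)"
      and i2: "integrable semicircle_law (\<lambda>t::real. t ^ m * cheb k t)"
      by (intro semicircle_integral continuous_intros)+
    have "s i ^ m * cheb (Suc (Suc k)) (s i) = s i ^ Suc m * cheb (Suc k) (s i) - s i ^ m * cheb k (s i)"
      by (simp add: right_diff_distrib power_Suc2 mult.assoc del: power_Suc)
    then have "\<tau> (s i ^ m * cheb (Suc (Suc k)) (s i)) = complex_of_real
        ((\<integral>t. t ^ Suc m * cheb (Suc k) t \<partial>semicircle_law) - (\<integral>t. t ^ m * cheb k t \<partial>semicircle_law))"
      using 3 by (simp add: tau_diff del: power_Suc)
    also have "(\<integral>t. t ^ Suc m * cheb (Suc k) t \<partial>semicircle_law) - (\<integral>t. t ^ m * cheb k t \<partial>semicircle_law)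
        = (\<integral>t. t ^ m * cheb (Suc (Suc k)) t \<partial>semicircle_law)"
      unfolding Bochner_Integration.integral_diff[OF i1 i2, symmetric]
      by (intro Bochner_Integration.integral_cong) (auto simp: algebra_simps)
    finally show ?case .
  qed
  from this[of 0 k] show ?thesis
    using semicircle_integral(2)[of "cheb k"] integral_cheb_semicircle[OF k] continuous_on_cheb[of UNIV id k]
    by simp
qed

lemma cheb_in_subalgebra: "cheb k x \<in> star_subalgebra {x}"
proof (induction k x rule: cheb.induct)
  case (3 k x)
  have "x * cheb (Suc k) x + (- 1) *\<^sub>C cheb k x \<in> star_subalgebra {x}"
    by (rule star_subalgebra.add[OF star_subalgebra.mult[OF star_subalgebra.gen 3(1)]
          star_subalgebra.scale[OF 3(2)]]) simp
  then show ?case by (simp add: scaleC_minus_left)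
qed (auto intro: star_subalgebra.one star_subalgebra.gen)

text \<open>The vectors of the Fock basis: under \<open>a \<mapsto> a \<Omega>\<close> the word \<open>w\<close> corresponds to the tensor
  \<open>e\<^sub>w\<^sub>1 \<otimes> e\<^sub>w\<^sub>2 \<otimes> \<dots>\<close>, and the recursion says that \<open>s i\<close> is creation plus annihilation.\<close>

fun wvec :: "nat list \<Rightarrow> 'a" where
  "wvec [] = 1"
| "wvec (i # w) = s i * wvec w - (case w of [] \<Rightarrow> 0 | j # w' \<Rightarrow> if j = i then wvec w' else 0)"

text \<open>Inside a block of equal letters the recursion of \<open>wvec\<close> is that of
  \<open>cheb\<close>; the condition on \<open>w\<close> excludes a cancellation across the end of
  the block.\<close>

lemma wvec_block:
  assumes "w = [] \<or> hd w \<noteq> i"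
  shows "wvec (replicate k i @ w) = cheb k (s i) * wvec w"
proof (induction k "0::real" rule: cheb.induct)
  case 2
  show ?case using assms by (cases w) auto
next
  case (3 k)
  then show ?case by (simp add: left_diff_distrib mult.assoc)
qed simp

text \<open>Maximal blocks of equal letters give an alternating product of Chebyshev polynomials,
  centered by \<open>tau_cheb\<close>: the shape that freeness asks for. The first index is recorded
  so that another block can be prepended.\<close>

lemma wvec_factor:
  assumes "w \<noteq> []" "set w \<subseteq> {1..n}"
  shows "\<exists>L. L \<noteq> [] \<and> distinct_adj (map fst L) \<and> fst (hd L) = hd w \<and>
    (\<forall>(i, b) \<in> set L. i \<in> {1..n} \<and> b \<in> star_subalgebra {s i} \<and> \<tau> b = 0) \<and>
    prod_list (map snd L) = wvec w"
  using assms
proof (induction "length w" arbitrary: w rule: less_induct)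
  case less
  define i k v where "i = hd w" and "k = length (takeWhile (\<lambda>j. j = i) w)"
    and "v = dropWhile (\<lambda>j. j = i) w"
  have "takeWhile (\<lambda>j. j = i) w = replicate k i"
    unfolding k_def by (rule replicate_eqI) (auto dest: set_takeWhileD)
  then have w: "w = replicate k i @ v" unfolding v_def by (metis takeWhile_dropWhile_id)
  have k: "0 < k" using less.prems(1) by (cases w) (auto simp: k_def i_def)
  have v: "v = [] \<or> hd v \<noteq> i" unfolding v_def using hd_dropWhile by blast
  have i: "i \<in> {1..n}" using less.prems(2) hd_in_set[OF less.prems(1)] unfolding i_def by blast
  have wv: "wvec w = cheb k (s i) * wvec v" using wvec_block[OF v] w by simp
  note cheb = cheb_in_subalgebra[of k "s i"] tau_cheb[OF i k]
  show ?case
  proof (cases "v = []")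
    case True
    then show ?thesis
      using i cheb wv by (intro exI[of _ "[(i, cheb k (s i))]"]) (auto simp: i_def)
  next
    case False
    have "length w = k + length v" using w by (metis length_append length_replicate)
    then have "length v < length w" using k by simp
    moreover have "set v \<subseteq> {1..n}" using less.prems(2) w by auto
    ultimately obtain L where L: "L \<noteq> []" "distinct_adj (map fst L)" "fst (hd L) = hd v"
      "\<forall>(i, b) \<in> set L. i \<in> {1..n} \<and> b \<in> star_subalgebra {s i} \<and> \<tau> b = 0"
      "prod_list (map snd L) = wvec v"
      using less.hyps False by blast
    have "distinct_adj (map fst ((i, cheb k (s i)) # L))"
      using L(1-3) v False by (simp add: distinct_adj_Cons hd_map)
    then show ?thesis
      using i cheb wv L(4,5)
      by (intro exI[of _ "(i, cheb k (s i)) # L"]) (auto simp: i_def)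
  qed
qed

lemma tau_wvec:
  assumes "w \<noteq> []" "set w \<subseteq> {1..n}"
  shows "\<tau> (wvec w) = 0"
proof -
  have "freely_independent \<tau> {1..n} s" using family by (simp add: free_semicircular_family_def)
  moreover obtain L where "L \<noteq> []" "distinct_adj (map fst L)"
    "\<forall>(i, b) \<in> set L. i \<in> {1..n} \<and> b \<in> star_subalgebra {s i} \<and> \<tau> b = 0"
    and L: "prod_list (map snd L) = wvec w"
    using wvec_factor[OF assms] by blast
  ultimately have "\<tau> (prod_list (map snd L)) = 0" unfolding freely_independent_def by blast
  then show ?thesis by (simp only: L)
qed

text \<open>Moving \<open>s i\<close> from the first factor to the second gives <iu, w> = <u, iw> +
  [w = iw'] <u, w'> - [u = iu'] <u', w>. By induction the first and last terms cancel, and the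
  middle one is the claim.\<close>

lemma wvec_orthonormal:
  assumes "set v \<subseteq> {1..n}" "set w \<subseteq> {1..n}"
  shows "\<tau> (star (wvec v) * wvec w) = (if v = w then 1 else 0)"
  using assms
proof (induction "length v" arbitrary: v w rule: less_induct)
  case less
  show ?case
  proof (cases v)
    case Nil
    then show ?thesis using tau_wvec[of w] less.prems by (auto simp: tau_one)
  next
    case (Cons i u)
    define A where "A x y = \<tau> (star (wvec x) * wvec y)" for x y
    have IH: "A x y = (if x = y then 1 else 0)"
      if "length x < length v" "set x \<subseteq> {1..n}" "set y \<subseteq> {1..n}" for x y
      using less.hyps that by (simp add: A_def)
    have i: "i \<in> {1..n}" and u: "set u \<subseteq> {1..n}" "length u < length v" using less.prems Cons by auto
    have w: "set w \<subseteq> {1..n}" using less.prems by simp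
    have step: "s i * wvec w = wvec (i # w) + (case w of [] \<Rightarrow> 0 | j # w' \<Rightarrow> if j = i then wvec w' else 0)"
      by simp
    have "\<tau> (star (wvec v) * wvec w) =
        \<tau> (star (wvec u) * (s i * wvec w)) - (case u of [] \<Rightarrow> 0 | j # u' \<Rightarrow> if j = i then A u' w else 0)"
      by (auto simp: Cons star_diff star_mult s_star[OF i] left_diff_distrib mult.assoc tau_diff A_def
          split: list.splits)
    also have "\<tau> (star (wvec u) * (s i * wvec w)) =
        A u (i # w) + (case w of [] \<Rightarrow> 0 | j # w' \<Rightarrow> if j = i then A u w' else 0)"
      unfolding step distrib_left tau_add A_def by (auto split: list.splits)
    also have "A u (i # w) = (case u of [] \<Rightarrow> 0 | j # u' \<Rightarrow> if j = i then A u' w else 0)"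
      using IH[of u "i # w"] IH[of "tl u" w] u w i by (auto split: list.splits)
    also have "(case w of [] \<Rightarrow> 0 | j # w' \<Rightarrow> if j = i then A u w' else 0) = (if v = w then 1 else 0)"
      using IH[of u "tl w"] u w by (auto simp: Cons split: list.splits)
    finally show ?thesis by simp
  qed
qed

section \<open>Coefficients in the Fock basis: Bessel and Parseval\<close>

definition words :: "nat list set" where "words = lists {1..n}"

text \<open>Set to 0 on lists with other letters, so that all families are indexed by the full list
  type.\<close>

definition cf :: "nat list \<Rightarrow> 'a \<Rightarrow> complex" where
  "cf w x = (if w \<in> words then \<tau> (star (wvec w) * x) else 0)"

lemma in_words: "w \<in> words \<longleftrightarrow> set w \<subseteq> {1..n}"
  by (auto simp: words_def lists_eq_set)

lemma cf_add: "cf w (x + y) = cf w x + cf w y"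
  by (simp add: cf_def distrib_left tau_add)

lemma cf_scaleC: "cf w (c *\<^sub>C x) = c * cf w x"
  by (simp add: cf_def mult_scaleC_right tau_scaleC)

lemma cf_zero [simp]: "cf w 0 = 0"
  by (simp add: cf_def)

lemma cf_sum: "cf w (sum f S) = (\<Sum>k\<in>S. cf w (f k))"
  by (induction S rule: infinite_finite_induct) (auto simp: cf_add)

lemma cf_Nil: "cf [] x = \<tau> x"
  by (simp add: cf_def words_def)

lemma cf_one: "cf w 1 = (if w = [] then 1 else 0)"
  using wvec_orthonormal[of w "[]"] by (auto simp: cf_def in_words tau_one)

text \<open>Annihilation plus creation, in coefficients. Outside \<open>words\<close> both sides are
  0.\<close>

lemma cf_s:
  assumes i: "i \<in> {1..n}"
  shows "cf w (s i * x) = cf (i # w) x + (case w of [] \<Rightarrow> 0 | j # w' \<Rightarrow> if j = i then cf w' x else 0)"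
proof -
  define C where "C = (case w of [] \<Rightarrow> 0 | j # w' \<Rightarrow> if j = i then wvec w' else 0)"
  have "s i * wvec w = wvec (i # w) + C" by (simp add: C_def)
  moreover have "star (wvec w) * (s i * x) = star (s i * wvec w) * x"
    by (simp add: star_mult s_star[OF i] mult.assoc)
  ultimately have "star (wvec w) * (s i * x) = star (wvec (i # w)) * x + star C * x"
    by (simp only: star_add distrib_right)
  then have "\<tau> (star (wvec w) * (s i * x)) = \<tau> (star (wvec (i # w)) * x) + \<tau> (star C * x)"
    by (simp only: tau_add)
  moreover have "\<tau> (star C * x) = (case w of [] \<Rightarrow> 0 | j # w' \<Rightarrow> if j = i then \<tau> (star (wvec w') * x) else 0)"
    by (auto simp: C_def split: list.splits)
  ultimately show ?thesis
    using i by (auto simp: cf_def in_words simp del: wvec.simps split: list.splits)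
qed

lemma cf_bessel:
  assumes "finite S"
  shows "(\<Sum>w\<in>S. (cmod (cf w x))\<^sup>2) \<le> sqn x"
proof -
  define S' where "S' = S \<inter> words"
  have fin: "finite S'" using assms by (simp add: S'_def)
  define p where "p = (\<Sum>w\<in>S'. cf w x *\<^sub>C wvec w)"
  define N where "N = (\<Sum>w\<in>S'. (cmod (cf w x))\<^sup>2)"
  have px: "\<tau> (star p * x) = complex_of_real N"
  proof -
    have "\<tau> (star p * x) = (\<Sum>w\<in>S'. cnj (cf w x) * cf w x)"
      by (simp add: p_def star_sum star_scaleC sum_distrib_right mult_scaleC_left tau_sum tau_scaleC)
        (simp add: cf_def S'_def)
    then show ?thesis by (simp add: N_def complex_norm_square mult.commute del: of_real_power)
  qed
  have cfp: "cf w p = cf w x" if w: "w \<in> S'" for w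
  proof -
    have "cf w p = (\<Sum>v\<in>S'. cf v x * cf w (wvec v))" by (simp add: p_def cf_sum cf_scaleC)
    also have "\<dots> = (\<Sum>v\<in>S'. if w = v then cf v x else 0)"
      using w by (intro sum.cong refl) (simp add: cf_def wvec_orthonormal S'_def in_words)
    finally show ?thesis using w fin by simp
  qed
  have "\<tau> (star p * p) = (\<Sum>w\<in>S'. cnj (cf w x) * cf w p)"
    by (subst (1) p_def) (simp add: star_sum star_scaleC sum_distrib_right mult_scaleC_left tau_sum tau_scaleC cf_def S'_def)
  then have pp: "\<tau> (star p * p) = complex_of_real N"
    using cfp by (simp add: N_def complex_norm_square mult.commute del: of_real_power)
  have xp: "\<tau> (star x * p) = complex_of_real N"
    using tau_star[of "star p * x"] px by (simp add: star_mult star_star)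
  have "0 \<le> sqn (x - p)" by simp
  also have "sqn (x - p) = sqn x - N"
    by (simp add: sqn_def star_diff left_diff_distrib right_diff_distrib tau_diff px xp pp)
  finally have "N \<le> sqn x" by simp
  moreover have "(\<Sum>w\<in>S. (cmod (cf w x))\<^sup>2) = N"
    unfolding N_def S'_def by (rule sum.mono_neutral_right) (use assms in \<open>auto simp: cf_def\<close>)
  ultimately show ?thesis by simp
qed

text \<open>The polynomials in the semicirculars, given as the span of the Fock basis so that
  Parseval is an induction over linear combinations; \<open>polys_s\<close> recovers closure under
  multiplication by \<open>s i\<close>.\<close>

inductive_set polys :: "'a set" where
  wvec: "w \<in> words \<Longrightarrow> wvec w \<in> polys"
| add: "x \<in> polys \<Longrightarrow> y \<in> polys \<Longrightarrow> x + y \<in> polys"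
| scale: "x \<in> polys \<Longrightarrow> c *\<^sub>C x \<in> polys"

lemma polys_one: "1 \<in> polys"
  using polys.wvec[of "[]"] by (simp add: words_def)

lemma polys_zero: "0 \<in> polys"
  using polys.scale[OF polys_one, of 0] by simp

lemma polys_sum: "(\<And>k. k \<in> S \<Longrightarrow> f k \<in> polys) \<Longrightarrow> sum f S \<in> polys"
  by (induction S rule: infinite_finite_induct) (auto intro: polys.add polys_zero)

lemma polys_s:
  assumes "i \<in> {1..n}" "x \<in> polys"
  shows "s i * x \<in> polys"
  using assms(2)
proof induction
  case (wvec w)
  have "s i * wvec w = wvec (i # w) + (case w of [] \<Rightarrow> 0 | j # w' \<Rightarrow> if j = i then wvec w' else 0)"
    by simp
  moreover have "wvec (i # w) \<in> polys" using wvec assms(1) by (intro polys.wvec) (auto simp: in_words)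
  moreover have "(case w of [] \<Rightarrow> 0 | j # w' \<Rightarrow> if j = i then wvec w' else 0) \<in> polys"
    using wvec by (auto simp: in_words polys_zero intro!: polys.wvec split: list.splits)
  ultimately show ?case by (simp only: polys.add)
qed (auto simp: distrib_left mult_scaleC_right intro: polys.intros)

lemma cf_parseval:
  assumes "x \<in> polys"
  shows "((\<lambda>w. cnj (cf w y) * cf w x) has_sum \<tau> (star y * x)) UNIV"
  using assms
proof induction
  case (wvec v)
  have "((\<lambda>w. cnj (cf w y) * cf w (wvec v)) has_sum (cnj (cf v y) * cf v (wvec v))) {v}"
    using has_sum_finite[of "{v}" "\<lambda>w. cnj (cf w y) * cf w (wvec v)"] by simp
  moreover have "cf w (wvec v) = 0" if "w \<noteq> v" for w
    using wvec that wvec_orthonormal[of w v] by (auto simp: cf_def in_words)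
  ultimately have "((\<lambda>w. cnj (cf w y) * cf w (wvec v)) has_sum (cnj (cf v y) * cf v (wvec v))) UNIV"
    by (subst has_sum_cong_neutral[where T="{v}"]) auto
  moreover have "cf v (wvec v) = 1" using wvec wvec_orthonormal[of v v] by (simp add: cf_def in_words)
  moreover have "cnj (cf v y) = \<tau> (star y * wvec v)"
    using wvec tau_star[of "star (wvec v) * y"] by (simp add: cf_def star_mult star_star)
  ultimately show ?case by simp
next
  case (add x z)
  have "((\<lambda>w. cnj (cf w y) * cf w x + cnj (cf w y) * cf w z) has_sum (\<tau> (star y * x) + \<tau> (star y * z))) UNIV"
    by (rule has_sum_add[OF add.IH])
  then show ?case by (simp add: cf_add distrib_left tau_add)
next
  case (scale x c)
  have "((\<lambda>w. c * (cnj (cf w y) * cf w x)) has_sum c * \<tau> (star y * x)) UNIV"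
    by (rule has_sum_cmult_right[OF scale.IH])
  then show ?case by (simp add: cf_scaleC mult_scaleC_right tau_scaleC mult.left_commute)
qed

end


section \<open>Square-summable vectors indexed by words\<close>

text \<open>Expand the z-form of p - z^{-1} q, which is nonnegative.\<close>

lemma (in tracial) form_young:
  assumes z: "mat_star z = z" and pos: "\<And>p. 0 \<le> rip p (z *v p)" and inv: "z ** zi = mat 1"
  shows "2 * rip p q \<le> rip p (z *v p) + rip q (zi *v q)"
proof -
  have zz: "z *v (zi *v q) = q" by (simp add: matrix_vector_mul_assoc inv)
  have "rip (zi *v q) (z *v p) = rip q p" by (simp add: rip_selfadj[OF z] zz)
  then have "rip (p - zi *v q) (z *v (p - zi *v q)) = rip p (z *v p) - 2 * rip p q + rip q (zi *v q)"
    by (simp add: matrix_vector_mult_diff_distrib rip_diff_left rip_diff_right zz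
        rip_commute[of q p] rip_commute[of "zi *v q" q])
  then show ?thesis using pos[of "p - zi *v q"] by linarith
qed

lemma (in tracial) form_inverse_ge_0:
  assumes z: "mat_star z = z" and pos: "\<And>p. 0 \<le> rip p (z *v p)" and inv: "z ** zi = mat 1"
  shows "0 \<le> rip q (zi *v q)"
proof -
  have "rip (zi *v q) (z *v (zi *v q)) = rip q (zi *v q)"
    by (simp add: matrix_vector_mul_assoc inv rip_commute)
  then show ?thesis using pos[of "zi *v q"] by simp
qed

lemma (in tracial) gram_bound: "\<exists>K\<ge>0. \<forall>\<xi>. rip (T *v \<xi>) (T *v \<xi>) \<le> K * rip \<xi> \<xi>"
proof -
  obtain K where K: "0 < K" "bnd (mat_star T ** T) K" using bnd_exists by blast
  have "rip (T *v \<xi>) (T *v \<xi>) = rip \<xi> ((mat_star T ** T) *v \<xi>)" for \<xi>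
    unfolding matrix_vector_mul_assoc[symmetric] rip_adjoint[of \<xi>] by simp
  then have "rip (T *v \<xi>) (T *v \<xi>) \<le> K * rip \<xi> \<xi>" for \<xi>
    using bnd_form_le[OF K(2), of \<xi>] by simp
  then show ?thesis using K(1) by (intro exI[of _ K]) auto
qed

text \<open>Scalar matrices are the case of the algebra of complex numbers, so the extreme
  eigenvalues on the right of the formulas obey the same lemmas as those on the left.\<close>

interpretation cx: tracial "\<lambda>x::complex. x"
proof
  show "faithful_tracial_state (\<lambda>x::complex. x)"
    unfolding faithful_tracial_state_def
    by (auto simp: scaleC_complex_def star_complex_def mult.commute complex_is_Real_iff)
qed

text \<open>The instance reads \<open>0 = 0\<close> and would make the simplifier loop.\<close>

declare cx.tau_zero [simp del]

definition l2 :: "('i \<Rightarrow> complex ^ 'd) \<Rightarrow> bool" where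
  "l2 f \<longleftrightarrow> (\<lambda>w. cx.rip (f w) (f w)) summable_on UNIV"

text \<open>\<open>infsum\<close> is 0 for a non-summable family, hence the \<open>l2\<close>
  hypotheses of the additive rules.\<close>

definition ip :: "('i \<Rightarrow> complex ^ 'd) \<Rightarrow> ('i \<Rightarrow> complex ^ 'd) \<Rightarrow> real" where
  "ip f g = infsum (\<lambda>w. cx.rip (f w) (g w)) UNIV"

lemma rip_le_half: "\<bar>cx.rip u v\<bar> \<le> cx.rip u u + cx.rip v v"
proof -
  have "0 \<le> cx.rip (u + v) (u + v)" "0 \<le> cx.rip (u - v) (u - v)" by auto
  then have "\<bar>2 * cx.rip u v\<bar> \<le> cx.rip u u + cx.rip v v"
    by (simp add: cx.rip_add_left cx.rip_add_right cx.rip_diff_left cx.rip_diff_right cx.rip_commute[of v u])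
  moreover have "\<bar>cx.rip u v\<bar> \<le> \<bar>2 * cx.rip u v\<bar>" by simp
  ultimately show ?thesis by linarith
qed

lemma summable_ip:
  assumes "l2 f" "l2 g"
  shows "(\<lambda>w. cx.rip (f w) (g w)) summable_on UNIV"
proof -
  have "(\<lambda>w. cx.rip (f w) (f w) + cx.rip (g w) (g w)) summable_on UNIV"
    using assms unfolding l2_def by (rule summable_on_add)
  then have "(\<lambda>w. norm (cx.rip (f w) (g w))) summable_on UNIV"
    by (rule Infinite_Sum.abs_summable_on_comparison_test') (simp add: rip_le_half)
  then show ?thesis by (rule abs_summable_summable)
qed

lemma l2_le:
  assumes "l2 f" "\<And>w. cx.rip (g w) (g w) \<le> K * cx.rip (f w) (f w)"
  shows "l2 g"
  unfolding l2_def
proof (rule summable_on_comparison_test)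
  show "(\<lambda>w. K * cx.rip (f w) (f w)) summable_on UNIV"
    using assms(1) unfolding l2_def by (rule summable_on_cmult_right)
qed (use assms(2) in auto)

lemma l2_zero: "l2 (\<lambda>w. 0)"
  by (simp add: l2_def)

lemma l2_add:
  assumes "l2 f" "l2 g"
  shows "l2 (\<lambda>w. f w + g w)"
proof -
  have "(\<lambda>w. cx.rip (f w) (f w) + cx.rip (g w) (g w) + (cx.rip (f w) (g w) + cx.rip (f w) (g w))) summable_on UNIV"
    using summable_ip[OF assms] assms unfolding l2_def by (intro summable_on_add)
  moreover have "cx.rip (f w + g w) (f w + g w) =
      cx.rip (f w) (f w) + cx.rip (g w) (g w) + (cx.rip (f w) (g w) + cx.rip (f w) (g w))" for w
    by (simp add: cx.rip_add_left cx.rip_add_right cx.rip_commute[of "g w" "f w"])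
  ultimately show ?thesis by (simp add: l2_def)
qed

lemma l2_sum: "(\<And>k. k \<in> S \<Longrightarrow> l2 (f k)) \<Longrightarrow> l2 (\<lambda>w. \<Sum>k\<in>S. f k w)"
  by (induction S rule: infinite_finite_induct) (auto simp: l2_zero intro: l2_add)

lemma l2_scaleR: "l2 f \<Longrightarrow> l2 (\<lambda>w. r *\<^sub>R f w)"
  by (rule l2_le[where K="r\<^sup>2"]) (auto simp: cx.rip_scaleR_left cx.rip_scaleR_right power2_eq_square)

lemma l2_matrix:
  assumes "l2 f"
  shows "l2 (\<lambda>w. T *v f w)"
  using cx.gram_bound[of T] l2_le[OF assms] by metis

lemma ip_commute: "ip f g = ip g f"
  by (simp add: ip_def cx.rip_commute)

lemma ip_add_right: "l2 f \<Longrightarrow> l2 g \<Longrightarrow> l2 h \<Longrightarrow> ip f (\<lambda>w. g w + h w) = ip f g + ip f h"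
  by (simp add: ip_def cx.rip_add_right infsum_add summable_ip)

lemma ip_scaleR_right: "ip f (\<lambda>w. r *\<^sub>R g w) = r * ip f g"
  by (simp add: ip_def cx.rip_scaleR_right infsum_cmult_right')

lemma ip_minus_right: "ip f (\<lambda>w. - g w) = - ip f g"
  by (simp add: ip_def cx.rip_minus_right infsum_uminus)

lemma ip_diff_right:
  assumes "l2 f" "l2 g" "l2 h"
  shows "ip f (\<lambda>w. g w - h w) = ip f g - ip f h"
proof -
  have "l2 (\<lambda>w. - h w)" using l2_scaleR[OF assms(3), of "-1"] by simp
  from ip_add_right[OF assms(1,2) this] show ?thesis by (simp add: ip_minus_right)
qed

lemma ip_sum_right:
  assumes "l2 f" "\<And>k. k \<in> S \<Longrightarrow> l2 (g k)"
  shows "ip f (\<lambda>w. \<Sum>k\<in>S. g k w) = (\<Sum>k\<in>S. ip f (g k))"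
  using assms(2)
proof (induction S rule: infinite_finite_induct)
  case (insert k S)
  then have "l2 (\<lambda>w. \<Sum>k\<in>S. g k w)" by (intro l2_sum) auto
  then show ?case using insert assms(1) by (simp add: ip_add_right)
qed (auto simp: ip_def)

lemma ip_matrix: "ip f (\<lambda>w. T *v g w) = ip (\<lambda>w. mat_star T *v f w) g"
  by (simp add: ip_def cx.rip_adjoint)

lemma ip_matrix_star: "ip f (\<lambda>w. mat_star T *v g w) = ip g (\<lambda>w. T *v f w)"
  using ip_matrix[of f "mat_star T" g] by (simp add: ip_commute[of g])

lemma ip_mono:
  assumes "l2 f" "l2 g" "l2 h" "l2 k" "\<And>w. cx.rip (f w) (g w) \<le> cx.rip (h w) (k w)"
  shows "ip f g \<le> ip h k"
  unfolding ip_def using assms by (intro infsum_mono summable_ip) auto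

lemma ip_young:
  assumes "l2 p" "l2 q" and z: "mat_star z = z" "\<And>p. 0 \<le> cx.rip p (z *v p)" "z ** zi = mat 1"
  shows "2 * ip p q \<le> ip p (\<lambda>w. z *v p w) + ip q (\<lambda>w. zi *v q w)"
proof -
  have "2 * ip p q = infsum (\<lambda>w. 2 * cx.rip (p w) (q w)) UNIV"
    by (simp add: ip_def infsum_cmult_right')
  also have "\<dots> \<le> infsum (\<lambda>w. cx.rip (p w) (z *v p w) + cx.rip (q w) (zi *v q w)) UNIV"
    using assms by (intro infsum_mono summable_on_cmult_right summable_on_add summable_ip l2_matrix cx.form_young) auto
  also have "\<dots> = ip p (\<lambda>w. z *v p w) + ip q (\<lambda>w. zi *v q w)"
    unfolding ip_def using assms by (intro infsum_add summable_ip l2_matrix) auto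
  finally show ?thesis .
qed

section \<open>Creation and annihilation\<close>

text \<open>Left creation. The value type is left open because it also shifts the scalar summands of
  norms and inner products.\<close>

definition creat :: "'i \<Rightarrow> ('i list \<Rightarrow> 'b::zero) \<Rightarrow> 'i list \<Rightarrow> 'b" where
  "creat i f w = (case w of [] \<Rightarrow> 0 | j # w' \<Rightarrow> if j = i then f w' else 0)"

definition ann :: "'i \<Rightarrow> ('i list \<Rightarrow> 'b) \<Rightarrow> 'i list \<Rightarrow> 'b" where
  "ann i f w = f (i # w)"

lemma creat_simps [simp]: "creat i f [] = 0" "creat i f (j # w) = (if j = i then f w else 0)"
  by (auto simp: creat_def)

lemma has_sum_creat:
  fixes f :: "'i list \<Rightarrow> 'b::{comm_monoid_add, topological_space}"
  shows "(creat i f has_sum S) UNIV \<longleftrightarrow> (f has_sum S) UNIV"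
proof -
  have "(f has_sum S) UNIV \<longleftrightarrow> (creat i f has_sum S) (range (Cons i))"
    by (subst has_sum_reindex) (auto simp: inj_on_def o_def)
  also have "\<dots> \<longleftrightarrow> (creat i f has_sum S) UNIV"
  proof (rule has_sum_cong_neutral)
    show "creat i f w = 0" if "w \<in> UNIV - range (Cons i)" for w
      using that by (cases w) auto
  qed auto
  finally show ?thesis by simp
qed

lemma summable_creat: "creat i f summable_on UNIV \<longleftrightarrow> f summable_on UNIV"
  by (simp add: summable_on_def has_sum_creat)

lemma infsum_creat:
  fixes f :: "'i list \<Rightarrow> 'b::{comm_monoid_add, t2_space}"
  shows "infsum (creat i f) UNIV = infsum f UNIV"
  by (metis has_sum_creat has_sum_infsum infsumI infsum_not_exists summable_creat)

lemma l2_creat: "l2 f \<Longrightarrow> l2 (creat i f)"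
proof -
  assume "l2 f"
  moreover have "cx.rip (creat i f w) (creat i f w) = creat i (\<lambda>u. cx.rip (f u) (f u)) w" for w
    by (cases w) auto
  ultimately show ?thesis by (simp add: l2_def summable_creat)
qed

lemma l2_ann: "l2 f \<Longrightarrow> l2 (ann i f)"
proof -
  assume "l2 f"
  then have "(\<lambda>w. cx.rip (f w) (f w)) summable_on range (Cons i)"
    unfolding l2_def by (rule summable_on_subset_banach) auto
  then show ?thesis
    by (subst (asm) summable_on_reindex) (auto simp: inj_on_def o_def l2_def ann_def)
qed

lemma ip_creat: "ip f (creat i g) = ip (ann i f) g"
proof -
  have "cx.rip (f w) (creat i g w) = creat i (\<lambda>u. cx.rip (ann i f u) (g u)) w" for w
    by (cases w) (auto simp: ann_def)
  then show ?thesis by (simp add: ip_def infsum_creat)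
qed

lemma has_sum_finite_sum:
  fixes \<phi> :: "'k \<Rightarrow> 'w \<Rightarrow> 'b::topological_comm_monoid_add"
  assumes "\<And>k. k \<in> S \<Longrightarrow> (\<phi> k has_sum s k) A"
  shows "((\<lambda>w. \<Sum>k\<in>S. \<phi> k w) has_sum (\<Sum>k\<in>S. s k)) A"
  using assms
  by (induction S rule: infinite_finite_induct) (auto intro: has_sum_add)

text \<open>The sets of words starting with 1, ..., n are disjoint, and all other words contribute
  nonnegatively. This is the relation \<Sum> l_i l_i^* \<le> 1.\<close>

lemma sum_ann_form_le:
  fixes n :: nat
  assumes f: "l2 f" and pos: "\<And>p. 0 \<le> cx.rip p (z *v p)"
  shows "(\<Sum>i=1..n. ip (ann i f) (\<lambda>w. z *v ann i f w)) \<le> ip f (\<lambda>w. z *v f w)"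
proof -
  define \<phi> where "\<phi> i w = creat i (\<lambda>u. cx.rip (ann i f u) (z *v ann i f u)) w" for i w
  have sm: "\<phi> i summable_on UNIV" for i
    unfolding \<phi>_def using summable_ip[OF l2_ann[OF f] l2_matrix[OF l2_ann[OF f]]] by (simp add: summable_creat)
  have hs: "((\<lambda>w. \<Sum>i=1..n. \<phi> i w) has_sum (\<Sum>i=1..n. infsum (\<phi> i) UNIV)) UNIV"
    using sm by (intro has_sum_finite_sum) auto
  have "(\<Sum>i=1..n. ip (ann i f) (\<lambda>w. z *v ann i f w)) = (\<Sum>i=1..n. infsum (\<phi> i) UNIV)"
    unfolding \<phi>_def ip_def by (simp add: infsum_creat)
  also have "\<dots> = infsum (\<lambda>w. \<Sum>i=1..n. \<phi> i w) UNIV"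
    using hs by (simp add: infsumI)
  also have "\<dots> \<le> ip f (\<lambda>w. z *v f w)"
    unfolding ip_def
  proof (rule infsum_mono)
    show "(\<lambda>w. \<Sum>i=1..n. \<phi> i w) summable_on UNIV" using hs by (rule has_sum_imp_summable)
    show "(\<lambda>w. cx.rip (f w) (z *v f w)) summable_on UNIV" by (intro summable_ip l2_matrix f)
    show "(\<Sum>i=1..n. \<phi> i w) \<le> cx.rip (f w) (z *v f w)" for w
    proof (cases w)
      case Nil
      then show ?thesis by (simp add: \<phi>_def pos)
    next
      case (Cons j u)
      then have "(\<Sum>i=1..n. \<phi> i w) = (\<Sum>i=1..n. if i = j then cx.rip (f w) (z *v f w) else 0)"
        by (intro sum.cong) (auto simp: \<phi>_def ann_def)
      then show ?thesis using pos[of "f w"] by simp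
    qed
  qed
  finally show ?thesis .
qed

text \<open>The action of \<Sum> b_i \<otimes> s_i on coefficient families, see
  \<open>cfv_semicircular_mult\<close>.\<close>

definition fock_op :: "(nat \<Rightarrow> complex ^ 'm ^ 'd) \<Rightarrow> nat \<Rightarrow> (nat list \<Rightarrow> complex ^ 'm) \<Rightarrow> nat list \<Rightarrow> complex ^ 'd" where
  "fock_op b n g w = (\<Sum>i=1..n. b i *v ann i g w + b i *v creat i g w)"

lemma l2_fock_op: "l2 g \<Longrightarrow> l2 (fock_op b n g)"
  unfolding fock_op_def by (intro l2_sum l2_add l2_matrix l2_ann l2_creat)

lemma matrix_creat: "T *v creat i g w = creat i (\<lambda>u. T *v g u) w"
  by (cases w) auto

lemma ip_fock_op:
  assumes "l2 f" "l2 g"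
  shows "ip f (fock_op b n g) =
    (\<Sum>i=1..n. ip f (\<lambda>w. b i *v ann i g w) + ip (ann i f) (\<lambda>w. b i *v g w))"
proof -
  have "ip f (fock_op b n g) = (\<Sum>i=1..n. ip f (\<lambda>w. b i *v ann i g w + b i *v creat i g w))"
    unfolding fock_op_def using assms
    by (intro ip_sum_right l2_add l2_matrix l2_ann l2_creat)
  also have "\<dots> = (\<Sum>i=1..n. ip f (\<lambda>w. b i *v ann i g w) + ip (ann i f) (\<lambda>w. b i *v g w))"
  proof (rule sum.cong[OF refl])
    fix i
    have "ip f (\<lambda>w. b i *v creat i g w) = ip (ann i f) (\<lambda>w. b i *v g w)"
      unfolding matrix_creat by (rule ip_creat)
    then show "ip f (\<lambda>w. b i *v ann i g w + b i *v creat i g w) =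
        ip f (\<lambda>w. b i *v ann i g w) + ip (ann i f) (\<lambda>w. b i *v g w)"
      using assms by (simp add: ip_add_right l2_matrix l2_ann l2_creat)
  qed
  finally show ?thesis .
qed

lemma ip_fock_op_adjoint:
  assumes "l2 f" "l2 g"
  shows "ip f (fock_op b n g) = ip (fock_op (\<lambda>i. mat_star (b i)) n f) g"
proof -
  have "ip (fock_op (\<lambda>i. mat_star (b i)) n f) g = ip g (fock_op (\<lambda>i. mat_star (b i)) n f)"
    by (rule ip_commute)
  also have "\<dots> = (\<Sum>i=1..n. ip g (\<lambda>w. mat_star (b i) *v ann i f w) + ip (ann i g) (\<lambda>w. mat_star (b i) *v f w))"
    by (rule ip_fock_op[OF assms(2,1)])
  also have "\<dots> = (\<Sum>i=1..n. ip f (\<lambda>w. b i *v ann i g w) + ip (ann i f) (\<lambda>w. b i *v g w))"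
  proof (rule sum.cong[OF refl])
    fix i
    show "ip g (\<lambda>w. mat_star (b i) *v ann i f w) + ip (ann i g) (\<lambda>w. mat_star (b i) *v f w) =
        ip f (\<lambda>w. b i *v ann i g w) + ip (ann i f) (\<lambda>w. b i *v g w)"
      unfolding ip_matrix_star by simp
  qed
  also have "\<dots> = ip f (fock_op b n g)" by (rule ip_fock_op[OF assms, symmetric])
  finally show ?thesis by simp
qed

section \<open>The two-sided variational bounds\<close>

lemma ip_sum_matrix:
  assumes "l2 f"
  shows "ip f (\<lambda>w. (\<Sum>k\<in>S. T k) *v f w) = (\<Sum>k\<in>S. ip f (\<lambda>w. T k *v f w))"
  unfolding matrix_vector_mult_sum_left using assms by (intro ip_sum_right l2_matrix)

lemma ip_conj: "ip (\<lambda>w. T *v f w) (\<lambda>w. M *v (T *v f w)) = ip f (\<lambda>w. (mat_star T ** M ** T) *v f w)"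
  unfolding matrix_vector_mul_assoc[symmetric] ip_matrix[of f "mat_star T"] by simp

text \<open>Here h = x^* f, and one factor h of 2 <h, h> is split into annihilation and creation
  parts. The z-form from the first Young inequality and the W-form from the second add up to at most
  <h, h>, because W + \<Sum> a_j^* z a_j = 1, and this absorbs one of the two copies.\<close>

lemma fock_upper_bound:
  fixes a :: "nat \<Rightarrow> complex ^ 'm ^ 'd"
  assumes f: "l2 f"
    and z: "mat_star z = z" "\<And>p. 0 \<le> cx.rip p (z *v p)" "z ** zi = mat 1"
    and W: "W = mat 1 - (\<Sum>j=1..n. mat_star (a j) ** z ** a j)"
      "\<And>p. 0 \<le> cx.rip p (W *v p)" "W ** Wi = mat 1"
    and L: "\<And>v. cx.rip v ((zi + (\<Sum>i=1..n. a i ** Wi ** mat_star (a i))) *v v) \<le> L * cx.rip v v"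
  shows "ip (fock_op (\<lambda>i. mat_star (a i)) n f) (fock_op (\<lambda>i. mat_star (a i)) n f) \<le> L * ip f f"
proof -
  define h where "h = fock_op (\<lambda>i. mat_star (a i)) n f"
  have h: "l2 h" unfolding h_def by (rule l2_fock_op[OF f])
  have Ws: "mat_star W = W"
    by (simp add: W(1) mat_star_diff mat_star_sum mat_star_mult z(1) matrix_mul_assoc)
  have "2 * ip h h = (\<Sum>i=1..n. 2 * ip (\<lambda>w. a i *v h w) (ann i f) + 2 * ip (ann i h) (\<lambda>w. mat_star (a i) *v f w))"
    unfolding h_def[symmetric] by (subst (2) h_def) (simp add: ip_fock_op[OF h f] ip_matrix sum_distrib_left distrib_left)
  also have "\<dots> \<le> (\<Sum>i=1..n. (ip h (\<lambda>w. (mat_star (a i) ** z ** a i) *v h w) + ip (ann i f) (\<lambda>w. zi *v ann i f w)) +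
      (ip (ann i h) (\<lambda>w. W *v ann i h w) + ip f (\<lambda>w. (a i ** Wi ** mat_star (a i)) *v f w)))"
  proof (rule sum_mono)
    fix i
    have "2 * ip (\<lambda>w. a i *v h w) (ann i f) \<le>
        ip (\<lambda>w. a i *v h w) (\<lambda>w. z *v (a i *v h w)) + ip (ann i f) (\<lambda>w. zi *v ann i f w)"
      by (intro ip_young z l2_matrix l2_ann f h)
    moreover have "2 * ip (ann i h) (\<lambda>w. mat_star (a i) *v f w) \<le> ip (ann i h) (\<lambda>w. W *v ann i h w) +
        ip (\<lambda>w. mat_star (a i) *v f w) (\<lambda>w. Wi *v (mat_star (a i) *v f w))"
      by (intro ip_young Ws W l2_matrix l2_ann f h)
    ultimately show "2 * ip (\<lambda>w. a i *v h w) (ann i f) + 2 * ip (ann i h) (\<lambda>w. mat_star (a i) *v f w)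
      \<le> (ip h (\<lambda>w. (mat_star (a i) ** z ** a i) *v h w) + ip (ann i f) (\<lambda>w. zi *v ann i f w)) +
      (ip (ann i h) (\<lambda>w. W *v ann i h w) + ip f (\<lambda>w. (a i ** Wi ** mat_star (a i)) *v f w))"
      unfolding ip_conj by simp
  qed
  also have "\<dots> = ip h (\<lambda>w. (\<Sum>i=1..n. mat_star (a i) ** z ** a i) *v h w) + (\<Sum>i=1..n. ip (ann i f) (\<lambda>w. zi *v ann i f w))
     + (\<Sum>i=1..n. ip (ann i h) (\<lambda>w. W *v ann i h w)) + ip f (\<lambda>w. (\<Sum>i=1..n. a i ** Wi ** mat_star (a i)) *v f w)"
    by (simp add: sum.distrib ip_sum_matrix f h)
  also have "\<dots> \<le> ip h (\<lambda>w. (\<Sum>i=1..n. mat_star (a i) ** z ** a i) *v h w) + ip f (\<lambda>w. zi *v f w)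
     + ip h (\<lambda>w. W *v h w) + ip f (\<lambda>w. (\<Sum>i=1..n. a i ** Wi ** mat_star (a i)) *v f w)"
    using sum_ann_form_le[OF f cx.form_inverse_ge_0[OF z], of n] sum_ann_form_le[OF h W(2), of n] by linarith
  also have "\<dots> = (ip h (\<lambda>w. (\<Sum>i=1..n. mat_star (a i) ** z ** a i) *v h w) + ip h (\<lambda>w. W *v h w))
     + (ip f (\<lambda>w. zi *v f w) + ip f (\<lambda>w. (\<Sum>i=1..n. a i ** Wi ** mat_star (a i)) *v f w))"
    by simp
  also have "ip h (\<lambda>w. (\<Sum>i=1..n. mat_star (a i) ** z ** a i) *v h w) + ip h (\<lambda>w. W *v h w) = ip h h"
    by (subst ip_add_right[symmetric]) (use h in \<open>auto simp: l2_matrix W(1) simp flip: matrix_vector_mult_add_rdistrib\<close>)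
  also have "ip f (\<lambda>w. zi *v f w) + ip f (\<lambda>w. (\<Sum>i=1..n. a i ** Wi ** mat_star (a i)) *v f w)
      = ip f (\<lambda>w. (zi + (\<Sum>i=1..n. a i ** Wi ** mat_star (a i))) *v f w)"
    unfolding matrix_vector_mult_add_rdistrib by (rule ip_add_right[symmetric]) (intro l2_matrix f)+
  also have "\<dots> \<le> ip f (\<lambda>w. L *\<^sub>R f w)"
    by (intro ip_mono l2_matrix l2_scaleR f) (simp only: L cx.rip_scaleR_right)
  also have "\<dots> = L * ip f f" by (rule ip_scaleR_right)
  finally show ?thesis unfolding h_def by simp
qed

text \<open>Here y = -z. A lower bound for <h, h> is obtained by testing h against a single
  \<open>g\<close>: <h, h> \<ge> 2 <g, h> - <g, g>.\<close>

lemma fock_lower_bound: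
  fixes a :: "nat \<Rightarrow> complex ^ 'm ^ 'd"
  assumes f: "l2 f"
    and y: "mat_star y = y" "\<And>p. 0 \<le> cx.rip p (y *v p)" "y ** yi = mat 1"
    and W: "W = mat 1 + (\<Sum>j=1..n. mat_star (a j) ** y ** a j)" "W ** Wi = mat 1"
    and L: "\<And>v. L * cx.rip v v \<le> cx.rip v (((\<Sum>i=1..n. a i ** Wi ** mat_star (a i)) - yi) *v v)"
  shows "L * ip f f \<le> ip (fock_op (\<lambda>i. mat_star (a i)) n f) (fock_op (\<lambda>i. mat_star (a i)) n f)"
proof -
  define h where "h = fock_op (\<lambda>i. mat_star (a i)) n f"
  have h: "l2 h" unfolding h_def by (rule l2_fock_op[OF f])
  define k where "k i w = Wi *v (mat_star (a i) *v f w)" for i w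
  have k: "l2 (k i)" for i unfolding k_def by (intro l2_matrix f)
  \<comment> \<open>\<open>g\<close> is the critical point of 2 <g, c> - <g, W g>, where c is the
    creation part of h; the value there is \<open>Q\<close>, the form of \<Sum> a_i W^{-1} a_i^* at
    f.\<close>
  define g where "g w = (\<Sum>i=1..n. creat i (k i) w)" for w
  have g: "l2 g" unfolding g_def by (intro l2_sum l2_creat k)
  have anng: "ann i g = k i" if "i \<in> {1..n}" for i
    using that by (auto simp: ann_def g_def fun_eq_iff)
  define Q where "Q = (\<Sum>i=1..n. ip f (\<lambda>w. (a i ** Wi ** mat_star (a i)) *v f w))"
  have kf: "ip (k i) (\<lambda>w. mat_star (a i) *v f w) = ip f (\<lambda>w. (a i ** Wi ** mat_star (a i)) *v f w)" for i
    unfolding k_def ip_commute[of "\<lambda>w. Wi *v _ w"] ip_conj by simp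
  have gWg: "ip g (\<lambda>w. W *v g w) = Q"
  proof -
    have "ip g (\<lambda>w. W *v g w) = ip (\<lambda>w. W *v g w) g" by (rule ip_commute)
    also have "\<dots> = (\<Sum>i=1..n. ip (\<lambda>w. W *v g w) (creat i (k i)))"
      using ip_sum_right[of "\<lambda>w. W *v g w" "{1..n}" "\<lambda>i. creat i (k i)", OF l2_matrix[OF g] l2_creat[OF k]]
      unfolding g_def[symmetric] .
    also have "\<dots> = (\<Sum>i=1..n. ip (k i) (\<lambda>w. mat_star (a i) *v f w))"
    proof (rule sum.cong[OF refl])
      fix i assume i: "i \<in> {1..n}"
      have "W *v ann i g w = mat_star (a i) *v f w" for w
        unfolding anng[OF i] k_def matrix_vector_mul_assoc[of W] W(2) by simp
      then have "ann i (\<lambda>w. W *v g w) = (\<lambda>w. mat_star (a i) *v f w)"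
        by (simp add: ann_def fun_eq_iff)
      then show "ip (\<lambda>w. W *v g w) (creat i (k i)) = ip (k i) (\<lambda>w. mat_star (a i) *v f w)"
        unfolding ip_creat by (simp only: ip_commute[of "k i"])
    qed
    finally show ?thesis by (simp add: kf Q_def)
  qed
  have "2 * ip g h = (\<Sum>i=1..n. 2 * ip (\<lambda>w. a i *v g w) (ann i f) + 2 * ip (ann i g) (\<lambda>w. mat_star (a i) *v f w))"
    unfolding h_def by (simp add: ip_fock_op[OF g f] ip_matrix sum_distrib_left distrib_left)
  also have "\<dots> = (\<Sum>i=1..n. 2 * ip (\<lambda>w. a i *v g w) (ann i f)) + 2 * Q"
    by (simp add: sum.distrib anng kf Q_def sum_distrib_left)
  finally have 1: "2 * ip g h = (\<Sum>i=1..n. 2 * ip (\<lambda>w. a i *v g w) (ann i f)) + 2 * Q" .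
  have "- (\<Sum>i=1..n. 2 * ip (\<lambda>w. a i *v g w) (ann i f)) = (\<Sum>i=1..n. 2 * ip (\<lambda>w. a i *v g w) (\<lambda>w. - ann i f w))"
    by (simp add: ip_minus_right sum_negf)
  also have "\<dots> \<le> (\<Sum>i=1..n. ip g (\<lambda>w. (mat_star (a i) ** y ** a i) *v g w) + ip (ann i f) (\<lambda>w. yi *v ann i f w))"
  proof (rule sum_mono)
    fix i
    have "l2 (\<lambda>w. - ann i f w)" using l2_scaleR[OF l2_ann[OF f], of "-1"] by simp
    then have "2 * ip (\<lambda>w. a i *v g w) (\<lambda>w. - ann i f w) \<le> ip (\<lambda>w. a i *v g w) (\<lambda>w. y *v (a i *v g w)) +
        ip (\<lambda>w. - ann i f w) (\<lambda>w. yi *v (- ann i f w))"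
      by (intro ip_young y l2_matrix g)
    moreover have "yi *v (- v) = - (yi *v v)" for v
      using matrix_vector_scaleR_right[of yi "-1" v] by simp
    ultimately show "2 * ip (\<lambda>w. a i *v g w) (\<lambda>w. - ann i f w) \<le>
        ip g (\<lambda>w. (mat_star (a i) ** y ** a i) *v g w) + ip (ann i f) (\<lambda>w. yi *v ann i f w)"
      unfolding ip_conj by (simp add: ip_minus_right ip_commute[of "\<lambda>w. - ann i f w"]
          ip_commute[of "\<lambda>w. yi *v ann i f w"])
  qed
  also have "\<dots> = ip g (\<lambda>w. (\<Sum>i=1..n. mat_star (a i) ** y ** a i) *v g w) + (\<Sum>i=1..n. ip (ann i f) (\<lambda>w. yi *v ann i f w))"
    by (simp add: sum.distrib ip_sum_matrix g)
  also have "\<dots> \<le> ip g (\<lambda>w. (\<Sum>i=1..n. mat_star (a i) ** y ** a i) *v g w) + ip f (\<lambda>w. yi *v f w)"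
    using sum_ann_form_le[OF f cx.form_inverse_ge_0[OF y], of n] by linarith
  also have "ip g (\<lambda>w. (\<Sum>i=1..n. mat_star (a i) ** y ** a i) *v g w) = Q - ip g g"
  proof -
    have "ip g (\<lambda>w. W *v g w) = ip g g + ip g (\<lambda>w. (\<Sum>i=1..n. mat_star (a i) ** y ** a i) *v g w)"
      unfolding W(1) matrix_vector_mult_add_rdistrib
      by (subst ip_add_right) (use g in \<open>auto simp: l2_matrix\<close>)
    then show ?thesis using gWg by simp
  qed
  finally have 2: "- (\<Sum>i=1..n. 2 * ip (\<lambda>w. a i *v g w) (ann i f)) \<le> Q - ip g g + ip f (\<lambda>w. yi *v f w)" .
  have 3: "2 * ip g h \<le> ip g g + ip h h"
    using ip_young[OF g h, of "mat 1" "mat 1"] by simp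
  have "L * ip f f = ip f (\<lambda>w. L *\<^sub>R f w)" by (rule ip_scaleR_right[symmetric])
  also have "\<dots> \<le> ip f (\<lambda>w. ((\<Sum>i=1..n. a i ** Wi ** mat_star (a i)) - yi) *v f w)"
    by (intro ip_mono l2_matrix l2_scaleR f) (simp only: L cx.rip_scaleR_right)
  also have "\<dots> = Q - ip f (\<lambda>w. yi *v f w)"
    unfolding matrix_vector_mult_diff_rdistrib Q_def ip_sum_matrix[OF f, symmetric]
    by (rule ip_diff_right) (intro l2_matrix f)+
  also have "\<dots> \<le> ip h h" using 1 2 3 by linarith
  finally show ?thesis by (simp add: h_def)
qed


section \<open>The Dyson equation\<close>

text \<open>For real \<open>\<alpha>, \<beta>\<close> the self-adjoint block operator with diagonal blocks \<open>\<alpha>, \<beta>\<close> and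
  off-diagonal blocks \<open>- x, - x\<^sup>*\<close> maps \<open>(f, g)\<close> to \<open>(p, q) \<otimes> \<Omega>\<close>.\<close>

definition solves :: "real \<Rightarrow> real \<Rightarrow> (nat \<Rightarrow> complex ^ 'm ^ 'd) \<Rightarrow> nat \<Rightarrow>
    (nat list \<Rightarrow> complex ^ 'd) \<Rightarrow> (nat list \<Rightarrow> complex ^ 'm) \<Rightarrow> complex ^ 'd \<Rightarrow> complex ^ 'm \<Rightarrow> bool" where
  "solves \<alpha> \<beta> a n f g p q \<longleftrightarrow> l2 f \<and> l2 g \<and>
    (\<forall>w. \<alpha> *\<^sub>R f w - fock_op a n g w = (if w = [] then p else 0)) \<and>
    (\<forall>w. \<beta> *\<^sub>R g w - fock_op (\<lambda>i. mat_star (a i)) n f w = (if w = [] then q else 0))"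

lemma solves_swap: "solves \<beta> \<alpha> (\<lambda>i. mat_star (a i)) n g f q p \<longleftrightarrow> solves \<alpha> \<beta> a n f g p q"
  by (auto simp: solves_def)

lemma ip_vacuum: "ip f (\<lambda>w. if w = [] then p else 0) = cx.rip (f []) p"
proof -
  have "infsum (\<lambda>w. cx.rip (f w) (if w = [] then p else 0)) UNIV = infsum (\<lambda>w. cx.rip (f w) p) {[]}"
    by (rule infsum_cong_neutral) auto
  then show ?thesis by (simp add: ip_def)
qed

text \<open>The block operator is symmetric, so pairing one solution with the source of the other is
  symmetric too; the sources sit on the vacuum, which leaves only vacuum coefficients.\<close>

lemma solves_pairing:
  assumes s: "solves \<alpha> \<beta> a n f g p q" and s': "solves \<alpha> \<beta> a n f' g' p' q'"
  shows "cx.rip (f []) p' + cx.rip (g []) q' = cx.rip p (f' []) + cx.rip q (g' [])"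
proof -
  have *: "cx.rip (f1 []) p2 + cx.rip (g1 []) q2 =
      \<alpha> * ip f1 f2 + \<beta> * ip g1 g2 - ip f1 (fock_op a n g2) - ip (fock_op a n g1) f2"
    if s1: "solves \<alpha> \<beta> a n f1 g1 p1 q1" and s2: "solves \<alpha> \<beta> a n f2 g2 p2 q2" for f1 g1 p1 q1 f2 g2 p2 q2
  proof -
    have l: "l2 f1" "l2 g1" "l2 f2" "l2 g2" using s1 s2 by (auto simp: solves_def)
    have "cx.rip (f1 []) p2 = ip f1 (\<lambda>w. \<alpha> *\<^sub>R f2 w - fock_op a n g2 w)"
      using s2 by (simp add: solves_def ip_vacuum)
    also have "\<dots> = \<alpha> * ip f1 f2 - ip f1 (fock_op a n g2)"
      using l by (simp add: ip_diff_right ip_scaleR_right l2_scaleR l2_fock_op)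
    finally have 1: "cx.rip (f1 []) p2 = \<alpha> * ip f1 f2 - ip f1 (fock_op a n g2)" .
    have "cx.rip (g1 []) q2 = ip g1 (\<lambda>w. \<beta> *\<^sub>R g2 w - fock_op (\<lambda>i. mat_star (a i)) n f2 w)"
      using s2 by (simp add: solves_def ip_vacuum)
    also have "\<dots> = \<beta> * ip g1 g2 - ip g1 (fock_op (\<lambda>i. mat_star (a i)) n f2)"
      using l by (simp add: ip_diff_right ip_scaleR_right l2_scaleR l2_fock_op)
    also have "ip g1 (fock_op (\<lambda>i. mat_star (a i)) n f2) = ip (fock_op a n g1) f2"
      using ip_fock_op_adjoint[OF l(2,3), of "\<lambda>i. mat_star (a i)" n] by simp
    finally show ?thesis using 1 by simp
  qed
  have "cx.rip p (f' []) + cx.rip q (g' []) = cx.rip (f' []) p + cx.rip (g' []) q"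
    by (simp only: cx.rip_commute)
  then show ?thesis
    using *[OF s s'] *[OF s' s] by (simp add: ip_commute[of f'] ip_commute[of g'] ip_commute[of "fock_op a n g'"])
qed

text \<open>\<open>fock_op\<close> changes word length by one and so swaps parities. Taking one
  parity in \<open>f\<close> and the other in \<open>g\<close> removes the vacuum coefficient of one
  component.\<close>

definition parity_part :: "bool \<Rightarrow> ('i list \<Rightarrow> 'b::zero) \<Rightarrow> 'i list \<Rightarrow> 'b" where
  "parity_part c f w = (if even (length w) = c then f w else 0)"

lemma fock_op_parity_part: "fock_op b n (parity_part c g) w = parity_part (\<not> c) (fock_op b n g) w"
proof -
  have "ann i (parity_part c g) w = parity_part (\<not> c) (ann i g) w" for i
    by (auto simp: ann_def parity_part_def)
  moreover have "creat i (parity_part c g) w = parity_part (\<not> c) (creat i g) w" for i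
    by (cases w) (auto simp: parity_part_def)
  ultimately show ?thesis by (auto simp: fock_op_def parity_part_def)
qed

lemma l2_parity_part: "l2 f \<Longrightarrow> l2 (parity_part c f)"
  by (rule l2_le[where K=1]) (auto simp: parity_part_def)

text \<open>The empty word is even. For \<open>c\<close> true the second equation is projected to
  odd words, which is why \<open>q = 0\<close> is required; likewise \<open>p = 0\<close>
  otherwise.\<close>

lemma solves_parity_part:
  assumes "solves \<alpha> \<beta> a n f g p q" "if c then q = 0 else p = 0"
  shows "solves \<alpha> \<beta> a n (parity_part c f) (parity_part (\<not> c) g) p q"
proof -
  have "\<alpha> *\<^sub>R parity_part c f w - parity_part c (fock_op a n g) w = (if w = [] then p else 0)" for w
    using assms by (cases "even (length w) = c") (auto simp: solves_def parity_part_def)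
  moreover have "\<beta> *\<^sub>R parity_part (\<not> c) g w - parity_part (\<not> c) (fock_op (\<lambda>i. mat_star (a i)) n f) w
      = (if w = [] then q else 0)" for w
    using assms by (cases "even (length w) = c") (auto simp: solves_def parity_part_def)
  ultimately show ?thesis
    using assms(1) by (simp add: solves_def fock_op_parity_part l2_parity_part)
qed

text \<open>\<open>right_ext n p F\<close> is \<open>p \<otimes> \<Omega> + \<Sum>i. r\<^sub>i F\<^sub>i\<close> with the right creation operators \<open>r\<^sub>i\<close>. These commute
  with left creation, and with left annihilation up to a vacuum term, so right translates of solutions
  of the block equation again solve it up to a vacuum term.\<close>

definition right_ext :: "nat \<Rightarrow> 'b::zero \<Rightarrow> (nat \<Rightarrow> nat list \<Rightarrow> 'b) \<Rightarrow> nat list \<Rightarrow> 'b" where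
  "right_ext n p F w = (if w = [] then p else if last w \<in> {1..n} then F (last w) (butlast w) else 0)"

lemma right_ext_simps [simp]:
  "right_ext n p F [] = p"
  "right_ext n p F (w @ [i]) = (if i \<in> {1..n} then F i w else 0)"
  "right_ext n p F (j # w @ [i]) = (if i \<in> {1..n} then F i (j # w) else 0)"
  by (auto simp: right_ext_def butlast_append)

lemma l2_right_ext:
  assumes "\<And>i. l2 (F i)"
  shows "l2 (right_ext n p F)"
proof -
  define G where "G i w = (if w \<noteq> [] \<and> last w = i then F i (butlast w) else 0)" for i w
  have "l2 (\<lambda>w::nat list. if w = [] then p else 0)"
    unfolding l2_def by (rule finite_nonzero_values_imp_summable_on) (auto intro: finite_subset[of _ "{[]}"])
  moreover have "l2 (G i)" for i
  proof -
    have "(\<lambda>w. cx.rip (G i w) (G i w)) summable_on range (\<lambda>w. w @ [i])"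
      using assms[of i] by (subst summable_on_reindex) (auto simp: inj_on_def o_def G_def l2_def)
    moreover have "cx.rip (G i w) (G i w) = 0" if "w \<in> UNIV - range (\<lambda>w. w @ [i])" for w
    proof -
      have "w = [] \<or> last w \<noteq> i" using that append_butlast_last_id[of w] by (metis DiffE rangeI)
      then show ?thesis by (auto simp: G_def)
    qed
    ultimately show ?thesis
      unfolding l2_def by (subst summable_on_cong_neutral[where T="range (\<lambda>w. w @ [i])"]) auto
  qed
  ultimately have "l2 (\<lambda>w. (if w = [] then p else 0) + (\<Sum>i=1..n. G i w))"
    by (intro l2_add l2_sum)
  moreover have "right_ext n p F w = (if w = [] then p else 0) + (\<Sum>i=1..n. G i w)" for w
  proof -
    have "(\<Sum>i=1..n. G i w) = (\<Sum>i=1..n. if i = last w then (if w \<noteq> [] then F i (butlast w) else 0) else 0)"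
      by (intro sum.cong) (auto simp: G_def)
    then show ?thesis by (simp add: right_ext_def)
  qed
  ultimately show ?thesis by (simp only: l2_def)
qed

lemma fock_op_right_ext_Nil: "fock_op b n (right_ext n p F) [] = (\<Sum>i=1..n. b i *v F i [])"
proof -
  have "ann i (right_ext n p F) [] = F i []" if "i \<in> {1..n}" for i
    using right_ext_simps(2)[of n p F "[]" i] that by (simp add: ann_def)
  then show ?thesis by (auto simp: fock_op_def intro: sum.cong)
qed

text \<open>The one-letter word \<open>[i]\<close> is special: left creation reaches it from the
  vacuum value \<open>p\<close>, which is no right translate.\<close>

lemma fock_op_right_ext_snoc:
  "fock_op b n (right_ext n p F) (w @ [i]) =
    (if i \<in> {1..n} then fock_op b n (F i) w + (if w = [] then b i *v p else 0) else 0)"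
proof (cases w)
  case Nil
  have e: "right_ext n p F [j, i] = (if i \<in> {1..n} then F i [j] else 0)" for j
    using right_ext_simps(3)[of n p F j "[]" i] by simp
  have "fock_op b n (right_ext n p F) [i] = (\<Sum>j=1..n. b j *v (if i \<in> {1..n} then F i [j] else 0)) +
      (\<Sum>j=1..n. b j *v (if i = j then p else 0))"
    by (simp add: fock_op_def ann_def sum.distrib e cong: if_cong)
  also have "(\<Sum>j=1..n. b j *v (if i = j then p else 0)) = (\<Sum>j=1..n. if j = i then b i *v p else 0)"
    by (intro sum.cong) auto
  finally have *: "fock_op b n (right_ext n p F) [i] = (\<Sum>j=1..n. b j *v (if i \<in> {1..n} then F i [j] else 0)) +
      (\<Sum>j=1..n. if j = i then b i *v p else 0)" .
  show ?thesis
  proof (cases "i \<in> {1..n}")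
    case True
    then show ?thesis using * Nil by (simp add: fock_op_def ann_def)
  next
    case False
    then have "(\<Sum>j=1..n. if j = i then b i *v p else 0) = 0" by (intro sum.neutral) auto
    then show ?thesis
      unfolding Nil append_Nil * by (simp only: False if_False matrix_vector_mult_0_right sum.neutral_const add_0)
  qed
next
  case (Cons k u)
  have cr: "creat j (right_ext n p F) (w @ [i]) = (if i \<in> {1..n} then creat j (F i) w else 0)" for j
    by (simp add: Cons)
  have an: "ann j (right_ext n p F) (w @ [i]) = (if i \<in> {1..n} then ann j (F i) w else 0)" for j
    by (simp add: ann_def)
  show ?thesis
  proof (cases "i \<in> {1..n}")
    case True
    then show ?thesis unfolding fock_op_def cr an using Cons by simp
  next
    case False
    then show ?thesis
      unfolding fock_op_def cr an
      by (simp only: False if_False matrix_vector_mult_0_right sum.neutral_const add_0)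
  qed
qed

text \<open>Extend P v by the right translates of the solutions with source b_i = a_i^* P v. This
  source cancels the extra creation term of P v in the second equation, so the extension solves the
  system with vacuum source \<open>p\<close> in the first; pair it with the solution for
  \<open>u\<close>.\<close>

lemma dyson_equation:
  fixes a :: "nat \<Rightarrow> complex ^ 'm ^ 'd"
  assumes 1: "\<And>v. solves \<alpha> \<beta> a n (F1 v) (G1 v) v 0" "\<And>v. F1 v [] = P v"
    and 2: "\<And>u. solves \<alpha> \<beta> a n (F2 u) (G2 u) 0 u" "\<And>u. F2 u [] = 0" "\<And>u. G2 u [] = Q u"
  shows "cx.rip (P u) (\<alpha> *\<^sub>R P v - (\<Sum>i=1..n. a i *v Q (mat_star (a i) *v P v))) = cx.rip u (P v)"
proof -
  define b where "b i = mat_star (a i) *v P v" for i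
  define f where "f = right_ext n (P v) (\<lambda>i. F2 (b i))"
  define g where "g = right_ext n 0 (\<lambda>i. G2 (b i))"
  define p where "p = \<alpha> *\<^sub>R P v - (\<Sum>i=1..n. a i *v Q (b i))"
  have "solves \<alpha> \<beta> a n f g p 0"
    unfolding solves_def
  proof (intro conjI allI)
    show "l2 f" "l2 g" unfolding f_def g_def using 2(1) by (auto simp: solves_def intro: l2_right_ext)
    show "\<alpha> *\<^sub>R f w - fock_op a n g w = (if w = [] then p else 0)" for w
    proof (cases w rule: rev_cases)
      case Nil
      then show ?thesis by (simp add: f_def g_def fock_op_right_ext_Nil p_def 2(3))
    next
      case (snoc w' i)
      have "\<alpha> *\<^sub>R F2 (b i) w' - fock_op a n (G2 (b i)) w' = 0"
        using 2(1)[of "b i"] by (simp add: solves_def)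
      then show ?thesis by (simp add: snoc f_def g_def fock_op_right_ext_snoc)
    qed
    show "\<beta> *\<^sub>R g w - fock_op (\<lambda>i. mat_star (a i)) n f w = (if w = [] then 0 else 0)" for w
    proof (cases w rule: rev_cases)
      case Nil
      then show ?thesis by (simp add: f_def g_def fock_op_right_ext_Nil 2(2))
    next
      case (snoc w' i)
      have "\<beta> *\<^sub>R G2 (b i) w' - fock_op (\<lambda>i. mat_star (a i)) n (F2 (b i)) w' = (if w' = [] then b i else 0)"
        using 2(1)[of "b i"] by (simp add: solves_def)
      then show ?thesis
        by (auto simp: snoc f_def g_def fock_op_right_ext_snoc b_def diff_eq_eq add.commute split: if_splits)
    qed
  qed
  from solves_pairing[OF 1(1)[of u] this] show ?thesis
    by (simp add: 1(2) f_def g_def p_def b_def)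
qed

section \<open>The matrix of semicirculars\<close>

lemma mat_star_tensor: "mat_star (A \<otimes>\<^sub>M t) = mat_star A \<otimes>\<^sub>M star t"
  by (simp add: mat_star_def mat_tensor_def star_scaleC star_complex_def vec_eq_iff)

definition emb :: "complex ^ 'd \<Rightarrow> 'a::cstar_algebra ^ 'd" where "emb u = (\<chi> k. u $ k *\<^sub>C 1)"

context free_family
begin

definition cfv :: "nat list \<Rightarrow> 'a ^ 'd \<Rightarrow> complex ^ 'd" where "cfv w \<xi> = (\<chi> k. cf w (\<xi> $ k))"

definition expect :: "'a ^ 'm ^ 'd \<Rightarrow> complex ^ 'm ^ 'd" where "expect X = (\<chi> k l. \<tau> (X $ k $ l))"

lemma cf_scaleR: "cf w (r *\<^sub>R x) = complex_of_real r * cf w x"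
  by (metis cf_scaleC scaleC_of_real)

lemma cf_diff: "cf w (x - y) = cf w x - cf w y"
  using cf_add[of w "x - y" y] by simp

lemma cfv_diff: "cfv w (\<xi> - \<eta>) = cfv w \<xi> - cfv w \<eta>"
  by (simp add: cfv_def cf_diff vec_eq_iff)

lemma cfv_scaleR: "cfv w (r *\<^sub>R \<xi>) = r *\<^sub>R cfv w \<xi>"
  by (simp add: cfv_def cf_scaleR vec_eq_iff scaleR_conv_of_real[where 'a=complex])

lemma cfv_emb: "cfv w (emb u) = (if w = [] then u else 0)"
  by (simp add: cfv_def emb_def cf_scaleC cf_one vec_eq_iff)

text \<open>Bessel's inequality is enough, so this covers all columns, including resolvents applied
  to scalar columns.\<close>

lemma l2_cfv: "l2 (\<lambda>w. cfv w \<xi>)"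
  unfolding l2_def
proof (rule nonneg_bdd_above_summable_on)
  show "bdd_above (sum (\<lambda>w. cx.rip (cfv w \<xi>) (cfv w \<xi>)) ` {F. F \<subseteq> UNIV \<and> finite F})"
  proof (rule bdd_aboveI2)
    fix F :: "nat list set" assume F: "F \<in> {F. F \<subseteq> UNIV \<and> finite F}"
    have sq: "cx.sqn c = (cmod c)\<^sup>2" for c
      by (simp add: cx.sqn_def star_complex_def cmod_power2 flip: power2_eq_square)
    have "(\<Sum>w\<in>F. cx.rip (cfv w \<xi>) (cfv w \<xi>)) = (\<Sum>k\<in>UNIV. \<Sum>w\<in>F. (cmod (cf w (\<xi> $ k)))\<^sup>2)"
      unfolding cx.rip_self_sqn sq cfv_def by (simp, rule sum.swap)
    also have "\<dots> \<le> (\<Sum>k\<in>UNIV. sqn (\<xi> $ k))" using F by (intro sum_mono cf_bessel) auto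
    finally show "(\<Sum>w\<in>F. cx.rip (cfv w \<xi>) (cfv w \<xi>)) \<le> (\<Sum>k\<in>UNIV. sqn (\<xi> $ k))" .
  qed
qed simp

lemma ip_cfv:
  assumes "\<And>k. \<eta> $ k \<in> polys"
  shows "ip (\<lambda>w. cfv w \<xi>) (\<lambda>w. cfv w \<eta>) = rip \<xi> \<eta>"
proof -
  have "((\<lambda>w. \<Sum>k\<in>UNIV. cnj (cf w (\<xi> $ k)) * cf w (\<eta> $ k)) has_sum (\<Sum>k\<in>UNIV. \<tau> (star (\<xi> $ k) * \<eta> $ k))) UNIV"
    by (intro has_sum_finite_sum cf_parseval assms)
  then have "((\<lambda>w. cx.tip (cfv w \<xi>) (cfv w \<eta>)) has_sum tip \<xi> \<eta>) UNIV"
    by (simp add: cx.tip_def tip_def cfv_def star_complex_def)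
  then have "((\<lambda>w. Re (cx.tip (cfv w \<xi>) (cfv w \<eta>))) has_sum Re (tip \<xi> \<eta>)) UNIV"
    by (rule has_sum_bounded_linear[OF bounded_linear_Re, unfolded o_def])
  then show ?thesis by (simp add: ip_def cx.rip_def rip_def infsumI)
qed

lemma rip_emb: "rip (emb u) \<xi> = cx.rip u (cfv [] \<xi>)"
  by (simp add: rip_def tip_def cx.rip_def cx.tip_def emb_def cfv_def cf_Nil star_scaleC star_complex_def
      mult_scaleC_left tau_scaleC)

lemma emb_eq_0: "emb u = (0 :: 'a ^ 'd) \<longleftrightarrow> u = 0"
proof -
  have "c *\<^sub>C (1::'a) = 0 \<longleftrightarrow> c = 0" for c
    using norm_eq_zero[of "c *\<^sub>C (1::'a)", unfolded norm_scaleC] by simp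
  then show ?thesis by (simp add: emb_def vec_eq_iff)
qed

lemma expect_mult: "expect X *v u = cfv [] (X *v emb u)"
  by (simp add: expect_def cfv_def cf_Nil matrix_vector_mult_def emb_def vec_eq_iff tau_sum
      mult_scaleC_right tau_scaleC mult.commute)

lemma mat_star_expect: "mat_star (expect X) = expect (mat_star X)"
  by (simp add: expect_def mat_star_def tau_star star_complex_def vec_eq_iff)

lemma cfv_semicircular_mult:
  fixes a :: "nat \<Rightarrow> complex ^ 'm ^ 'd"
  shows "cfv w ((\<Sum>i=1..n. a i \<otimes>\<^sub>M s i) *v \<xi>) = fock_op a n (\<lambda>w. cfv w \<xi>) w"
proof -
  have cr: "creat i (\<lambda>w. cfv w \<xi>) w $ l = creat i (\<lambda>w. cf w (\<xi> $ l)) w" for i l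
    by (cases w) (auto simp: cfv_def)
  have cs: "cf w (s i * \<xi> $ l) = cf (i # w) (\<xi> $ l) + creat i (\<lambda>w. cf w (\<xi> $ l)) w" if "i \<in> {1..n}" for i l
    by (simp add: cf_s[OF that] creat_def)
  have "cfv w ((\<Sum>i=1..n. a i \<otimes>\<^sub>M s i) *v \<xi>) $ k = fock_op a n (\<lambda>w. cfv w \<xi>) w $ k" for k
  proof -
    have "cfv w ((\<Sum>i=1..n. a i \<otimes>\<^sub>M s i) *v \<xi>) $ k = (\<Sum>l\<in>UNIV. \<Sum>i=1..n. a i $ k $ l * cf w (s i * \<xi> $ l))"
      by (simp add: cfv_def matrix_vector_mult_def mat_tensor_def sum_distrib_right mult_scaleC_left
          cf_sum cf_scaleC)
    also have "\<dots> = (\<Sum>i=1..n. \<Sum>l\<in>UNIV. a i $ k $ l * cf w (s i * \<xi> $ l))" by (rule sum.swap)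
    also have "\<dots> = (\<Sum>i=1..n. \<Sum>l\<in>UNIV. a i $ k $ l * (cf (i # w) (\<xi> $ l) + creat i (\<lambda>w. cf w (\<xi> $ l)) w))"
      by (intro sum.cong refl) (simp only: cs)
    also have "\<dots> = fock_op a n (\<lambda>w. cfv w \<xi>) w $ k"
      by (simp add: fock_op_def ann_def matrix_vector_mult_def cr sum.distrib distrib_left)
        (simp add: cfv_def)
    finally show ?thesis .
  qed
  then show ?thesis by (simp add: vec_eq_iff)
qed

lemma polys_semicircular_mult:
  assumes "\<And>l. \<xi> $ l \<in> polys"
  shows "((\<Sum>i=1..n. a i \<otimes>\<^sub>M s i) *v \<xi>) $ k \<in> polys"
proof -
  have "((\<Sum>i=1..n. a i \<otimes>\<^sub>M s i) *v \<xi>) $ k = (\<Sum>l\<in>UNIV. \<Sum>i=1..n. a i $ k $ l *\<^sub>C (s i * \<xi> $ l))"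
    by (simp add: matrix_vector_mult_def mat_tensor_def sum_distrib_right mult_scaleC_left)
  also have "\<dots> \<in> polys" by (intro polys_sum polys.scale polys_s assms)
  finally show ?thesis .
qed

end


section \<open>Proof of the formulas\<close>

lemma inverse_unique:
  assumes "C ** A = mat 1" "A ** B = mat 1"
  shows "C = (B :: 'a::semiring_1 ^ 'd ^ 'd)"
  by (metis assms matrix_mul_assoc matrix_mul_lid matrix_mul_rid)

lemma matrix_inv_eqI:
  assumes "A ** B = mat 1" "B ** A = mat 1"
  shows "matrix_inv A = (B :: 'a::semiring_1 ^ 'd ^ 'd)"
proof -
  have "\<exists>B. A ** B = mat 1 \<and> B ** A = mat 1" using assms by blast
  then have "A ** matrix_inv A = mat 1 \<and> matrix_inv A ** A = mat 1"
    unfolding matrix_inv_def by (rule someI_ex)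
  then show ?thesis using inverse_unique assms by blast
qed

lemma selfadj_inverse:
  fixes A B :: "'a::cstar_algebra ^ 'd ^ 'd"
  assumes "mat_star A = A" "A ** B = mat 1"
  shows "mat_star B = B"
  using inverse_unique[of "mat_star B" A B] assms mat_star_mult[of A B] by simp

lemma positive_definite_iff:
  "positive_definite A \<longleftrightarrow> mat_star A = A \<and> (\<forall>v. v \<noteq> 0 \<longrightarrow> 0 < cx.rip v (A *v v))"
  by (simp add: positive_definite_def cx.rip_def cx.tip_def star_complex_def)

lemma positive_definite_form_ge_0: "positive_definite A \<Longrightarrow> 0 \<le> cx.rip v (A *v v)"
  by (cases "v = 0") (auto simp: positive_definite_iff less_imp_le)

lemma positive_definite_inverse:
  assumes "positive_definite A"
  shows "A ** matrix_inv A = mat 1" "matrix_inv A ** A = mat 1" "mat_star (matrix_inv A) = matrix_inv A"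
proof -
  have "inj ((*v) A)"
  proof (rule injI)
    fix u v assume "A *v u = A *v v"
    then have "cx.rip (u - v) (A *v (u - v)) = 0" by (simp add: matrix_vector_mult_diff_distrib)
    then have "u - v = 0" using assms unfolding positive_definite_iff by (metis less_irrefl)
    then show "u = v" by simp
  qed
  then obtain B where B: "B ** A = mat 1" using matrix_left_invertible_injective by blast
  then have "A ** B = mat 1" by (simp add: matrix_left_right_inverse)
  then show "A ** matrix_inv A = mat 1" "matrix_inv A ** A = mat 1" "mat_star (matrix_inv A) = matrix_inv A"
    using B matrix_inv_eqI[of A B] selfadj_inverse[of A B] assms by (auto simp: positive_definite_iff)
qed

lemma form_conj_sum:
  "cx.rip v ((\<Sum>j\<in>S. mat_star (a j) ** z ** a j) *v v) = (\<Sum>j\<in>S. cx.rip (a j *v v) (z *v (a j *v v)))"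
  by (simp add: matrix_vector_mult_sum_left cx.rip_sum_right cx.rip_adjoint[of v "mat_star _"]
      flip: matrix_vector_mul_assoc)

lemma selfadj_conj_sum:
  assumes "mat_star z = z"
  shows "mat_star (\<Sum>j\<in>S. mat_star (a j) ** z ** a j) = (\<Sum>j\<in>S. mat_star (a j) ** z ** a j)"
    and "mat_star (\<Sum>j\<in>S. b j ** z ** mat_star (b j)) = (\<Sum>j\<in>S. b j ** z ** mat_star (b j))"
  by (simp_all add: mat_star_sum mat_star_mult assms matrix_mul_assoc)

lemma mat_star_scaled_id: "mat_star (t *\<^sub>R mat 1) = t *\<^sub>R mat 1"
  by (simp add: mat_star_scaleR)

locale semicircular_matrix = free_family \<tau> s n
  for \<tau> :: "'a::cstar_algebra \<Rightarrow> complex" and s :: "nat \<Rightarrow> 'a" and n :: nat +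
  fixes a :: "nat \<Rightarrow> complex ^ 'm ^ 'd" and x :: "'a ^ 'm ^ 'd"
  assumes x_def: "x = (\<Sum>i=1..n. a i \<otimes>\<^sub>M s i)"
begin

lemma mat_star_x: "mat_star x = (\<Sum>i=1..n. mat_star (a i) \<otimes>\<^sub>M s i)"
  unfolding x_def mat_star_sum mat_star_tensor by (intro sum.cong refl) (simp add: s_star)

lemma cfv_x: "cfv w (x *v \<xi>) = fock_op a n (\<lambda>w. cfv w \<xi>) w"
  and cfv_star_x: "cfv w (mat_star x *v \<zeta>) = fock_op (\<lambda>i. mat_star (a i)) n (\<lambda>w. cfv w \<zeta>) w"
  unfolding mat_star_x unfolding x_def by (rule cfv_semicircular_mult)+

text \<open>The subspace to which \<open>form_ge_0_from_subspace\<close> is applied.\<close>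

definition poly_vecs :: "('a ^ 'k) set" where "poly_vecs = {\<xi>. \<forall>k. \<xi> $ k \<in> polys}"

lemma poly_vecs_gram: "\<xi> \<in> poly_vecs \<Longrightarrow> x ** mat_star x *v \<xi> \<in> poly_vecs"
  and poly_vecs_star: "\<xi> \<in> poly_vecs \<Longrightarrow> mat_star x *v \<xi> \<in> poly_vecs"
  unfolding matrix_vector_mul_assoc[symmetric] mat_star_x unfolding x_def
  by (auto simp only: poly_vecs_def mem_Collect_eq intro!: polys_semicircular_mult)

lemma poly_vecs_diff: "\<xi> \<in> poly_vecs \<Longrightarrow> \<eta> \<in> poly_vecs \<Longrightarrow> \<xi> - r *\<^sub>R \<eta> \<in> poly_vecs"
proof -
  have "u - r *\<^sub>R v \<in> polys" if "u \<in> polys" "v \<in> polys" for u v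
    using polys.add[OF that(1) polys.scale[OF that(2), of "complex_of_real (- r)"]]
    by (simp only: scaleC_of_real) simp
  then show "\<xi> \<in> poly_vecs \<Longrightarrow> \<eta> \<in> poly_vecs \<Longrightarrow> \<xi> - r *\<^sub>R \<eta> \<in> poly_vecs"
    by (simp add: poly_vecs_def)
qed

lemma poly_vecs_axis: "axis k 1 \<in> poly_vecs"
  by (simp add: poly_vecs_def axis_def polys_one polys_zero)

lemma poly_vecs_scaleR: "\<xi> \<in> poly_vecs \<Longrightarrow> r *\<^sub>R \<xi> \<in> poly_vecs"
  using poly_vecs_diff[of \<xi> \<xi> "1 - r"] by (simp add: scaleR_diff_left)

lemma ip_gram:
  assumes "\<xi> \<in> poly_vecs"
  defines "f \<equiv> (\<lambda>w. cfv w \<xi>)"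
  shows "rip \<xi> (x ** mat_star x *v \<xi>) = ip (fock_op (\<lambda>i. mat_star (a i)) n f) (fock_op (\<lambda>i. mat_star (a i)) n f)"
    and "rip \<xi> \<xi> = ip f f"
proof -
  have "mat_star x *v \<xi> \<in> poly_vecs" by (rule poly_vecs_star[OF assms(1)])
  then have "rip (mat_star x *v \<xi>) (mat_star x *v \<xi>) =
      ip (\<lambda>w. cfv w (mat_star x *v \<xi>)) (\<lambda>w. cfv w (mat_star x *v \<xi>))"
    by (intro ip_cfv[symmetric]) (simp add: poly_vecs_def)
  then show "rip \<xi> (x ** mat_star x *v \<xi>) =
      ip (fock_op (\<lambda>i. mat_star (a i)) n f) (fock_op (\<lambda>i. mat_star (a i)) n f)"
    unfolding gram_form cfv_star_x f_def .
  show "rip \<xi> \<xi> = ip f f"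
    unfolding f_def using assms(1) by (intro ip_cfv[symmetric]) (simp add: poly_vecs_def)
qed

lemma lambda_max_gram_le:
  assumes "\<And>f. l2 f \<Longrightarrow> ip (fock_op (\<lambda>i. mat_star (a i)) n f) (fock_op (\<lambda>i. mat_star (a i)) n f) \<le> L * ip f f"
  shows "lambda_max (x ** mat_star x) \<le> L"
proof -
  define c where "c = L *\<^sub>R mat 1 - x ** mat_star x"
  have form: "rip \<xi> (c *v \<xi>) = L * rip \<xi> \<xi> - rip \<xi> (x ** mat_star x *v \<xi>)" for \<xi>
    by (simp add: c_def matrix_vector_mult_diff_rdistrib rip_diff_right matrix_vector_scaleR_left rip_scaleR_right)
  have "form_ge c 0"
  proof (rule form_ge_0_from_subspace[where V=poly_vecs])
    show "mat_star c = c" by (simp add: c_def mat_star_diff mat_star_scaled_id gram_selfadj)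
    show "c *v \<xi> \<in> poly_vecs" if "\<xi> \<in> poly_vecs" for \<xi>
      using poly_vecs_diff[OF poly_vecs_scaleR[OF that, of L] poly_vecs_gram[OF that], of 1]
      by (simp add: c_def matrix_vector_mult_diff_rdistrib matrix_vector_scaleR_left)
    show "0 \<le> rip \<xi> (c *v \<xi>)" if "\<xi> \<in> poly_vecs" for \<xi>
      unfolding form ip_gram[OF that] using assms[OF l2_cfv] by simp
  qed (simp_all add: poly_vecs_axis poly_vecs_diff)
  then show ?thesis
    unfolding lambda_max_le_iff[OF gram_selfadj] form_ge_0 form by simp
qed

lemma lambda_min_gram_ge:
  assumes "\<And>f. l2 f \<Longrightarrow> L * ip f f \<le> ip (fock_op (\<lambda>i. mat_star (a i)) n f) (fock_op (\<lambda>i. mat_star (a i)) n f)"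
  shows "L \<le> lambda_min (x ** mat_star x)"
proof -
  define c where "c = x ** mat_star x - L *\<^sub>R mat 1"
  have "form_ge c 0"
  proof (rule form_ge_0_from_subspace[where V=poly_vecs])
    show "mat_star c = c" by (simp add: c_def mat_star_diff mat_star_scaled_id gram_selfadj)
    show "c *v \<xi> \<in> poly_vecs" if "\<xi> \<in> poly_vecs" for \<xi>
      using poly_vecs_diff[OF poly_vecs_gram[OF that] that, of L]
      by (simp add: c_def matrix_vector_mult_diff_rdistrib matrix_vector_scaleR_left)
    show "0 \<le> rip \<xi> (c *v \<xi>)" if "\<xi> \<in> poly_vecs" for \<xi>
      unfolding c_def rip_shift ip_gram[OF that] using assms[OF l2_cfv] by simp
  qed (simp_all add: poly_vecs_axis poly_vecs_diff)
  then show ?thesis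
    unfolding le_lambda_min_iff[OF gram_selfadj] form_ge_0 by (simp add: c_def rip_shift form_ge_def)
qed

lemma solves_if_block_equation:
  assumes "t *\<^sub>R \<xi> - x *v \<zeta> = emb p" "\<zeta> - mat_star x *v \<xi> = emb q"
  shows "solves t 1 a n (\<lambda>w. cfv w \<xi>) (\<lambda>w. cfv w \<zeta>) p q"
proof -
  have "t *\<^sub>R cfv w \<xi> - fock_op a n (\<lambda>w. cfv w \<zeta>) w = (if w = [] then p else 0)" for w
    using arg_cong[OF assms(1), of "cfv w"] by (simp add: cfv_diff cfv_scaleR cfv_x cfv_emb)
  moreover have "cfv w \<zeta> - fock_op (\<lambda>i. mat_star (a i)) n (\<lambda>w. cfv w \<xi>) w = (if w = [] then q else 0)" for w
    using arg_cong[OF assms(2), of "cfv w"] by (simp add: cfv_diff cfv_star_x cfv_emb)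
  ultimately show ?thesis by (simp add: solves_def l2_cfv)
qed

text \<open>\<open>R\<close> and \<open>mat 1 + mat_star x ** R ** x\<close> are the diagonal blocks
  of the inverse of the block operator; \<open>f1, g1\<close> and \<open>f2, g2\<close> are the two
  block columns of this inverse, applied to scalar columns.\<close>

lemma resolvent_equations:
  assumes R: "(t *\<^sub>R mat 1 - x ** mat_star x) ** R = mat 1"
  defines "P \<equiv> expect R" and "Q \<equiv> expect (mat 1 + mat_star x ** R ** x)"
  shows "mat_star P = P" "mat_star Q = Q"
    and "P ** (t *\<^sub>R mat 1 - (\<Sum>i=1..n. a i ** Q ** mat_star (a i))) ** P = P"
    and "Q ** (mat 1 - (\<Sum>i=1..n. mat_star (a i) ** P ** a i)) ** Q = Q"
    and "cx.rip v (P *v v) = rip (emb v) (R *v emb v)"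
    and "cx.rip u (Q *v u) = rip (emb u) (emb u) + rip (x *v emb u) (R *v (x *v emb u))"
proof -
  have As: "mat_star (t *\<^sub>R mat 1 - x ** mat_star x) = t *\<^sub>R mat 1 - x ** mat_star x"
    by (simp add: mat_star_diff mat_star_scaled_id gram_selfadj)
  have Rs: "mat_star R = R" by (rule selfadj_inverse[OF As R])
  then show Ps: "mat_star P = P" by (simp add: P_def mat_star_expect)
  show Qs: "mat_star Q = Q"
    by (simp add: Q_def mat_star_expect mat_star_add mat_star_mult Rs matrix_mul_assoc)
  show "cx.rip v (P *v v) = rip (emb v) (R *v emb v)"
    by (simp add: P_def expect_mult rip_emb)
  have Qu: "Q *v u = cfv [] (emb u + mat_star x *v (R *v (x *v emb u)))" for u
    by (simp add: Q_def expect_mult matrix_vector_mult_add_rdistrib matrix_vector_mul_assoc matrix_mul_assoc)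
  show "cx.rip u (Q *v u) = rip (emb u) (emb u) + rip (x *v emb u) (R *v (x *v emb u))"
    by (simp add: Qu rip_add_right rip_adjoint[of "emb u" "mat_star x"] flip: rip_emb)
  have res: "t *\<^sub>R (R *v \<xi>) - x *v (mat_star x *v (R *v \<xi>)) = \<xi>" for \<xi>
  proof -
    have "(t *\<^sub>R mat 1 - x ** mat_star x) *v (R *v \<xi>) = \<xi>" by (simp add: matrix_vector_mul_assoc R)
    then show ?thesis
      by (simp add: matrix_vector_mult_diff_rdistrib matrix_vector_scaleR_left
          flip: matrix_vector_mul_assoc)
  qed
  define f1 g1 where "f1 v = R *v emb v" and "g1 v = mat_star x *v f1 v" for v
  define f2 g2 where "f2 u = R *v (x *v emb u)" and "g2 u = emb u + mat_star x *v f2 u" for u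
  have s1: "solves t 1 a n (\<lambda>w. cfv w (f1 v)) (\<lambda>w. cfv w (g1 v)) v 0" for v
    by (rule solves_if_block_equation) (simp_all add: f1_def g1_def res emb_eq_0)
  have s2: "solves t 1 a n (\<lambda>w. cfv w (f2 u)) (\<lambda>w. cfv w (g2 u)) 0 u" for u
  proof (rule solves_if_block_equation)
    have "emb (0 :: complex ^ 'd) = (0 :: 'a ^ 'd)" by (simp add: emb_eq_0)
    then show "t *\<^sub>R f2 u - x *v g2 u = emb 0"
      using res[of "x *v emb u"] by (simp add: f2_def g2_def matrix_vector_right_distrib algebra_simps)
  qed (simp add: g2_def)
  \<comment> \<open>Parity parts solve the same equations, keep the diagonal vacuum values and make
    the off-diagonal ones vanish, as \<open>dyson_equation\<close> asks.\<close>
  define F1 G1 where "F1 v = parity_part True (\<lambda>w. cfv w (f1 v))"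
    and "G1 v = parity_part False (\<lambda>w. cfv w (g1 v))" for v
  define F2 G2 where "F2 u = parity_part False (\<lambda>w. cfv w (f2 u))"
    and "G2 u = parity_part True (\<lambda>w. cfv w (g2 u))" for u
  have S1: "solves t 1 a n (F1 v) (G1 v) v 0" for v
    using solves_parity_part[OF s1, of True] by (simp add: F1_def G1_def)
  have S2: "solves t 1 a n (F2 u) (G2 u) 0 u" for u
    using solves_parity_part[OF s2, of False] by (simp add: F2_def G2_def)
  have vac: "F1 v [] = P *v v" "G1 v [] = 0" "F2 u [] = 0" "G2 u [] = Q *v u" for u v
    by (simp_all add: F1_def G1_def F2_def G2_def parity_part_def f1_def g1_def f2_def g2_def
        P_def expect_mult Qu)
  show "P ** (t *\<^sub>R mat 1 - (\<Sum>i=1..n. a i ** Q ** mat_star (a i))) ** P = P"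
  proof (rule cx.matrix_eqI_rip)
    fix u v
    have "cx.rip (P *v u) (t *\<^sub>R (P *v v) - (\<Sum>i=1..n. a i *v (Q *v (mat_star (a i) *v (P *v v))))) =
        cx.rip u (P *v v)"
      by (rule dyson_equation[OF S1 vac(1) S2 vac(3,4)])
    then show "cx.rip u ((P ** (t *\<^sub>R mat 1 - (\<Sum>i=1..n. a i ** Q ** mat_star (a i))) ** P) *v v) =
        cx.rip u (P *v v)"
      unfolding cx.rip_selfadj[OF Ps, symmetric]
      by (simp add: matrix_vector_mult_diff_rdistrib matrix_vector_scaleR_left matrix_vector_mult_sum_left
          flip: matrix_vector_mul_assoc)
  qed
  \<comment> \<open>The second Dyson equation is the first one for the swapped system.\<close>
  have S1': "solves 1 t (\<lambda>i. mat_star (a i)) n (G2 u) (F2 u) u 0" for u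
    using S2 by (simp add: solves_swap)
  have S2': "solves 1 t (\<lambda>i. mat_star (a i)) n (G1 v) (F1 v) 0 v" for v
    using S1 by (simp add: solves_swap)
  show "Q ** (mat 1 - (\<Sum>i=1..n. mat_star (a i) ** P ** a i)) ** Q = Q"
  proof (rule cx.matrix_eqI_rip)
    fix u v
    have "cx.rip (Q *v u) (1 *\<^sub>R (Q *v v) -
        (\<Sum>i=1..n. mat_star (a i) *v (P *v (mat_star (mat_star (a i)) *v (Q *v v))))) = cx.rip u (Q *v v)"
      by (rule dyson_equation[OF S1' vac(4) S2' vac(2,1)])
    then show "cx.rip u ((Q ** (mat 1 - (\<Sum>i=1..n. mat_star (a i) ** P ** a i)) ** Q) *v v) = cx.rip u (Q *v v)"
      unfolding cx.rip_selfadj[OF Qs, symmetric]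
      by (simp add: matrix_vector_mult_diff_rdistrib matrix_vector_mult_sum_left
          flip: matrix_vector_mul_assoc)
  qed
qed

section \<open>The variational function, its bounds and its optimizers\<close>

definition gap :: "complex ^ 'd ^ 'd \<Rightarrow> complex ^ 'm ^ 'm" where
  "gap z = mat 1 - (\<Sum>j=1..n. mat_star (a j) ** z ** a j)"

definition lehner :: "complex ^ 'd ^ 'd \<Rightarrow> complex ^ 'd ^ 'd" where
  "lehner z = matrix_inv z + (\<Sum>i=1..n. a i ** matrix_inv (gap z) ** mat_star (a i))"

lemma gap_selfadj: "mat_star z = z \<Longrightarrow> mat_star (gap z) = gap z"
  by (simp add: gap_def mat_star_diff selfadj_conj_sum(1))

lemma gap_form: "cx.rip v (gap z *v v) = cx.rip v v - (\<Sum>j=1..n. cx.rip (a j *v v) (z *v (a j *v v)))"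
  by (simp add: gap_def matrix_vector_mult_diff_rdistrib cx.rip_diff_right form_conj_sum)

lemma lehner_selfadj:
  assumes "mat_star (matrix_inv z) = matrix_inv z" "mat_star (matrix_inv (gap z)) = matrix_inv (gap z)"
  shows "mat_star (lehner z) = lehner z"
  using assms by (simp add: lehner_def mat_star_add selfadj_conj_sum(2))

lemma lambda_max_gram_le_lehner:
  assumes z: "positive_definite z" and W: "positive_definite (gap z)"
  shows "lambda_max (x ** mat_star x) \<le> lambda_max (lehner z)"
proof (rule lambda_max_gram_le)
  fix f :: "nat list \<Rightarrow> complex ^ 'd" assume f: "l2 f"
  note zi = positive_definite_inverse[OF z] and Wi = positive_definite_inverse[OF W]
  have L: "cx.rip v ((matrix_inv z + (\<Sum>i=1..n. a i ** matrix_inv (gap z) ** mat_star (a i))) *v v)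
      \<le> lambda_max (lehner z) * cx.rip v v" for v
    unfolding lehner_def[symmetric]
    using cx.lambda_max_le_iff[OF lehner_selfadj[OF zi(3) Wi(3)], of "lambda_max (lehner z)"] by blast
  show "ip (fock_op (\<lambda>i. mat_star (a i)) n f) (fock_op (\<lambda>i. mat_star (a i)) n f) \<le> lambda_max (lehner z) * ip f f"
  proof (rule fock_upper_bound[OF f _ _ zi(1) gap_def _ Wi(1) L])
    show "mat_star z = z" using z by (simp add: positive_definite_iff)
  qed (intro positive_definite_form_ge_0 z W)+
qed

text \<open>The reason why the formula for the smallest singular value has no second
  constraint.\<close>

lemma gap_positive:
  assumes "positive_definite (- z)"
  shows "positive_definite (gap z)"
proof -
  have z: "mat_star z = z" using assms by (simp add: positive_definite_iff mat_star_minus)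
  have neg: "cx.rip v (z *v v) \<le> 0" for v
    using positive_definite_form_ge_0[OF assms, of v] matrix_vector_scaleR_left[of "-1" z v]
    by (simp add: cx.rip_minus_right)
  have "0 < cx.rip v (gap z *v v)" if "v \<noteq> 0" for v
    unfolding gap_form using cx.rip_self_pos[OF that] neg
    by (smt (verit) sum_nonpos)
  then show ?thesis using gap_selfadj[OF z] by (simp add: positive_definite_iff)
qed

lemma negative_definite_inverse:
  assumes "positive_definite (- z)"
  shows "z ** matrix_inv z = mat 1" "mat_star (matrix_inv z) = matrix_inv z"
proof -
  have z: "mat_star z = z" using assms by (simp add: positive_definite_iff mat_star_minus)
  have "z ** (- matrix_inv (- z)) = mat 1" "(- matrix_inv (- z)) ** z = mat 1"
    using positive_definite_inverse(1,2)[OF assms]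
    by (simp_all add: matrix_mult_minus_left matrix_mult_minus_right)
  then show "z ** matrix_inv z = mat 1" using matrix_inv_eqI[of z] by metis
  then show "mat_star (matrix_inv z) = matrix_inv z" by (rule selfadj_inverse[OF z])
qed

lemma lehner_le_lambda_min_gram:
  assumes z: "positive_definite (- z)"
  shows "lambda_min (lehner z) \<le> lambda_min (x ** mat_star x)"
proof (rule lambda_min_gram_ge)
  fix f :: "nat list \<Rightarrow> complex ^ 'd" assume f: "l2 f"
  note zi = negative_definite_inverse[OF z] and Wi = positive_definite_inverse[OF gap_positive[OF z]]
  have "cx.form_ge (lehner z) (lambda_min (lehner z))"
    by (rule cx.form_ge_lambda_min[OF lehner_selfadj[OF zi(2) Wi(3)]])
  then have L: "lambda_min (lehner z) * cx.rip v v \<le>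
      cx.rip v (((\<Sum>i=1..n. a i ** matrix_inv (gap z) ** mat_star (a i)) - (- matrix_inv z)) *v v)" for v
    unfolding cx.form_ge_def lehner_def by (simp add: add.commute)
  have W: "gap z = mat 1 + (\<Sum>j=1..n. mat_star (a j) ** (- z) ** a j)"
    by (simp add: gap_def matrix_mult_minus_left matrix_mult_minus_right sum_negf)
  show "lambda_min (lehner z) * ip f f \<le> ip (fock_op (\<lambda>i. mat_star (a i)) n f) (fock_op (\<lambda>i. mat_star (a i)) n f)"
  proof (rule fock_lower_bound[OF f _ _ _ W Wi(1) L])
    show "mat_star (- z) = - z" using z by (simp add: positive_definite_iff)
    show "0 \<le> cx.rip p (- z *v p)" for p by (rule positive_definite_form_ge_0[OF z])
    show "- z ** - matrix_inv z = mat 1" using zi(1) by (simp add: matrix_mult_minus_left matrix_mult_minus_right)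
  qed
qed

text \<open>Take z = P = E[R]. As R is positive, so are P and Q; both Dyson equations can be
  cancelled, and \<open>lehner P\<close> is exactly t times the identity.\<close>

lemma lehner_attains_max:
  assumes t: "lambda_max (x ** mat_star x) < t"
  shows "\<exists>z. positive_definite z \<and> positive_definite (gap z) \<and> lambda_max (lehner z) \<le> t"
proof -
  define A where "A = t *\<^sub>R mat 1 - x ** mat_star x"
  have "invertible A"
    unfolding A_def using invertible_outside_spectral_interval[OF gram_selfadj] t by blast
  then obtain R where R: "A ** R = mat 1" "R ** A = mat 1" unfolding invertible_def by blast
  have Apos: "0 < rip \<xi> (A *v \<xi>)" if "\<xi> \<noteq> 0" for \<xi>
  proof -
    have "rip \<xi> (x ** mat_star x *v \<xi>) \<le> lambda_max (x ** mat_star x) * rip \<xi> \<xi>"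
      using lambda_max_le_iff[OF gram_selfadj] by blast
    also have "\<dots> < t * rip \<xi> \<xi>" using t rip_self_pos[OF that] by simp
    finally show ?thesis
      by (simp add: A_def matrix_vector_mult_diff_rdistrib rip_diff_right matrix_vector_scaleR_left rip_scaleR_right)
  qed
  have AR: "A *v (R *v \<xi>) = \<xi>" for \<xi> by (simp add: matrix_vector_mul_assoc R)
  have Rpos: "0 < rip \<xi> (R *v \<xi>)" if "\<xi> \<noteq> 0" for \<xi>
  proof -
    have "R *v \<xi> \<noteq> 0" using AR[of \<xi>] that by auto
    from Apos[OF this] show ?thesis by (simp add: AR rip_commute)
  qed
  define P Q where "P = expect R" and "Q = expect (mat 1 + mat_star x ** R ** x)"
  note eqs = resolvent_equations[OF R(1)[unfolded A_def], folded P_def Q_def]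
  have P: "positive_definite P"
    unfolding positive_definite_iff eqs(5) using eqs(1) Rpos by (simp add: emb_eq_0)
  have Q: "positive_definite Q"
    unfolding positive_definite_iff
  proof (intro conjI allI impI)
    fix u :: "complex ^ 'm" assume "u \<noteq> 0"
    then have "0 < rip (emb u :: 'a ^ 'm) (emb u)" by (intro rip_self_pos) (simp add: emb_eq_0)
    moreover have "0 \<le> rip (x *v emb u) (R *v (x *v emb u))"
      using Rpos[of "x *v emb u"] by (cases "x *v emb u = 0") auto
    ultimately show "0 < cx.rip u (Q *v u)" unfolding eqs(6) by linarith
  qed (rule eqs(2))
  note Pi = positive_definite_inverse[OF P] and Qi = positive_definite_inverse[OF Q]
  define S where "S = t *\<^sub>R mat 1 - (\<Sum>i=1..n. a i ** Q ** mat_star (a i))"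
  have PSP: "P ** S ** P = P" unfolding S_def by (rule eqs(3))
  have QWQ: "Q ** gap P ** Q = Q" unfolding gap_def by (rule eqs(4))
  have "P ** S = mat 1" using arg_cong[OF PSP, of "\<lambda>X. X ** matrix_inv P"] Pi(1)
    by (simp flip: matrix_mul_assoc)
  moreover have "S ** P = mat 1" using arg_cong[OF PSP, of "\<lambda>X. matrix_inv P ** X"] Pi(2)
    by (simp add: matrix_mul_assoc)
  ultimately have invP: "matrix_inv P = S" by (rule matrix_inv_eqI)
  have QW: "Q ** gap P = mat 1" using arg_cong[OF QWQ, of "\<lambda>X. X ** matrix_inv Q"] Qi(1)
    by (simp flip: matrix_mul_assoc)
  have WQ: "gap P ** Q = mat 1" using arg_cong[OF QWQ, of "\<lambda>X. matrix_inv Q ** X"] Qi(2)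
    by (simp add: matrix_mul_assoc)
  have invW: "matrix_inv (gap P) = Q" by (rule matrix_inv_eqI[OF WQ QW])
  \<comment> \<open>Admissibility: the inverse \<open>Q\<close> of \<open>gap P\<close> is positive
    definite.\<close>
  have "positive_definite (gap P)"
    unfolding positive_definite_iff
  proof (intro conjI allI impI)
    fix v :: "complex ^ 'm" assume "v \<noteq> 0"
    have "Q *v (gap P *v v) = v" by (simp only: matrix_vector_mul_assoc QW matrix_vector_mul_lid)
    moreover from this have "gap P *v v \<noteq> 0" using \<open>v \<noteq> 0\<close> by (metis matrix_vector_mult_0_right)
    ultimately show "0 < cx.rip v (gap P *v v)"
      using Q unfolding positive_definite_iff by (metis cx.rip_commute)
  qed (rule gap_selfadj[OF eqs(1)])
  moreover have "lehner P = t *\<^sub>R mat 1" unfolding lehner_def invP invW S_def by simp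
  then have "lambda_max (lehner P) \<le> t"
    by (simp add: cx.lambda_max_le_iff mat_star_scaled_id matrix_vector_scaleR_left cx.rip_scaleR_right)
  ultimately show ?thesis using P by blast
qed

text \<open>P is negative definite, so the first Dyson equation can be cancelled and the gap is
  positive, but Q need not be invertible. The defect D of Q from the inverse gap is nonnegative and
  can only raise \<open>lehner P\<close> above t.\<close>

lemma lehner_attains_min:
  assumes t: "t < lambda_min (x ** mat_star x)"
  shows "\<exists>z. positive_definite (- z) \<and> t \<le> lambda_min (lehner z)"
proof -
  define A where "A = t *\<^sub>R mat 1 - x ** mat_star x"
  have "invertible A"
    unfolding A_def using invertible_outside_spectral_interval[OF gram_selfadj] t by blast
  then obtain R where R: "A ** R = mat 1" "R ** A = mat 1" unfolding invertible_def by blast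
  have Aneg: "rip \<xi> (A *v \<xi>) < 0" if "\<xi> \<noteq> 0" for \<xi>
  proof -
    have "t * rip \<xi> \<xi> < lambda_min (x ** mat_star x) * rip \<xi> \<xi>" using t rip_self_pos[OF that] by simp
    also have "\<dots> \<le> rip \<xi> (x ** mat_star x *v \<xi>)"
      by (rule form_geD[OF form_ge_lambda_min[OF gram_selfadj]])
    finally show ?thesis
      by (simp add: A_def matrix_vector_mult_diff_rdistrib rip_diff_right matrix_vector_scaleR_left rip_scaleR_right)
  qed
  have AR: "A *v (R *v \<xi>) = \<xi>" for \<xi> by (simp add: matrix_vector_mul_assoc R)
  have Rneg: "rip \<xi> (R *v \<xi>) < 0" if "\<xi> \<noteq> 0" for \<xi>
  proof -
    have "R *v \<xi> \<noteq> 0" using AR[of \<xi>] that by auto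
    from Aneg[OF this] show ?thesis by (simp add: AR rip_commute)
  qed
  define P Q where "P = expect R" and "Q = expect (mat 1 + mat_star x ** R ** x)"
  note eqs = resolvent_equations[OF R(1)[unfolded A_def], folded P_def Q_def]
  have P: "positive_definite (- P)"
    unfolding positive_definite_iff
  proof (intro conjI allI impI)
    fix v :: "complex ^ 'd" assume "v \<noteq> 0"
    then show "0 < cx.rip v (- P *v v)"
      using Rneg[of "emb v"] eqs(5)[of v] matrix_vector_scaleR_left[of "-1" P v]
      by (simp add: emb_eq_0 cx.rip_minus_right)
  qed (simp add: mat_star_minus eqs(1))
  note Pi = negative_definite_inverse[OF P] and W = gap_positive[OF P]
  note Wi = positive_definite_inverse[OF W]
  define S where "S = t *\<^sub>R mat 1 - (\<Sum>i=1..n. a i ** Q ** mat_star (a i))"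
  have PSP: "P ** S ** P = P" unfolding S_def by (rule eqs(3))
  have PS: "P ** S = mat 1" using arg_cong[OF PSP, of "\<lambda>X. X ** matrix_inv P"] Pi(1)
    by (simp flip: matrix_mul_assoc)
  then have "S ** P = mat 1" by (simp add: matrix_left_right_inverse)
  with PS have invP: "matrix_inv P = S" by (rule matrix_inv_eqI)
  define D where "D = matrix_inv (gap P) - Q"
  \<comment> \<open>With this the form of D at p is the gap form at D p, which is
    nonnegative.\<close>
  have "D ** gap P ** D = D"
  proof -
    have "D ** gap P = mat 1 - Q ** gap P" by (simp only: D_def matrix_diff_rdistrib Wi(2))
    then have "D ** gap P ** D = D - Q ** (gap P ** D)"
      by (simp only: matrix_diff_rdistrib matrix_mul_lid matrix_mul_assoc)
    also have "Q ** (gap P ** D) = Q - Q ** gap P ** Q"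
      by (simp only: D_def matrix_diff_ldistrib Wi(1) matrix_mul_rid matrix_mul_assoc[of Q "gap P"])
    finally show ?thesis using eqs(4)[folded gap_def] by simp
  qed
  moreover have Ds: "mat_star D = D" by (simp only: D_def mat_star_diff Wi(3) eqs(2))
  ultimately have Dpos: "0 \<le> cx.rip p (D *v p)" for p
    using positive_definite_form_ge_0[OF W, of "D *v p"] cx.rip_selfadj[OF Ds, of p "gap P *v (D *v p)"]
    by (metis matrix_vector_mul_assoc)
  have "lehner P = t *\<^sub>R mat 1 + (\<Sum>i=1..n. a i ** D ** mat_star (a i))"
    unfolding lehner_def invP S_def D_def by (simp add: matrix_diff_ldistrib matrix_diff_rdistrib sum_subtractf)
  then have "cx.rip v (lehner P *v v) = t * cx.rip v v +
      (\<Sum>i=1..n. cx.rip (mat_star (a i) *v v) (D *v (mat_star (a i) *v v)))" for v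
    using form_conj_sum[of v "\<lambda>i. mat_star (a i)" D "{1..n}"]
    by (simp add: matrix_vector_mult_add_rdistrib cx.rip_add_right matrix_vector_scaleR_left cx.rip_scaleR_right)
  then have "cx.form_ge (lehner P) t" by (simp add: cx.form_ge_def sum_nonneg Dpos)
  then have "t \<le> lambda_min (lehner P)"
    using cx.le_lambda_min_iff[OF lehner_selfadj[OF Pi(2) Wi(3)]] by blast
  then show ?thesis using P by blast
qed

end

text \<open>In \<open>ereal\<close> the infimum and supremum are meaningful without separate proofs
  of nonemptiness and boundedness.\<close>

theorem corollary1p3:
  fixes \<tau> :: "'a::cstar_algebra \<Rightarrow> complex"
    and s :: "nat \<Rightarrow> 'a"
    and n :: nat
    and a :: "nat \<Rightarrow> complex ^ 'm ^ 'd"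
    and x :: "'a ^ 'm ^ 'd"
  assumes "faithful_tracial_state \<tau>"
    and "free_semicircular_family \<tau> {1..n} s"
    and "x = (\<Sum>i=1..n. a i \<otimes>\<^sub>M s i)"
  shows "(ereal ((s_max x)\<^sup>2) =
           (INF z \<in> {z. positive_definite z \<and>
                        positive_definite (mat 1 - (\<Sum>j=1..n. mat_star (a j) ** z ** a j))}.
              ereal (lambda_max (matrix_inv z +
                (\<Sum>i=1..n. a i ** matrix_inv (mat 1 - (\<Sum>j=1..n. mat_star (a j) ** z ** a j))
                            ** mat_star (a i)))))) \<and>
         (ereal ((s_min x)\<^sup>2) =
           (SUP z \<in> {z. positive_definite (- z)}.
              ereal (lambda_min (matrix_inv z +
                (\<Sum>i=1..n. a i ** matrix_inv (mat 1 - (\<Sum>j=1..n. mat_star (a j) ** z ** a j))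
                            ** mat_star (a i))))))"
proof -
  interpret semicircular_matrix \<tau> s n a x
    using assms by unfold_locales
  show ?thesis
    unfolding s_max_square s_min_square gap_def[symmetric] lehner_def[symmetric]
  proof (intro conjI antisym)
    show "ereal (lambda_max (x ** mat_star x)) \<le>
        (INF z \<in> {z. positive_definite z \<and> positive_definite (gap z)}. ereal (lambda_max (lehner z)))"
      by (rule INF_greatest) (simp add: lambda_max_gram_le_lehner)
    show "(INF z \<in> {z. positive_definite z \<and> positive_definite (gap z)}. ereal (lambda_max (lehner z)))
        \<le> ereal (lambda_max (x ** mat_star x))"
    \<comment> \<open>The optimizer is constructed only for t strictly above the spectrum, so the
      extreme value is approached along \<open>lambda_max (x ** mat_star x) + e\<close>.\<close>
    proof (rule ereal_le_epsilon2)
      fix e :: real assume "0 < e"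
      then obtain z where "positive_definite z" "positive_definite (gap z)"
        "lambda_max (lehner z) \<le> lambda_max (x ** mat_star x) + e"
        using lehner_attains_max[of "lambda_max (x ** mat_star x) + e"] by auto
      then show "(INF z \<in> {z. positive_definite z \<and> positive_definite (gap z)}. ereal (lambda_max (lehner z)))
          \<le> ereal (lambda_max (x ** mat_star x)) + ereal e"
        by (intro INF_lower2[of z]) auto
    qed
    show "(SUP z \<in> {z. positive_definite (- z)}. ereal (lambda_min (lehner z))) \<le> ereal (lambda_min (x ** mat_star x))"
      by (rule SUP_least) (simp add: lehner_le_lambda_min_gram)
    show "ereal (lambda_min (x ** mat_star x)) \<le> (SUP z \<in> {z. positive_definite (- z)}. ereal (lambda_min (lehner z)))"
    proof (rule ereal_le_epsilon2)
      fix e :: real assume "0 < e"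
      then obtain z where z: "positive_definite (- z)" "lambda_min (x ** mat_star x) - e \<le> lambda_min (lehner z)"
        using lehner_attains_min[of "lambda_min (x ** mat_star x) - e"] by auto
      have "ereal (lambda_min (lehner z)) \<le> (SUP z \<in> {z. positive_definite (- z)}. ereal (lambda_min (lehner z)))"
        using z(1) by (intro SUP_upper) simp
      then have "ereal (lambda_min (lehner z)) + ereal e \<le>
          (SUP z \<in> {z. positive_definite (- z)}. ereal (lambda_min (lehner z))) + ereal e"
        by (rule add_right_mono)
      moreover have "ereal (lambda_min (x ** mat_star x)) \<le> ereal (lambda_min (lehner z)) + ereal e"
        using z(2) by simp
      ultimately show "ereal (lambda_min (x ** mat_star x)) \<le>
          (SUP z \<in> {z. positive_definite (- z)}. ereal (lambda_min (lehner z))) + ereal e"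
        by (rule order_trans[rotated])
    qed
  qed
qed

end
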